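(* Let $K\in\mathbb{N}$, $0<\tau_1<\cdots<\tau_K$ and $A_0,\dots,A_K\in\mathbb{R}^{n\times n}$. Suppose that there exist $S_i\in W_2^{n\times n}[-\tau_i,0]$ and $R_{ij}\in W_2^{n\times n}\left[[-\tau_i,0]\times[-\tau_j,0]\right]$ such that $S_i(s)=S_i(s)^T$ and $R_{ij}(s,\theta)=R_{ji}(\theta,s)^T$, and let $P$ and $Q_j$ satisfy $P=\tau_KQ_i(0)^T + \tau_KS_i(0)$ and $Q_j(s)=R_{ij}(0,s)$ for all $i,j\in\{1,\dots,K\}$. Suppose that for some $\epsilon>0$, $\langle z,\mathcal{P}z\rangle_{Z_{n,K}} \ge \epsilon \|z\|_{Z_{n,K}}^2$ for all $z \in X$, and that $$\left\langle\begin{bmatrix} v\\ \phi_i\end{bmatrix},\mathcal{D}\begin{bmatrix}v\\ \phi_i\end{bmatrix}\right\rangle_{Z_{n(K+1),n,K}}\le- \left\|\begin{bmatrix}x \\ \phi_i\end{bmatrix}\right\|_{Z_{n,K}}^2,\qquad v:=\begin{bmatrix}x \\ \phi_1(-\tau_1) \\ \vdots \\ \phi_K(-\tau_K)\end{bmatrix},$$ for all $\begin{bmatrix}x\\ \phi_i\end{bmatrix} \in X$, where $$\left(\mathcal{P} \begin{bmatrix}x\\ \phi_i\end{bmatrix}\right)(s) =\begin{bmatrix} P x + \sum_{i=1}^K \int_{-\tau_i}^0 Q_i(\theta)\phi_i(\theta)\, d \theta \\ \tau_K Q_i(s)^T x + \tau_K S_i(s)\phi_i(s) + \sum_{j=1}^K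 \int_{-\tau_j}^0 R_{ij}(s,\theta)\phi_j(\theta)\,d \theta \end{bmatrix}$$ and $$\left(\mathcal{D}\begin{bmatrix}v\\ \phi_i\end{bmatrix}\right)(s)=\begin{bmatrix}\begin{bmatrix}C_0 & C_{1} & \cdots &C_{K} \\C_{1}^T &-S_1(-\tau_1) & 0&0 \\ \vdots&0&\ddots&0 \\ C_{K}^T &0&0&-S_K(-\tau_K)\end{bmatrix}v + \sum_{i=1}^K\int_{-\tau_i}^0 \begin{bmatrix}B_{i}(\theta)\\ 0 \\ \vdots \\ 0\end{bmatrix}\phi_i(\theta)\,d\theta \\ \tau_K B_{i}(s)^T x + \tau_K \dot S_i(s)\phi_i(s)+\sum_{j=1}^K \int_{-\tau_j}^0G_{ij}(s,\theta)\phi_j(\theta)\, d \theta \end{bmatrix}$$ with $$C_0:= A_0 P + PA_0^T + \sum_{i=1}^K \big( \tau_K A_i Q_i(-\tau_i)^T+ \tau_K Q_i(-\tau_i)A_i^T + S_i(0)\big),\qquad C_{i}:=\tau_K A_iS_i(-\tau_i),$$ $$B_{i}(s):=A_0 Q_i(s) +\dot Q_i(s)+\sum_{j=1}^K A_jR_{ji}(-\tau_j,s),\qquad G_{ij}(s,\theta):=\frac{\partial}{\partial s}R_{ij}(s,\theta)+\frac{\partial}{\partial \theta}R_{ji}(\theta,s)^T .$$ Then the system $$\dot x(t)=A_0x(t)+\sum_{i=1}^KA_ix(t-\tau_i),\quad t\ge0,\qquad x(t)=\phi_0(t),\quad t\in[-\tau_K,0],$$ with $\phi_0\in\mathcal{C}[-\tau_K,0]$,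 is exponentially stable.
   Context: $L_2^m[D]$ denotes the square-integrable functions $D\to\mathbb{R}^m$ and $W_2^m[D]=\{x: x,\dot x\in L_2^m[D]\}$; $W_2^{n\times m}$ is the matrix-valued analogue (for functions of two variables, first-order partial derivatives in $L_2$). Functions in $W_2$ are regarded as continuous, and $Q_i,S_i,R_{ij}$ are assumed sufficiently smooth that the one-variable sections that occur (e.g. $s\mapsto R_{ij}(0,s)$) are well defined and lie in $W_2$. $\mathcal{C}[-\tau_K,0]$ is the space of continuous functions $[-\tau_K,0]\to\mathbb{R}^n$. $Z_{m,n,K}:=\mathbb{R}^m\times L_2^n[-\tau_1,0]\times\cdots\times L_2^n[-\tau_K,0]$ and $Z_{n,K}:=Z_{n,n,K}$; elements $\{x,\phi_1,\dots,\phi_K\}$ are written $\begin{bmatrix} x\\ \phi_i\end{bmatrix}$, and the second row in the formula for an operator specifies the component with index $i$, for $s\in[-\tau_i,0]$, for each $i\in\{1,\dots,K\}$. The inner product is $$\left\langle \begin{bmatrix} y\\ \psi_i\end{bmatrix},\begin{bmatrix} x\\ \phi_i\end{bmatrix}\right\rangle_{Z_{m,n,K}}=\tau_K y^Tx+\sum_{i=1}^K\int_{-\tau_i}^0\psi_i(s)^T\phi_i(s)\,ds .$$ The state space is $X:=\{\begin{bmatrix} x\\ \phi_i\end{bmatrix}\in Z_{n,K}: \phi_i\in W_2^n[-\tau_i,0] \text{ and } \phi_i(0)=x \text{ for all } i\}$. Exponential stability of the delay system: there are $M,\beta>0$ such that every solution satisfies $\|x(t)\|\le Me^{-\beta t}\sup_{s\in[-\tau_K,0]}\|\phi_0(s)\|$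 for all $t\ge0$. *)

theory Defs
  imports "HOL-Analysis.Analysis"
begin

text \<open>Square integrability is stated for Borel functions; every Lebesgue class has such a
  representative.\<close>

definition L2 :: "'a::euclidean_space set \<Rightarrow> ('a \<Rightarrow> 'b::euclidean_space) set" where
  "L2 D = {f. set_borel_measurable lborel D f \<and> set_integrable lborel D (\<lambda>x. (norm (f x))\<^sup>2)}"

text \<open>Test functions are the \<open>C\<^sup>1\<close> functions whose support is compact and contained in
  the interior of the domain.\<close>

definition test_function :: "'a::euclidean_space set \<Rightarrow> ('a \<Rightarrow> real) \<Rightarrow> bool" where
  "test_function D \<eta> \<longleftrightarrow>
     (\<forall>x. \<eta> differentiable at x) \<and>
     (\<forall>b\<in>Basis. continuous_on UNIV (\<lambda>x. frechet_derivative \<eta> (at x) b)) \<and>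
     (\<exists>C. compact C \<and> C \<subseteq> interior D \<and> (\<forall>x. x \<notin> C \<longrightarrow> \<eta> x = 0))"

text \<open>\<open>g\<close> is a square-integrable weak partial derivative of \<open>f\<close> on \<open>D\<close>
  in the coordinate direction \<open>b\<close>.\<close>

definition has_weak_partial ::
  "('a::euclidean_space \<Rightarrow> 'b::euclidean_space) \<Rightarrow> ('a \<Rightarrow> 'b) \<Rightarrow> 'a \<Rightarrow> 'a set \<Rightarrow> bool" where
  "has_weak_partial f g b D \<longleftrightarrow> g \<in> L2 D \<and>
     (\<forall>\<eta>. test_function D \<eta> \<longrightarrow>
        (LINT x:D|lborel. frechet_derivative \<eta> (at x) b *\<^sub>R f x)
          = - (LINT x:D|lborel. \<eta> x *\<^sub>R g x))"

text \<open>The first-order Sobolev space, with its elements taken to be continuous.  The domains of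
  interest are intervals in \<^typ>\<open>real\<close>, where \<^term>\<open>Basis = {1::real}\<close>, and rectangles in
  \<^typ>\<open>real \<times> real\<close>.\<close>

definition W2 :: "'a::euclidean_space set \<Rightarrow> ('a \<Rightarrow> 'b::euclidean_space) set" where
  "W2 D = {f. f \<in> L2 D \<and> continuous_on D f \<and> (\<forall>b\<in>Basis. \<exists>g. has_weak_partial f g b D)}"

text \<open>Weak derivatives are determined only up to a null set; below they occur only under
  integrals, so that the choice is immaterial.\<close>

definition weak_partial ::
  "'a::euclidean_space \<Rightarrow> 'a set \<Rightarrow> ('a \<Rightarrow> 'b::euclidean_space) \<Rightarrow> 'a \<Rightarrow> 'b" where
  "weak_partial b D f = (SOME g. has_weak_partial f g b D)"

text \<open>An element \<open>(x, \<phi>)\<close> of \<open>Z\<^bsub>m,n,K\<^esub>\<close> has the history components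
  \<open>\<phi> 1, \<dots>, \<phi> K\<close>, with \<open>\<phi> i\<close> considered on \<open>[-\<tau> i, 0]\<close>.
  The type \<open>'m\<close> of the finite-dimensional part is either \<open>real ^ 'n\<close> or, for
  \<open>m = n(K+1)\<close>, the type \<open>nat \<Rightarrow> real ^ 'n\<close> of block vectors, of which only
  the blocks \<open>0, \<dots>, K\<close> are relevant.  The argument \<open>ip\<close> is the Euclidean inner
  product of this part.\<close>

type_synonym ('m, 'n) zstate = "'m \<times> (nat \<Rightarrow> real \<Rightarrow> real ^ 'n)"

definition Z_space :: "nat \<Rightarrow> (nat \<Rightarrow> real) \<Rightarrow> ('m, 'n::finite) zstate set" where
  "Z_space K \<tau> = {(x, \<phi>). \<forall>i\<in>{1..K}. \<phi> i \<in> L2 {-\<tau> i..0}}"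

definition Z_inner ::
  "('m \<Rightarrow> 'm \<Rightarrow> real) \<Rightarrow> nat \<Rightarrow> (nat \<Rightarrow> real) \<Rightarrow>
   ('m, 'n::finite) zstate \<Rightarrow> ('m, 'n) zstate \<Rightarrow> real" where
  "Z_inner ip K \<tau> = (\<lambda>(y, \<psi>) (x, \<phi>).
     \<tau> K * ip y x + (\<Sum>i=1..K. LINT s:{-\<tau> i..0}|lborel. \<psi> i s \<bullet> \<phi> i s))"

definition block_inner :: "nat \<Rightarrow> (nat \<Rightarrow> real ^ 'n::finite) \<Rightarrow> (nat \<Rightarrow> real ^ 'n) \<Rightarrow> real" where
  "block_inner K u v = (\<Sum>k=0..K. u k \<bullet> v k)"

definition Z_norm :: "nat \<Rightarrow> (nat \<Rightarrow> real) \<Rightarrow> (real ^ 'n::finite, 'n) zstate \<Rightarrow> real" where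
  "Z_norm K \<tau> z = sqrt (Z_inner inner K \<tau> z z)"

definition X_space :: "nat \<Rightarrow> (nat \<Rightarrow> real) \<Rightarrow> (real ^ 'n::finite, 'n) zstate set" where
  "X_space K \<tau> = {(x, \<phi>). (x, \<phi>) \<in> Z_space K \<tau> \<and>
     (\<forall>i\<in>{1..K}. \<phi> i \<in> W2 {-\<tau> i..0} \<and> \<phi> i 0 = x)}"

definition P_op ::
  "nat \<Rightarrow> (nat \<Rightarrow> real) \<Rightarrow> real ^ 'n::finite ^ 'n \<Rightarrow> (nat \<Rightarrow> real \<Rightarrow> real ^ 'n ^ 'n) \<Rightarrow>
   (nat \<Rightarrow> real \<Rightarrow> real ^ 'n ^ 'n) \<Rightarrow> (nat \<Rightarrow> nat \<Rightarrow> real \<times> real \<Rightarrow> real ^ 'n ^ 'n) \<Rightarrow>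
   (real ^ 'n, 'n) zstate \<Rightarrow> (real ^ 'n, 'n) zstate" where
  "P_op K \<tau> P Q S R = (\<lambda>(x, \<phi>).
     (P *v x + (\<Sum>i=1..K. LINT \<theta>:{-\<tau> i..0}|lborel. Q i \<theta> *v \<phi> i \<theta>),
      \<lambda>i s. \<tau> K *\<^sub>R (transpose (Q i s) *v x) + \<tau> K *\<^sub>R (S i s *v \<phi> i s)
        + (\<Sum>j=1..K. LINT \<theta>:{-\<tau> j..0}|lborel. R i j (s, \<theta>) *v \<phi> j \<theta>)))"

definition C0_mat ::
  "nat \<Rightarrow> (nat \<Rightarrow> real) \<Rightarrow> (nat \<Rightarrow> real ^ 'n::finite ^ 'n) \<Rightarrow> real ^ 'n ^ 'n \<Rightarrow>
   (nat \<Rightarrow> real \<Rightarrow> real ^ 'n ^ 'n) \<Rightarrow> (nat \<Rightarrow> real \<Rightarrow> real ^ 'n ^ 'n) \<Rightarrow> real ^ 'n ^ 'n" where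
  "C0_mat K \<tau> A P Q S = A 0 ** P + P ** transpose (A 0)
     + (\<Sum>i=1..K. \<tau> K *\<^sub>R (A i ** transpose (Q i (-\<tau> i)))
          + \<tau> K *\<^sub>R (Q i (-\<tau> i) ** transpose (A i)) + S i 0)"

definition C_mat ::
  "nat \<Rightarrow> (nat \<Rightarrow> real) \<Rightarrow> (nat \<Rightarrow> real ^ 'n::finite ^ 'n) \<Rightarrow> (nat \<Rightarrow> real \<Rightarrow> real ^ 'n ^ 'n) \<Rightarrow>
   nat \<Rightarrow> real ^ 'n ^ 'n" where
  "C_mat K \<tau> A S i = \<tau> K *\<^sub>R (A i ** S i (-\<tau> i))"

definition B_fun ::
  "nat \<Rightarrow> (nat \<Rightarrow> real) \<Rightarrow> (nat \<Rightarrow> real ^ 'n::finite ^ 'n) \<Rightarrow> (nat \<Rightarrow> real \<Rightarrow> real ^ 'n ^ 'n) \<Rightarrow>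
   (nat \<Rightarrow> nat \<Rightarrow> real \<times> real \<Rightarrow> real ^ 'n ^ 'n) \<Rightarrow> nat \<Rightarrow> real \<Rightarrow> real ^ 'n ^ 'n" where
  "B_fun K \<tau> A Q R i s = A 0 ** Q i s + weak_partial 1 {-\<tau> i..0} (Q i) s
     + (\<Sum>j=1..K. A j ** R j i (-\<tau> j, s))"

text \<open>The second summand is \<open>\<partial>/\<partial>\<theta>\<close> of \<open>R j i (\<theta>, s)\<close>, transposed:
  \<open>\<theta>\<close> is the first argument of \<open>R j i\<close>.\<close>

definition G_fun ::
  "(nat \<Rightarrow> real) \<Rightarrow> (nat \<Rightarrow> nat \<Rightarrow> real \<times> real \<Rightarrow> real ^ 'n::finite ^ 'n) \<Rightarrow>
   nat \<Rightarrow> nat \<Rightarrow> real \<Rightarrow> real \<Rightarrow> real ^ 'n ^ 'n" where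
  "G_fun \<tau> R i j s \<theta> = weak_partial (1, 0) ({-\<tau> i..0} \<times> {-\<tau> j..0}) (R i j) (s, \<theta>)
     + transpose (weak_partial (1, 0) ({-\<tau> j..0} \<times> {-\<tau> i..0}) (R j i) (\<theta>, s))"

definition D_block ::
  "nat \<Rightarrow> (nat \<Rightarrow> real) \<Rightarrow> (nat \<Rightarrow> real ^ 'n::finite ^ 'n) \<Rightarrow> real ^ 'n ^ 'n \<Rightarrow>
   (nat \<Rightarrow> real \<Rightarrow> real ^ 'n ^ 'n) \<Rightarrow> (nat \<Rightarrow> real \<Rightarrow> real ^ 'n ^ 'n) \<Rightarrow>
   nat \<Rightarrow> nat \<Rightarrow> real ^ 'n ^ 'n" where
  "D_block K \<tau> A P Q S k l =
     (if k = 0 \<and> l = 0 then C0_mat K \<tau> A P Q S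
      else if k = 0 then C_mat K \<tau> A S l
      else if l = 0 then transpose (C_mat K \<tau> A S k)
      else if k = l then - S k (-\<tau> k)
      else 0)"

definition D_op ::
  "nat \<Rightarrow> (nat \<Rightarrow> real) \<Rightarrow> (nat \<Rightarrow> real ^ 'n::finite ^ 'n) \<Rightarrow> real ^ 'n ^ 'n \<Rightarrow>
   (nat \<Rightarrow> real \<Rightarrow> real ^ 'n ^ 'n) \<Rightarrow> (nat \<Rightarrow> real \<Rightarrow> real ^ 'n ^ 'n) \<Rightarrow>
   (nat \<Rightarrow> nat \<Rightarrow> real \<times> real \<Rightarrow> real ^ 'n ^ 'n) \<Rightarrow>
   (nat \<Rightarrow> real ^ 'n, 'n) zstate \<Rightarrow> (nat \<Rightarrow> real ^ 'n, 'n) zstate" where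
  "D_op K \<tau> A P Q S R = (\<lambda>(v, \<phi>).
     (\<lambda>k. (\<Sum>l=0..K. D_block K \<tau> A P Q S k l *v v l)
        + (\<Sum>i=1..K. LINT \<theta>:{-\<tau> i..0}|lborel. (if k = 0 then B_fun K \<tau> A Q R i \<theta> else 0) *v \<phi> i \<theta>),
      \<lambda>i s. \<tau> K *\<^sub>R (transpose (B_fun K \<tau> A Q R i s) *v v 0)
        + \<tau> K *\<^sub>R (weak_partial 1 {-\<tau> i..0} (S i) s *v \<phi> i s)
        + (\<Sum>j=1..K. LINT \<theta>:{-\<tau> j..0}|lborel. G_fun \<tau> R i j s \<theta> *v \<phi> j \<theta>)))"

text \<open>The vector \<open>v\<close> with blocks \<open>x, \<phi> 1 (-\<tau> 1), \<dots>, \<phi> K (-\<tau> K)\<close>.\<close>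

definition boundary_vec ::
  "(nat \<Rightarrow> real) \<Rightarrow> real ^ 'n::finite \<Rightarrow> (nat \<Rightarrow> real \<Rightarrow> real ^ 'n) \<Rightarrow> nat \<Rightarrow> real ^ 'n" where
  "boundary_vec \<tau> x \<phi> k = (if k = 0 then x else \<phi> k (-\<tau> k))"

text \<open>The derivative at \<open>t = 0\<close> is the right-hand one.\<close>

definition delay_solution ::
  "nat \<Rightarrow> (nat \<Rightarrow> real) \<Rightarrow> (nat \<Rightarrow> real ^ 'n::finite ^ 'n) \<Rightarrow> (real \<Rightarrow> real ^ 'n) \<Rightarrow>
   (real \<Rightarrow> real ^ 'n) \<Rightarrow> bool" where
  "delay_solution K \<tau> A \<phi>\<^sub>0 x \<longleftrightarrow>
     (\<forall>t\<in>{-\<tau> K..0}. x t = \<phi>\<^sub>0 t) \<and>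
     (\<forall>t\<ge>0. (x has_vector_derivative (A 0 *v x t + (\<Sum>i=1..K. A i *v x (t - \<tau> i))))
        (at t within {0..}))"

definition exponentially_stable ::
  "nat \<Rightarrow> (nat \<Rightarrow> real) \<Rightarrow> (nat \<Rightarrow> real ^ 'n::finite ^ 'n) \<Rightarrow> bool" where
  "exponentially_stable K \<tau> A \<longleftrightarrow>
     (\<exists>M>0. \<exists>\<beta>>0. \<forall>\<phi>\<^sub>0 x.
        continuous_on {-\<tau> K..0} \<phi>\<^sub>0 \<longrightarrow> delay_solution K \<tau> A \<phi>\<^sub>0 x \<longrightarrow>
        (\<forall>t\<ge>0. norm (x t) \<le> M * exp (-\<beta> * t) * (SUP s\<in>{-\<tau> K..0}. norm (\<phi>\<^sub>0 s))))"

end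

theory Submission imports Defs begin

text \<open>
  Writing the delay equation as \<open>w' = \<A> w\<close> for the history \<open>w t = (x t, x (t + \<cdot>))\<close>, integration by
  parts shows that the hypothesis on \<open>\<D>\<close> says \<open>2 \<langle>z, \<A> \<P> z\<rangle> \<le> - \<parallel>z\<parallel>\<^sup>2\<close>.  It is thus a
  condition on the dual system, and the Lyapunov function is \<open>V w = \<langle>w, \<P>\<^sup>-\<^sup>1 w\<rangle>\<close> rather than
  \<open>\<langle>w, \<P> w\<rangle>\<close>: with \<open>z = \<P>\<^sup>-\<^sup>1 w\<close>, self-adjointness of \<open>\<P>\<close> gives
  \<open>V' = 2 \<langle>z, w'\<rangle> = 2 \<langle>z, \<A> \<P> z\<rangle> \<le> - \<parallel>z\<parallel>\<^sup>2\<close>, while coercivity and boundedness of \<open>\<P>\<close> make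
  \<open>V\<close>, \<open>\<parallel>z\<parallel>\<^sup>2\<close> and \<open>\<parallel>w\<parallel>\<^sup>2\<close> comparable.

  The inverse of \<open>\<P>\<close> is constructed on continuous histories whose components agree at \<open>0\<close>.  Since
  neither quadratic form contains a derivative of the history, both inequalities extend from \<open>X\<close> to
  such histories by density, so that no regularity of \<open>\<P>\<^sup>-\<^sup>1 w\<close> beyond continuity is needed.
\<close>

section \<open>Set integrals and matrix-valued functions\<close>

text \<open>The obstacle is that \<open>\<phi> = z t\<close> cannot be differentiated in the
  integration by parts. What is absolutely continuous are the coefficients and, once
  \<open>t\<close> exceeds \<open>\<tau> K\<close> and the whole history of the solution is
  continuously differentiable, the image \<open>T \<phi>\<close>. Solving the definition of
  \<open>T\<close> for \<open>S i s *v \<phi> i s\<close> shows that this product is absolutely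
  continuous too, and a product rule that uses only the increments of \<open>S\<close> and of
  \<open>S \<phi>\<close> does the rest. An inverse in the Hilbert space alone would not stay among
  continuous histories. Testing coercivity on narrow bumps therefore extracts the pointwise bound
  that \<open>\<tau> K *\<^sub>R S i s\<close> is at least \<open>\<epsilon>\<close> as a quadratic
  form. With it, one step size makes the iteration contract both pointwise and in the Hilbert norm.
  Before time \<open>\<tau> K\<close> the history still contains the merely continuous initial
  function, so the decay argument starts later, and a crude growth bound covers the initial
  stretch.\<close>

lemma bounded_bilinear_matrix_vector_mult:
  "bounded_bilinear ((*v) :: real ^ 'n::finite ^ 'm::finite \<Rightarrow> real ^ 'n \<Rightarrow> real ^ 'm)"
proof -
  have "bilinear ((*v) :: real ^ 'n ^ 'm \<Rightarrow> real ^ 'n \<Rightarrow> real ^ 'm)"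
    unfolding bilinear_def
    by (intro conjI allI linearI)
      (auto simp: matrix_vector_mult_add_rdistrib matrix_vector_right_distrib
        scaleR_matrix_vector_assoc[symmetric] matrix_vector_mult_scaleR)
  then show ?thesis by (simp add: bilinear_conv_bounded_bilinear)
qed

lemmas continuous_on_matrix_vector_mult [continuous_intros] =
  bounded_bilinear.continuous_on[OF bounded_bilinear_matrix_vector_mult]

lemma bounded_linear_transpose:
  "bounded_linear (transpose :: real ^ 'n::finite ^ 'm::finite \<Rightarrow> real ^ 'm ^ 'n)"
  by (intro linear_conv_bounded_linear[THEN iffD1] linearI)
    (auto simp: transpose_def vec_eq_iff)

lemmas continuous_on_transpose [continuous_intros] =
  bounded_linear.continuous_on[OF bounded_linear_transpose]

lemma inner_matrix_vector_transpose:
  fixes A :: "real ^ 'n::finite ^ 'm::finite"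
  shows "x \<bullet> (A *v y) = (transpose A *v x) \<bullet> y"
  by (simp add: transpose_matrix_vector dot_lmul_matrix)

text \<open>A compact set has finite measure, so \<open>1 + (norm (f x))\<^sup>2\<close> is an
  integrable majorant.\<close>

lemma set_integrable_of_L2:
  fixes f :: "'a::euclidean_space \<Rightarrow> 'b::euclidean_space"
  assumes "f \<in> L2 D" "compact D"
  shows "set_integrable lborel D f"
proof (rule set_integrable_bound)
  show "set_integrable lborel D (\<lambda>x. 1 + (norm (f x))\<^sup>2)"
    using assms borel_integrable_compact[OF \<open>compact D\<close>, of "\<lambda>_. 1::real"]
    by (intro set_integral_add) (auto simp: L2_def set_integrable_def)
  show "set_borel_measurable lborel D f" using assms by (auto simp: L2_def)
  have "norm (f x) \<le> norm (1 + (norm (f x))\<^sup>2)" for x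
    using sum_squares_bound[of "norm (f x)" 1] by (smt (verit) norm_ge_zero power_one real_norm_def)
  then show "AE x in lborel. x \<in> D \<longrightarrow> norm (f x) \<le> norm (1 + (norm (f x))\<^sup>2)" by auto
qed

text \<open>The continuous factor is bounded on the compact set, so a multiple of \<open>g\<close>
  dominates the product. This is how weak derivatives, used only as integrable functions, are paired
  with continuous histories.\<close>

lemma set_integrable_bilinear:
  fixes g :: "'a::euclidean_space \<Rightarrow> 'b::euclidean_space" and h :: "'a \<Rightarrow> 'c::euclidean_space"
    and p :: "'b \<Rightarrow> 'c \<Rightarrow> 'd::euclidean_space"
  assumes p: "bounded_bilinear p" and g: "set_integrable lborel D g"
    and D: "compact D" and h: "continuous_on D h"
  shows "set_integrable lborel D (\<lambda>x. p (g x) (h x))"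
proof -
  interpret bounded_bilinear p by fact
  obtain C where C: "\<And>a b. norm (p a b) \<le> norm a * norm b * C" "0 \<le> C"
    using nonneg_bounded by blast
  obtain B where B: "\<And>x. x \<in> D \<Longrightarrow> norm (h x) \<le> B"
    using compact_imp_bounded[OF compact_continuous_image[OF h D]] by (auto simp: bounded_iff)
  have eq: "(\<lambda>x. indicator D x *\<^sub>R p (g x) (h x)) =
      (\<lambda>x. p (indicator D x *\<^sub>R g x) (indicator D x *\<^sub>R h x))"
    by (auto simp: indicator_def zero_left)
  have mp: "(\<lambda>x. p (fst x) (snd x)) \<in> borel_measurable borel"
    by (intro borel_measurable_continuous_onI continuous_on continuous_intros)
  have mg: "(\<lambda>x. indicator D x *\<^sub>R g x) \<in> borel_measurable lborel"
    using g unfolding set_integrable_def by (rule borel_measurable_integrable)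
  have mh: "(\<lambda>x. indicator D x *\<^sub>R h x) \<in> borel_measurable lborel"
    using set_measurable_continuous_on[OF borel_compact[OF D] h] by (simp add: set_borel_measurable_def)
  have m: "set_borel_measurable lborel D (\<lambda>x. p (g x) (h x))"
    unfolding set_borel_measurable_def eq
    using measurable_compose[OF borel_measurable_Pair[OF mg mh] mp] by simp
  show ?thesis
  proof (rule set_integrable_bound[OF _ m])
    show "set_integrable lborel D (\<lambda>x. (C * B) *\<^sub>R g x)" using g by auto
    have "norm (p (g x) (h x)) \<le> norm ((C * B) *\<^sub>R g x)" if "x \<in> D" for x
    proof -
      have "norm (p (g x) (h x)) \<le> norm (g x) * norm (h x) * C" by (rule C)
      also have "\<dots> \<le> norm (g x) * B * C"
        using B[OF that] C(2) by (intro mult_right_mono mult_left_mono) auto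
      also have "\<dots> \<le> \<bar>C * B\<bar> * norm (g x)" using abs_ge_self[of "C*B"]
        by (metis mult.commute mult.assoc mult_left_mono norm_ge_zero)
      finally show ?thesis by simp
    qed
    then show "AE x in lborel. x \<in> D \<longrightarrow> norm (p (g x) (h x)) \<le> norm ((C * B) *\<^sub>R g x)" by auto
  qed
qed

lemma set_integrable_continuous:
  fixes h :: "'a::euclidean_space \<Rightarrow> 'b::euclidean_space"
  assumes "compact D" "continuous_on D h"
  shows "set_integrable lborel D h"
  unfolding set_integrable_def by (intro borel_integrable_compact assms)

lemma set_integral_bounded_linear:
  fixes f :: "'a \<Rightarrow> 'b::euclidean_space" and L :: "'b \<Rightarrow> 'c::euclidean_space"
  assumes L: "bounded_linear L" and f: "set_integrable M D f"
  shows "set_integrable M D (\<lambda>x. L (f x))" "(LINT x:D|M. L (f x)) = L (LINT x:D|M. f x)"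
proof -
  have eq: "(\<lambda>x. indicator D x *\<^sub>R L (f x)) = (\<lambda>x. L (indicator D x *\<^sub>R f x))"
    using bounded_linear.linear[OF L] by (simp add: linear_scale)
  show "set_integrable M D (\<lambda>x. L (f x))"
    using integrable_bounded_linear[OF L] f unfolding set_integrable_def eq by blast
  show "(LINT x:D|M. L (f x)) = L (LINT x:D|M. f x)"
    using integral_bounded_linear[OF L] f unfolding set_integrable_def set_lebesgue_integral_def eq by blast
qed

lemma set_integral_sum:
  fixes f :: "'i \<Rightarrow> 'a \<Rightarrow> 'b::euclidean_space"
  assumes "\<And>i. i \<in> I \<Longrightarrow> set_integrable M D (f i)"
  shows "set_integrable M D (\<lambda>x. \<Sum>i\<in>I. f i x)"
    "(LINT x:D|M. (\<Sum>i\<in>I. f i x)) = (\<Sum>i\<in>I. LINT x:D|M. f i x)"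
  using assms unfolding set_integrable_def set_lebesgue_integral_def
  by (auto simp: scaleR_sum_right intro!: Bochner_Integration.integral_sum)

lemma set_integral_dominated_convergence:
  fixes f :: "nat \<Rightarrow> 'a \<Rightarrow> 'b::euclidean_space"
  assumes f: "\<And>n. set_integrable M D (f n)" and g: "set_integrable M D g"
    and w: "set_integrable M D w"
    and lim: "AE x in M. x \<in> D \<longrightarrow> (\<lambda>n. f n x) \<longlonglongrightarrow> g x"
    and bound: "\<And>n x. x \<in> D \<Longrightarrow> norm (f n x) \<le> w x"
  shows "(\<lambda>n. LINT x:D|M. f n x) \<longlonglongrightarrow> (LINT x:D|M. g x)"
  unfolding set_lebesgue_integral_def
proof (rule integral_dominated_convergence[where w = "\<lambda>x. indicator D x *\<^sub>R w x"])
  show "AE x in M. (\<lambda>n. indicator D x *\<^sub>R f n x) \<longlonglongrightarrow> indicator D x *\<^sub>R g x"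
    using lim by eventually_elim (auto simp: indicator_def)
qed (use f g w bound in \<open>auto simp: set_integrable_def indicator_def dest!: borel_measurable_integrable\<close>)

lemma norm_set_integral_le:
  fixes f :: "'a \<Rightarrow> 'b::euclidean_space"
  shows "norm (LINT x:D|M. f x) \<le> (LINT x:D|M. norm (f x))"
proof -
  have "norm (LINT x:D|M. f x) \<le> (LINT x|M. norm (indicator D x *\<^sub>R f x))"
    unfolding set_lebesgue_integral_def by (rule integral_norm_bound)
  also have "\<dots> = (LINT x:D|M. norm (f x))"
    unfolding set_lebesgue_integral_def by (intro Bochner_Integration.integral_cong) (auto simp: indicator_def)
  finally show ?thesis .
qed

lemma set_integrable_norm:
  fixes f :: "'a \<Rightarrow> 'b::euclidean_space"
  assumes "set_integrable M D f"
  shows "set_integrable M D (\<lambda>x. norm (f x))"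
proof -
  have "(\<lambda>x. indicator D x *\<^sub>R norm (f x)) = (\<lambda>x. norm (indicator D x *\<^sub>R f x))"
    by (auto simp: indicator_def)
  then show ?thesis using assms unfolding set_integrable_def by (metis integrable_norm)
qed

text \<open>Sections of an integrable function are integrable only almost everywhere. The third
  clause records this for later, when a linear map has to pass through the inner integral.\<close>

lemma set_integral_Fubini:
  fixes f :: "'a::euclidean_space \<times> 'b::euclidean_space \<Rightarrow> 'c::euclidean_space"
  assumes f: "set_integrable lborel (D \<times> D') f"
  shows "set_integrable lborel D (\<lambda>s. LBINT \<theta>:D'. f (s, \<theta>))"
    "(LBINT s:D. LBINT \<theta>:D'. f (s, \<theta>)) = (LBINT z:D \<times> D'. f z)"
    "AE s in lborel. s \<in> D \<longrightarrow> set_integrable lborel D' (\<lambda>\<theta>. f (s, \<theta>))"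
    "set_integrable lborel D' (\<lambda>\<theta>. LBINT s:D. f (s, \<theta>))"
    "(LBINT \<theta>:D'. LBINT s:D. f (s, \<theta>)) = (LBINT z:D \<times> D'. f z)"
proof -
  define h where "h = (\<lambda>z. indicator (D \<times> D') z *\<^sub>R f z)"
  have h: "integrable (lborel \<Otimes>\<^sub>M lborel) h"
    using f unfolding set_integrable_def h_def lborel_prod .
  have h1: "indicator D s *\<^sub>R (LBINT \<theta>:D'. f (s, \<theta>)) = (LINT \<theta>|lborel. h (s, \<theta>))" for s
    unfolding h_def set_lebesgue_integral_def by (auto simp: indicator_def)
  have h2: "indicator D' \<theta> *\<^sub>R (LBINT s:D. f (s, \<theta>)) = (LINT s|lborel. h (s, \<theta>))" for \<theta>
    unfolding h_def set_lebesgue_integral_def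
    by (cases "\<theta> \<in> D'") (auto simp: indicator_def intro!: Bochner_Integration.integral_cong)
  show "set_integrable lborel D (\<lambda>s. LBINT \<theta>:D'. f (s, \<theta>))"
    using lborel_pair.integrable_fst'[OF h] unfolding set_integrable_def h1 .
  show "(LBINT s:D. LBINT \<theta>:D'. f (s, \<theta>)) = (LBINT z:D \<times> D'. f z)"
    using lborel_pair.integral_fst'[OF h] h1
    by (simp add: set_lebesgue_integral_def h_def lborel_prod)
  show "AE s in lborel. s \<in> D \<longrightarrow> set_integrable lborel D' (\<lambda>\<theta>. f (s, \<theta>))"
    using lborel_pair.AE_integrable_fst'[OF h]
    by eventually_elim (auto simp: h_def set_integrable_def indicator_def cong: if_cong)
  have h': "integrable (lborel \<Otimes>\<^sub>M lborel) (\<lambda>(s,\<theta>). h (s,\<theta>))" using h by simp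
  show "set_integrable lborel D' (\<lambda>\<theta>. LBINT s:D. f (s, \<theta>))"
    using lborel_pair.integrable_snd[OF h'] unfolding set_integrable_def h2 .
  show "(LBINT \<theta>:D'. LBINT s:D. f (s, \<theta>)) = (LBINT z:D \<times> D'. f z)"
    using lborel_pair.integral_snd[OF h'] h2
    by (simp add: set_lebesgue_integral_def h_def lborel_prod split_beta')
qed

section \<open>Weak derivatives and primitives\<close>

lemma set_integral_FTC:
  fixes F :: "real \<Rightarrow> 'a::euclidean_space"
  assumes "a \<le> b" "continuous_on {a..b} f"
    "\<And>x. x \<in> {a..b} \<Longrightarrow> (F has_vector_derivative f x) (at x within {a..b})"
  shows "(LBINT x:{a..b}. f x) = F b - F a"
proof -
  have "set_integrable lborel {a..b} f" using assms by (intro set_integrable_continuous) auto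
  then have "(LBINT x:{a..b}. f x) = integral {a..b} f" by (rule set_borel_integral_eq_integral)
  also have "\<dots> = F b - F a"
    using fundamental_theorem_of_calculus[OF assms(1,3)] by (simp add: integral_unique)
  finally show ?thesis .
qed

section \<open>A continuously differentiable step and cutoff functions built from it\<close>

definition tent :: "real \<Rightarrow> real" where
  "tent u = max 0 (1 - \<bar>u\<bar>)"

text \<open>The second difference of \<open>u * \<bar>u\<bar> / 4\<close> plus \<open>1 / 2\<close>: its derivative is the second difference of
  \<open>\<bar>u\<bar> / 2\<close>, which is \<open>tent\<close>.\<close>

definition smooth_step :: "real \<Rightarrow> real" where
  "smooth_step u = ((u + 1) * \<bar>u + 1\<bar> - 2 * (u * \<bar>u\<bar>) + (u - 1) * \<bar>u - 1\<bar> + 2) / 4"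

text \<open>At 0 the difference quotient is \<open>\<bar>h\<bar>\<close>; elsewhere the function
  agrees locally with \<open>sgn u * v\<^sup>2\<close>.\<close>

lemma DERIV_mult_abs: "((\<lambda>u. u * \<bar>u\<bar>) has_real_derivative 2 * \<bar>u\<bar>) (at u)"
proof (cases "u = 0")
  case True
  have "((\<lambda>h::real. \<bar>h\<bar>) \<longlongrightarrow> 0) (at 0)" by (rule tendsto_eq_intros refl)+ simp
  then have "((\<lambda>h::real. h * \<bar>h\<bar> / h) \<longlongrightarrow> 0) (at 0)"
    by (rule Lim_transform_eventually) (auto simp: eventually_at_filter)
  then show ?thesis using True by (simp add: DERIV_def)
next
  case False
  have D: "((\<lambda>v. sgn u * v\<^sup>2) has_real_derivative 2 * \<bar>u\<bar>) (at u)"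
    by (rule derivative_eq_intros refl | simp add: abs_sgn)+
  show ?thesis
  proof (rule has_field_derivative_transform_within_open[OF D])
    show "open (if u > 0 then {0<..} else {..<0::real})" by auto
    show "u \<in> (if u > 0 then {0<..} else {..<0})" using False by auto
    show "sgn u * v\<^sup>2 = v * \<bar>v\<bar>" if "v \<in> (if u > 0 then {0<..} else {..<0})" for v
      using that False by (auto simp: sgn_if power2_eq_square split: if_splits)
  qed
qed

lemma DERIV_smooth_step: "(smooth_step has_real_derivative tent u) (at u)"
proof -
  have *: "((\<lambda>u. (u + c) * \<bar>u + c\<bar>) has_real_derivative 2 * \<bar>u + c\<bar>) (at u)" for c
  proof -
    have "((\<lambda>u. u + c) has_real_derivative 1) (at u)" by (auto intro!: derivative_eq_intros)
    from DERIV_chain2[OF DERIV_mult_abs this] show ?thesis by simp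
  qed
  have "((\<lambda>u. ((u + 1) * \<bar>u + 1\<bar> - 2 * (u * \<bar>u\<bar>) + (u + -1) * \<bar>u + -1\<bar> + 2) / 4)
      has_real_derivative (2 * \<bar>u + 1\<bar> - 2 * (2 * \<bar>u\<bar>) + 2 * \<bar>u + -1\<bar> + 0) / 4) (at u)"
    by (intro DERIV_cdivide DERIV_add DERIV_diff DERIV_cmult DERIV_const * DERIV_mult_abs)
  then have "(smooth_step has_real_derivative (2 * \<bar>u + 1\<bar> - 2 * (2 * \<bar>u\<bar>) + 2 * \<bar>u + -1\<bar> + 0) / 4) (at u)"
    unfolding smooth_step_def[abs_def] by simp
  moreover have "(2 * \<bar>u + 1\<bar> - 2 * (2 * \<bar>u\<bar>) + 2 * \<bar>u + -1\<bar> + 0) / 4 = tent u"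
    by (auto simp: tent_def max_def abs_if)
  ultimately show ?thesis by simp
qed

lemma tent_nonneg: "0 \<le> tent u" by (simp add: tent_def)

lemma tent_eq_0: "1 \<le> \<bar>u\<bar> \<Longrightarrow> tent u = 0" by (simp add: tent_def)

lemma continuous_on_tent [continuous_intros]:
  "continuous_on D f \<Longrightarrow> continuous_on D (\<lambda>x. tent (f x))"
  unfolding tent_def by (intro continuous_intros)

lemma smooth_step_eq_0: "u \<le> -1 \<Longrightarrow> smooth_step u = 0"
  by (simp add: smooth_step_def abs_of_nonpos algebra_simps)

lemma smooth_step_eq_1: "1 \<le> u \<Longrightarrow> smooth_step u = 1"
  by (simp add: smooth_step_def abs_of_nonneg algebra_simps)

lemma smooth_step_mono: "u \<le> v \<Longrightarrow> smooth_step u \<le> smooth_step v"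
  by (rule DERIV_nonneg_imp_nondecreasing) (auto intro: DERIV_smooth_step tent_nonneg)

lemma smooth_step_bounds: "0 \<le> smooth_step u" "smooth_step u \<le> 1"
  using smooth_step_mono[of "min u (-1)" u] smooth_step_mono[of u "max u 1"]
  by (auto simp: smooth_step_eq_0 smooth_step_eq_1)

text \<open>The first step climbs on \<open>[s + \<delta>, s + 3 * \<delta>]\<close>, the second on
  \<open>[t - 3 * \<delta>, t - \<delta>]\<close>. The offsets 2 keep the support at distance
  \<open>\<delta>\<close> inside \<open>(s, t)\<close>, so that the difference is an admissible test
  function even when \<open>s\<close> and \<open>t\<close> are the end points of the domain.\<close>

definition cutoff :: "real \<Rightarrow> real \<Rightarrow> real \<Rightarrow> real \<Rightarrow> real" where
  "cutoff s t \<delta> x = smooth_step ((x - s) / \<delta> - 2) - smooth_step ((x - t) / \<delta> + 2)"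

definition cutoff' :: "real \<Rightarrow> real \<Rightarrow> real \<Rightarrow> real \<Rightarrow> real" where
  "cutoff' s t \<delta> x = tent ((x - s) / \<delta> - 2) / \<delta> - tent ((x - t) / \<delta> + 2) / \<delta>"

lemma DERIV_smooth_step_affine:
  "((\<lambda>x. smooth_step ((x - s) / \<delta> + c)) has_real_derivative tent ((x - s) / \<delta> + c) / \<delta>) (at x)"
proof -
  have "((\<lambda>x. (x - s) / \<delta> + c) has_real_derivative 1 / \<delta>) (at x)"
    by (cases "\<delta> = 0") (auto intro!: derivative_eq_intros)
  from DERIV_chain2[OF DERIV_smooth_step this] show ?thesis by simp
qed

lemma DERIV_cutoff: "(cutoff s t \<delta> has_real_derivative cutoff' s t \<delta> x) (at x)"
  unfolding cutoff_def cutoff'_def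
  using DERIV_diff[OF DERIV_smooth_step_affine[of s \<delta> "-2" x] DERIV_smooth_step_affine[of t \<delta> 2 x]]
  by simp

lemma continuous_on_cutoff': "continuous_on D (cutoff' s t \<delta>)"
  unfolding cutoff'_def divide_inverse by (intro continuous_intros)

lemma continuous_on_cutoff: "continuous_on D (cutoff s t \<delta>)"
  by (meson DERIV_cutoff DERIV_continuous continuous_at_imp_continuous_on)

text \<open>The condition on \<open>\<delta>\<close> puts \<open>s + \<delta>\<close> to the left of
  \<open>t - 3 * \<delta>\<close> and \<open>t - \<delta>\<close> to the right of
  \<open>s + 3 * \<delta>\<close>; outside the interval both steps are thus 0 or both are 1.\<close>

lemma cutoff_eq_0:
  assumes "0 < \<delta>" "4 * \<delta> < t - s" "x \<notin> {s + \<delta>..t - \<delta>}"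
  shows "cutoff s t \<delta> x = 0"
proof (cases "x < s + \<delta>")
  case True
  then have "(x - s) / \<delta> - 2 \<le> -1" "(x - t) / \<delta> + 2 \<le> -1"
    using assms by (auto simp: field_simps)
  then show ?thesis by (simp add: cutoff_def smooth_step_eq_0)
next
  case False
  then have "(x - s) / \<delta> - 2 \<ge> 1" "(x - t) / \<delta> + 2 \<ge> 1"
    using assms by (auto simp: field_simps)
  then show ?thesis by (simp add: cutoff_def smooth_step_eq_1)
qed

lemma cutoff_eq_1:
  assumes "0 < \<delta>" "s + 3 * \<delta> \<le> x" "x \<le> t - 3 * \<delta>"
  shows "cutoff s t \<delta> x = 1"
proof -
  have "(x - s) / \<delta> - 2 \<ge> 1" "(x - t) / \<delta> + 2 \<le> -1"
    using assms by (auto simp: field_simps)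
  then show ?thesis by (simp add: cutoff_def smooth_step_eq_0 smooth_step_eq_1)
qed

lemma abs_cutoff_le: "\<bar>cutoff s t \<delta> x\<bar> \<le> 1"
  unfolding cutoff_def
  using smooth_step_bounds[of "(x - s) / \<delta> - 2"] smooth_step_bounds[of "(x - t) / \<delta> + 2"] by linarith

text \<open>A null sequence that meets the condition \<open>4 * \<delta> < t - s\<close> of
  \<open>cutoff_eq_0\<close> already at index 0, which accounts for the factor 8 and for
  \<open>Suc\<close>.\<close>

definition cut_width :: "real \<Rightarrow> real \<Rightarrow> nat \<Rightarrow> real" where
  "cut_width s t n = (t - s) / (8 * real (Suc n))"

lemma cut_width:
  assumes "s < t"
  shows "0 < cut_width s t n" "4 * cut_width s t n < t - s"
proof -
  show "0 < cut_width s t n" using assms by (simp add: cut_width_def)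
  have "4 * cut_width s t n = (t - s) * (1 / (2 * real (Suc n)))" by (simp add: cut_width_def field_simps)
  also have "\<dots> < (t - s) * 1" using assms by (intro mult_strict_left_mono) auto
  finally show "4 * cut_width s t n < t - s" by simp
qed

lemma cut_width_tendsto: "cut_width s t \<longlonglongrightarrow> 0"
proof -
  have "(\<lambda>n. (t - s) / 8 * inverse (real (Suc n))) \<longlonglongrightarrow> (t - s) / 8 * 0"
    by (intro tendsto_intros LIMSEQ_inverse_real_of_nat)
  then show ?thesis unfolding cut_width_def by (simp add: field_simps)
qed

lemma cutoff_tendsto:
  assumes "s < t"
  shows "(\<lambda>n. cutoff s t (cut_width s t n) x) \<longlonglongrightarrow> indicator {s<..<t} x"
proof (cases "x \<in> {s<..<t}")
  case True
  define r where "r = min (x - s) (t - x) / 3"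
  have "0 < r" using True by (auto simp: r_def)
  then have "eventually (\<lambda>n. cut_width s t n < r) sequentially"
    using cut_width_tendsto order_tendstoD(2) by blast
  then have "eventually (\<lambda>n. cutoff s t (cut_width s t n) x = 1) sequentially"
    by eventually_elim (rule cutoff_eq_1, use cut_width[OF assms] in \<open>auto simp: r_def min_def split: if_splits\<close>)
  then show ?thesis using True by (auto intro: tendsto_eventually)
next
  case False
  have "cutoff s t (cut_width s t n) x = 0" for n
    using False cut_width[OF assms, of n] by (intro cutoff_eq_0) auto
  then show ?thesis using False by simp
qed

section \<open>From weak derivatives to primitives\<close>

lemma weighted_mean_close:
  fixes f :: "real \<Rightarrow> 'a::euclidean_space"
  assumes f: "continuous_on {a..b} f" and k: "continuous_on {a..b} k" "\<And>x. 0 \<le> k x"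
    and int: "(LBINT x:{a..b}. k x) = 1"
    and close: "\<And>x. x \<in> {a..b} \<Longrightarrow> k x \<noteq> 0 \<Longrightarrow> norm (f x - y) \<le> \<omega>"
  shows "norm ((LBINT x:{a..b}. k x *\<^sub>R f x) - y) \<le> \<omega>"
proof -
  have ik: "set_integrable lborel {a..b} (\<lambda>x. k x *\<^sub>R h x)" if "continuous_on {a..b} h" for h :: "real \<Rightarrow> 'b::euclidean_space"
    by (intro set_integrable_continuous continuous_intros k that) auto
  have ik': "set_integrable lborel {a..b} k" using k by (intro set_integrable_continuous) auto
  have "y = (LBINT x:{a..b}. k x *\<^sub>R y)"
    using set_integral_bounded_linear(2)[OF bounded_linear_scaleR_left ik', of y] int by simp
  then have "(LBINT x:{a..b}. k x *\<^sub>R f x) - y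
      = (LBINT x:{a..b}. k x *\<^sub>R f x) - (LBINT x:{a..b}. k x *\<^sub>R y)" by simp
  also have "\<dots> = (LBINT x:{a..b}. k x *\<^sub>R (f x - y))"
    by (subst set_integral_diff(2)[symmetric]) (auto intro!: ik f simp: scaleR_diff_right)
  finally have "norm ((LBINT x:{a..b}. k x *\<^sub>R f x) - y)
      \<le> (LBINT x:{a..b}. norm (k x *\<^sub>R (f x - y)))"
    using norm_set_integral_le by metis
  also have "\<dots> \<le> (LBINT x:{a..b}. k x * \<omega>)"
  proof (rule set_integral_mono)
    show "set_integrable lborel {a..b} (\<lambda>x. norm (k x *\<^sub>R (f x - y)))"
      by (intro set_integrable_norm ik continuous_intros f)
    show "set_integrable lborel {a..b} (\<lambda>x. k x * \<omega>)" using ik' by simp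
    show "norm (k x *\<^sub>R (f x - y)) \<le> k x * \<omega>" if "x \<in> {a..b}" for x
      using close[OF that] k(2)[of x] by (cases "k x = 0") (auto intro: mult_left_mono)
  qed
  also have "\<dots> = \<omega>" using int by simp
  finally show ?thesis .
qed

text \<open>A Dirac sequence: unit mass on supports shrinking to \<open>y\<close>. The kernels may
  be one-sided, so \<open>y\<close> may be an end point.\<close>

lemma weighted_mean_tendsto:
  fixes f :: "real \<Rightarrow> 'a::euclidean_space"
  assumes f: "continuous_on {a..b} f" and y: "y \<in> {a..b}"
    and k: "\<And>n. continuous_on {a..b} (k n)" "\<And>n x. 0 \<le> k n x"
    and int: "\<And>n. (LBINT x:{a..b}. k n x) = 1"
    and supp: "\<And>n x. x \<in> {a..b} \<Longrightarrow> k n x \<noteq> 0 \<Longrightarrow> \<bar>x - y\<bar> \<le> r n" and r: "r \<longlonglongrightarrow> 0"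
  shows "(\<lambda>n. LBINT x:{a..b}. k n x *\<^sub>R f x) \<longlonglongrightarrow> f y"
proof (rule LIMSEQ_I)
  fix e :: real assume "0 < e"
  then obtain d where d: "0 < d" "\<And>x. x \<in> {a..b} \<Longrightarrow> dist x y < d \<Longrightarrow> dist (f x) (f y) < e / 2"
    using f y unfolding continuous_on_iff by (metis half_gt_zero)
  have "eventually (\<lambda>n. r n < d) sequentially" using r d(1) order_tendstoD(2) by blast
  then obtain N where N: "\<And>n. N \<le> n \<Longrightarrow> r n < d" by (auto simp: eventually_sequentially)
  have "norm ((LBINT x:{a..b}. k n x *\<^sub>R f x) - f y) < e" if "N \<le> n" for n
  proof -
    have "norm ((LBINT x:{a..b}. k n x *\<^sub>R f x) - f y) \<le> e / 2"
    proof (rule weighted_mean_close[OF f k int])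
      fix x assume x: "x \<in> {a..b}" "k n x \<noteq> 0"
      have "dist x y < d" using supp[OF x] N[OF that] by (simp add: dist_real_def)
      then show "norm (f x - f y) \<le> e / 2" using d(2)[OF x(1)] by (simp add: dist_norm)
    qed
    then show ?thesis using \<open>0 < e\<close> by linarith
  qed
  then show "\<exists>N. \<forall>n\<ge>N. norm ((LBINT x:{a..b}. k n x *\<^sub>R f x) - f y) < e" by blast
qed

text \<open>Test with the cutoffs of \<open>[s, t]\<close>. Their derivative is the difference of
  two kernels of unit mass that shrink to \<open>s\<close> and to \<open>t\<close>, so the left side
  tends to \<open>f s - f t\<close>; the right side tends to minus the integral of \<open>g\<close>
  by dominated convergence. The weak identity is an explicit hypothesis so that the result serves
  both for elements of \<open>W2\<close> and for integrals depending on a parameter.\<close>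

lemma primitive_of_weak_derivative:
  fixes f g :: "real \<Rightarrow> 'a::euclidean_space"
  assumes f: "continuous_on {a..b} f" and g: "set_integrable lborel {a..b} g"
    and weak: "\<And>\<eta> \<eta>' c d. a < c \<Longrightarrow> d < b \<Longrightarrow> (\<And>x. (\<eta> has_real_derivative \<eta>' x) (at x)) \<Longrightarrow>
      continuous_on UNIV \<eta>' \<Longrightarrow> (\<And>x. x \<notin> {c..d} \<Longrightarrow> \<eta> x = 0) \<Longrightarrow>
      (LBINT x:{a..b}. \<eta>' x *\<^sub>R f x) = - (LBINT x:{a..b}. \<eta> x *\<^sub>R g x)"
    and st: "a \<le> s" "s \<le> t" "t \<le> b"
  shows "f t - f s = (LBINT r:{s..t}. g r)"
proof (cases "s = t")
  case True
  have "(LBINT r:{s..s}. g r) = (LBINT r:{}. g r)"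
    by (rule set_integral_discrete_difference[of "{s}"]) auto
  then show ?thesis using True by (simp add: set_lebesgue_integral_def)
next
  case False
  then have "s < t" using st by simp
  let ?\<delta> = "cut_width s t"
  note \<delta> = cut_width[OF \<open>s < t\<close>]
  define k1 where "k1 = (\<lambda>n x. tent ((x - s) / ?\<delta> n - 2) / ?\<delta> n)"
  define k2 where "k2 = (\<lambda>n x. tent ((x - t) / ?\<delta> n + 2) / ?\<delta> n)"
  have k1c: "continuous_on {a..b} (k1 n)" and k2c: "continuous_on {a..b} (k2 n)" for n
    unfolding k1_def k2_def divide_inverse by (intro continuous_intros)+
  have ab: "a \<le> b" using st by simp
  have fin: "\<bar>u\<bar> < 1" if "tent u \<noteq> 0" for u using tent_eq_0 that by force
  \<comment> \<open>\<open>k1 n\<close> lives between distances \<open>\<delta>\<close> and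
    \<open>3 * \<delta>\<close> to the right of \<open>s\<close>, and \<open>k2 n\<close>
    symmetrically to the left of \<open>t\<close>, where \<open>\<delta>\<close> is the cut
    width.\<close>
  have r0: "(\<lambda>n. 3 * ?\<delta> n) \<longlonglongrightarrow> 0" using tendsto_mult_right_zero[OF cut_width_tendsto] by simp
  have L1: "(\<lambda>n. LBINT x:{a..b}. k1 n x *\<^sub>R f x) \<longlonglongrightarrow> f s"
  proof (rule weighted_mean_tendsto[OF f _ k1c _ _ _ r0])
    show "s \<in> {a..b}" using st by simp
    show "0 \<le> k1 n x" for n x using \<delta>(1)[of n] by (simp add: k1_def tent_nonneg)
    have "(LBINT x:{a..b}. k1 n x) = smooth_step ((b - s) / ?\<delta> n + - 2) - smooth_step ((a - s) / ?\<delta> n + - 2)" for n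
      by (rule set_integral_FTC[OF ab k1c])
        (use DERIV_smooth_step_affine[of s "?\<delta> n" "-2"] in \<open>auto simp: k1_def has_real_derivative_iff_has_vector_derivative intro: has_vector_derivative_at_within\<close>)
    moreover have "(b - s) / ?\<delta> n + - 2 \<ge> 1" "(a - s) / ?\<delta> n + - 2 \<le> -1" for n
      using \<delta>[of n] st by (auto simp: field_simps)
    ultimately show "(LBINT x:{a..b}. k1 n x) = 1" for n
      by (simp add: smooth_step_eq_0 smooth_step_eq_1)
    show "\<bar>x - s\<bar> \<le> 3 * ?\<delta> n" if "x \<in> {a..b}" "k1 n x \<noteq> 0" for n x
      using fin[of "(x - s) / ?\<delta> n - 2"] that \<delta>(1)[of n] by (auto simp: k1_def abs_less_iff field_simps)
  qed
  have L2: "(\<lambda>n. LBINT x:{a..b}. k2 n x *\<^sub>R f x) \<longlonglongrightarrow> f t"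
  proof (rule weighted_mean_tendsto[OF f _ k2c _ _ _ r0])
    show "t \<in> {a..b}" using st by simp
    show "0 \<le> k2 n x" for n x using \<delta>(1)[of n] by (simp add: k2_def tent_nonneg)
    have "(LBINT x:{a..b}. k2 n x) = smooth_step ((b - t) / ?\<delta> n + 2) - smooth_step ((a - t) / ?\<delta> n + 2)" for n
      by (rule set_integral_FTC[OF ab k2c])
        (use DERIV_smooth_step_affine[of t "?\<delta> n" "2"] in \<open>auto simp: k2_def has_real_derivative_iff_has_vector_derivative intro: has_vector_derivative_at_within\<close>)
    moreover have "(b - t) / ?\<delta> n + 2 \<ge> 1" "(a - t) / ?\<delta> n + 2 \<le> -1" for n
      using \<delta>[of n] st by (auto simp: field_simps)
    ultimately show "(LBINT x:{a..b}. k2 n x) = 1" for n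
      by (simp add: smooth_step_eq_0 smooth_step_eq_1)
    show "\<bar>x - t\<bar> \<le> 3 * ?\<delta> n" if "x \<in> {a..b}" "k2 n x \<noteq> 0" for n x
      using fin[of "(x - t) / ?\<delta> n + 2"] that \<delta>(1)[of n] by (auto simp: k2_def abs_less_iff field_simps)
  qed
  have eq: "(LBINT x:{a..b}. k1 n x *\<^sub>R f x) - (LBINT x:{a..b}. k2 n x *\<^sub>R f x)
      = - (LBINT x:{a..b}. cutoff s t (?\<delta> n) x *\<^sub>R g x)" for n
  proof -
    have "(LBINT x:{a..b}. cutoff' s t (?\<delta> n) x *\<^sub>R f x) = - (LBINT x:{a..b}. cutoff s t (?\<delta> n) x *\<^sub>R g x)"
      by (rule weak[of "s + ?\<delta> n" "t - ?\<delta> n"])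
        (use \<delta>[of n] st in \<open>auto intro!: DERIV_cutoff continuous_on_cutoff' cutoff_eq_0\<close>)
    moreover have "(LBINT x:{a..b}. cutoff' s t (?\<delta> n) x *\<^sub>R f x)
        = (LBINT x:{a..b}. k1 n x *\<^sub>R f x - k2 n x *\<^sub>R f x)"
      by (rule set_lebesgue_integral_cong) (auto simp: cutoff'_def k1_def k2_def scaleR_diff_left)
    moreover have "\<dots> = (LBINT x:{a..b}. k1 n x *\<^sub>R f x) - (LBINT x:{a..b}. k2 n x *\<^sub>R f x)"
      by (intro set_integral_diff set_integrable_continuous continuous_intros k1c k2c f) auto
    ultimately show ?thesis by simp
  qed
  have ig: "set_integrable lborel {a..b} (\<lambda>x. indicator {s<..<t} x *\<^sub>R g x)"
  proof -
    have "set_integrable lborel {s<..<t} g" by (rule set_integrable_subset[OF g]) (use st in auto)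
    moreover have "(\<lambda>x. indicator {a..b} x *\<^sub>R indicator {s<..<t} x *\<^sub>R g x) = (\<lambda>x. indicator {s<..<t} x *\<^sub>R g x)"
      using st by (auto simp: indicator_def)
    ultimately show ?thesis unfolding set_integrable_def by simp
  qed
  have "(\<lambda>n. LBINT x:{a..b}. cutoff s t (?\<delta> n) x *\<^sub>R g x)
      \<longlonglongrightarrow> (LBINT x:{a..b}. indicator {s<..<t} x *\<^sub>R g x)"
  proof (rule set_integral_dominated_convergence[OF _ ig set_integrable_norm[OF g]])
    show "set_integrable lborel {a..b} (\<lambda>x. cutoff s t (?\<delta> n) x *\<^sub>R g x)" for n
      using set_integrable_bilinear[OF bounded_bilinear.flip[OF bounded_bilinear_scaleR] g _ continuous_on_cutoff]
      by simp
    show "AE x in lborel. x \<in> {a..b} \<longrightarrow> (\<lambda>n. cutoff s t (?\<delta> n) x *\<^sub>R g x) \<longlonglongrightarrow> indicator {s<..<t} x *\<^sub>R g x"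
      by (intro AE_I2 impI tendsto_intros cutoff_tendsto \<open>s < t\<close>)
    show "norm (cutoff s t (?\<delta> n) x *\<^sub>R g x) \<le> norm (g x)" for n x
      using mult_right_mono[OF abs_cutoff_le norm_ge_zero] by simp
  qed
  from tendsto_minus[OF this] have "(\<lambda>n. (LBINT x:{a..b}. k1 n x *\<^sub>R f x) - (LBINT x:{a..b}. k2 n x *\<^sub>R f x))
      \<longlonglongrightarrow> - (LBINT x:{a..b}. indicator {s<..<t} x *\<^sub>R g x)" unfolding eq .
  with tendsto_diff[OF L1 L2] have "f s - f t = - (LBINT x:{a..b}. indicator {s<..<t} x *\<^sub>R g x)"
    by (rule LIMSEQ_unique)
  moreover have "(LBINT x:{a..b}. indicator {s<..<t} x *\<^sub>R g x) = (LBINT x:{s<..<t}. g x)"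
    unfolding set_lebesgue_integral_def using st
    by (intro Bochner_Integration.integral_cong) (auto simp: indicator_def)
  moreover have "(LBINT x:{s<..<t}. g x) = (LBINT x:{s..t}. g x)"
    by (rule set_integral_discrete_difference[of "{s, t}"]) (use \<open>s < t\<close> in auto)
  ultimately show ?thesis by (simp add: algebra_simps)
qed

lemma set_integrable_scaleR_continuous:
  fixes g :: "'a::euclidean_space \<Rightarrow> 'b::euclidean_space"
  assumes "set_integrable lborel D g" "compact D" "continuous_on D h"
  shows "set_integrable lborel D (\<lambda>x. h x *\<^sub>R g x)"
  using set_integrable_bilinear[OF bounded_bilinear.flip[OF bounded_bilinear_scaleR] assms] .

text \<open>Absolute continuity with density \<open>g\<close> in integrated form, which is
  insensitive to the null sets on which a weak derivative is undetermined.\<close>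

definition is_primitive :: "real \<Rightarrow> real \<Rightarrow> (real \<Rightarrow> 'a::euclidean_space) \<Rightarrow> (real \<Rightarrow> 'a) \<Rightarrow> bool" where
  "is_primitive a b g f \<longleftrightarrow> set_integrable lborel {a..b} g \<and>
     (\<forall>s t. a \<le> s \<longrightarrow> s \<le> t \<longrightarrow> t \<le> b \<longrightarrow> f t - f s = (LBINT r:{s..t}. g r))"

lemma is_primitive_C1:
  assumes "continuous_on {a..b} f'"
    and "\<And>x. x \<in> {a..b} \<Longrightarrow> (f has_vector_derivative f' x) (at x within {a..b})"
  shows "is_primitive a b f' f"
  unfolding is_primitive_def
proof (intro conjI allI impI)
  show "set_integrable lborel {a..b} f'" using assms(1) by (intro set_integrable_continuous) auto
  fix s t assume st: "a \<le> s" "s \<le> t" "t \<le> b"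
  then have "(LBINT r:{s..t}. f' r) = f t - f s"
    by (intro set_integral_FTC continuous_on_subset[OF assms(1)]
        has_vector_derivative_within_subset[OF assms(2)]) auto
  then show "f t - f s = (LBINT r:{s..t}. f' r)" by simp
qed

lemma is_primitiveD:
  "is_primitive a b g f \<Longrightarrow> a \<le> s \<Longrightarrow> s \<le> t \<Longrightarrow> t \<le> b \<Longrightarrow> f t - f s = (LBINT r:{s..t}. g r)"
  by (simp add: is_primitive_def)

lemma is_primitive_subset_integrable:
  "is_primitive a b g f \<Longrightarrow> a \<le> s \<Longrightarrow> t \<le> b \<Longrightarrow> set_integrable lborel {s..t} g"
  unfolding is_primitive_def by (auto intro: set_integrable_subset)

lemma is_primitive_linear:
  assumes L: "bounded_linear L" and f: "is_primitive a b g f"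
  shows "is_primitive a b (\<lambda>s. L (g s)) (\<lambda>s. L (f s))"
  unfolding is_primitive_def
proof (intro conjI allI impI)
  show "set_integrable lborel {a..b} (\<lambda>s. L (g s))"
    using set_integral_bounded_linear(1)[OF L] f by (auto simp: is_primitive_def)
  fix s t assume st: "a \<le> s" "s \<le> t" "t \<le> b"
  show "L (f t) - L (f s) = (LBINT r:{s..t}. L (g r))"
    using set_integral_bounded_linear(2)[OF L is_primitive_subset_integrable[OF f st(1,3)]]
    by (simp add: is_primitiveD[OF f st, symmetric] linear_diff[OF bounded_linear.linear[OF L]])
qed

lemma is_primitive_diff:
  assumes f: "is_primitive a b g f" and f': "is_primitive a b g' f'"
  shows "is_primitive a b (\<lambda>s. g s - g' s) (\<lambda>s. f s - f' s)"
  unfolding is_primitive_def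
proof (intro conjI allI impI)
  show "set_integrable lborel {a..b} (\<lambda>s. g s - g' s)"
    using f f' by (auto simp: is_primitive_def)
  fix s t assume st: "a \<le> s" "s \<le> t" "t \<le> b"
  show "f t - f' t - (f s - f' s) = (LBINT r:{s..t}. g r - g' r)"
    using set_integral_diff(2)[OF is_primitive_subset_integrable[OF f st(1,3)] is_primitive_subset_integrable[OF f' st(1,3)]]
      is_primitiveD[OF f st] is_primitiveD[OF f' st] by (simp add: algebra_simps)
qed

lemma is_primitive_sum:
  assumes f: "\<And>i. i \<in> I \<Longrightarrow> is_primitive a b (g i) (f i)"
  shows "is_primitive a b (\<lambda>s. \<Sum>i\<in>I. g i s) (\<lambda>s. \<Sum>i\<in>I. f i s)"
  unfolding is_primitive_def
proof (intro conjI allI impI)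
  show "set_integrable lborel {a..b} (\<lambda>s. \<Sum>i\<in>I. g i s)"
    using f by (intro set_integral_sum) (auto simp: is_primitive_def)
  fix s t assume st: "a \<le> s" "s \<le> t" "t \<le> b"
  show "(\<Sum>i\<in>I. f i t) - (\<Sum>i\<in>I. f i s) = (LBINT r:{s..t}. (\<Sum>i\<in>I. g i r))"
    using set_integral_sum(2)[of I lborel "{s..t}" g, OF is_primitive_subset_integrable[OF f st(1,3)]]
      is_primitiveD[OF f st] by (simp add: sum_subtractf[symmetric])
qed

lemma frechet_derivative_real:
  "(\<eta> has_real_derivative D) (at x) \<Longrightarrow> frechet_derivative \<eta> (at x) 1 = D"
  using frechet_derivative_at[of \<eta> "(*) D" x] by (metis has_field_derivative_def mult.right_neutral)

lemma test_function_realI: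
  fixes \<eta> :: "real \<Rightarrow> real"
  assumes "a < c" "d < b" and D: "\<And>x. (\<eta> has_real_derivative \<eta>' x) (at x)"
    and c: "continuous_on UNIV \<eta>'" and 0: "\<And>x. x \<notin> {c..d} \<Longrightarrow> \<eta> x = 0"
  shows "test_function {a..b} \<eta>"
  unfolding test_function_def
proof (intro conjI allI ballI)
  show "\<eta> differentiable at x" for x
    using D real_differentiable_def by blast
  show "continuous_on UNIV (\<lambda>x. frechet_derivative \<eta> (at x) e)" if "e \<in> Basis" for e
    using that c frechet_derivative_real[OF D] by simp
  show "\<exists>C. compact C \<and> C \<subseteq> interior {a..b} \<and> (\<forall>x. x \<notin> C \<longrightarrow> \<eta> x = 0)"
    using assms by (intro exI[of _ "{c..d}"]) auto
qed

lemma W2_weak_partial: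
  "f \<in> W2 D \<Longrightarrow> e \<in> Basis \<Longrightarrow> has_weak_partial f (weak_partial e D f) e D"
  unfolding weak_partial_def
  by (rule someI_ex[of "\<lambda>g. has_weak_partial f g e D"]) (simp add: W2_def)

lemma W2_L2: "f \<in> W2 D \<Longrightarrow> f \<in> L2 D"
  by (simp add: W2_def)

lemma W2_continuous: "f \<in> W2 D \<Longrightarrow> continuous_on D f"
  by (simp add: W2_def)

lemma W2_weak_partial_integrable:
  "f \<in> W2 D \<Longrightarrow> e \<in> Basis \<Longrightarrow> compact D \<Longrightarrow> set_integrable lborel D (weak_partial e D f)"
  using W2_weak_partial set_integrable_of_L2 unfolding has_weak_partial_def by blast

lemma W2_is_primitive:
  fixes f :: "real \<Rightarrow> 'a::euclidean_space"
  assumes f: "f \<in> W2 {a..b}"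
  shows "is_primitive a b (weak_partial 1 {a..b} f) f"
  unfolding is_primitive_def
proof (intro conjI allI impI)
  have w: "has_weak_partial f (weak_partial 1 {a..b} f) 1 {a..b}"
    using W2_weak_partial[OF f] by simp
  show i: "set_integrable lborel {a..b} (weak_partial 1 {a..b} f)"
    using W2_weak_partial_integrable[OF f] by simp
  fix s t assume st: "a \<le> s" "s \<le> t" "t \<le> b"
  show "f t - f s = (LBINT r:{s..t}. weak_partial 1 {a..b} f r)"
  proof (rule primitive_of_weak_derivative[OF W2_continuous[OF f] i _ st])
    fix \<eta> \<eta>' c d
    assume h: "a < c" "d < b" "\<And>x. (\<eta> has_real_derivative \<eta>' x) (at x)"
      "continuous_on UNIV \<eta>'" "\<And>x. x \<notin> {c..d} \<Longrightarrow> \<eta> x = 0"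
    show "(LBINT x:{a..b}. \<eta>' x *\<^sub>R f x) = - (LBINT x:{a..b}. \<eta> x *\<^sub>R weak_partial 1 {a..b} f x)"
      using w test_function_realI[OF h] unfolding has_weak_partial_def frechet_derivative_real[OF h(3), symmetric]
      by blast
  qed
qed

lemma L2_of_continuous:
  fixes f :: "'a::euclidean_space \<Rightarrow> 'b::euclidean_space"
  assumes "compact D" "continuous_on D f"
  shows "f \<in> L2 D"
  unfolding L2_def
  using set_measurable_continuous_on[OF borel_compact[OF assms(1)] assms(2)] assms
  by (auto intro!: set_integrable_continuous continuous_intros simp: set_borel_measurable_def)

lemma test_function_boundary:
  assumes "test_function {a..b::real} \<eta>" "x \<notin> {a<..<b}"
  shows "\<eta> x = 0"
  using assms unfolding test_function_def by (auto simp: interior_atLeastAtMost_real)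

text \<open>Integration by parts against a test function has no boundary terms, since test functions
  vanish at the end points. This puts the polynomial approximants of a continuous history into the
  state space.\<close>

lemma W2_of_C1:
  fixes f :: "real \<Rightarrow> 'a::euclidean_space"
  assumes ab: "a \<le> b" and f: "\<And>x. (f has_vector_derivative f' x) (at x)" and f': "continuous_on UNIV f'"
  shows "f \<in> W2 {a..b}"
proof -
  have cf: "continuous_on S f" for S
    using has_vector_derivative_continuous[OF f] by (simp add: continuous_at_imp_continuous_on)
  have cf': "continuous_on S f'" for S using f' continuous_on_subset by blast
  have "has_weak_partial f f' 1 {a..b}"
    unfolding has_weak_partial_def
  proof (intro conjI allI impI)
    show "f' \<in> L2 {a..b}" by (intro L2_of_continuous cf') auto
    fix \<eta> assume t: "test_function {a..b} \<eta>"
    define \<eta>' where "\<eta>' = (\<lambda>x. frechet_derivative \<eta> (at x) 1)"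
    have c': "continuous_on S \<eta>'" for S
      using t continuous_on_subset unfolding test_function_def \<eta>'_def by auto
    have D: "(\<eta> has_real_derivative \<eta>' x) (at x)" for x
    proof -
      have "\<eta> differentiable at x" using t by (simp add: test_function_def)
      then have "(\<eta> has_derivative frechet_derivative \<eta> (at x)) (at x)" by (simp add: frechet_derivative_works)
      moreover have "frechet_derivative \<eta> (at x) = (*) (\<eta>' x)"
      proof
        show "frechet_derivative \<eta> (at x) h = \<eta>' x * h" for h
          using linear_scale[OF has_derivative_linear[OF calculation], of h 1] by (simp add: \<eta>'_def mult.commute)
      qed
      ultimately show ?thesis by (simp add: has_field_derivative_def)
    qed
    have c: "continuous_on S \<eta>" for S
      using DERIV_continuous[OF D] by (simp add: continuous_at_imp_continuous_on)
    have "(LBINT x:{a..b}. \<eta>' x *\<^sub>R f x + \<eta> x *\<^sub>R f' x) = \<eta> b *\<^sub>R f b - \<eta> a *\<^sub>R f a"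
    proof (rule set_integral_FTC[OF ab])
      show "((\<lambda>x. \<eta> x *\<^sub>R f x) has_vector_derivative \<eta>' x *\<^sub>R f x + \<eta> x *\<^sub>R f' x) (at x within {a..b})" for x
        using has_vector_derivative_scaleR[OF has_field_derivative_at_within[OF D] has_vector_derivative_at_within[OF f]]
        by (simp add: add.commute)
    qed (intro continuous_intros c c' cf cf')
    also have "\<dots> = 0" using test_function_boundary[OF t] by simp
    also have "(LBINT x:{a..b}. \<eta>' x *\<^sub>R f x + \<eta> x *\<^sub>R f' x)
      = (LBINT x:{a..b}. \<eta>' x *\<^sub>R f x) + (LBINT x:{a..b}. \<eta> x *\<^sub>R f' x)"
      by (intro set_integral_add set_integrable_continuous continuous_intros c c' cf cf') auto
    finally show "(LBINT x:{a..b}. frechet_derivative \<eta> (at x) 1 *\<^sub>R f x) = - (LBINT x:{a..b}. \<eta> x *\<^sub>R f' x)"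
      unfolding \<eta>'_def by (simp add: eq_neg_iff_add_eq_0)
  qed
  then show ?thesis unfolding W2_def using L2_of_continuous[OF _ cf] cf by auto
qed

section \<open>Parameter integrals with Sobolev kernels\<close>

text \<open>Weierstrass polynomials times cutoffs. They are uniformly bounded and converge at every
  interior point, which is what dominated convergence asks for.\<close>

lemma test_function_approx:
  fixes \<psi> :: "real \<Rightarrow> real"
  assumes cd: "c < d" and \<psi>: "continuous_on {c..d} \<psi>"
  obtains \<zeta> \<zeta>' c' d' B where
    "\<And>n::nat. c < c' n" "\<And>n. d' n < d"
    "\<And>n x. (\<zeta> n has_real_derivative \<zeta>' n x) (at x)" "\<And>n. continuous_on UNIV (\<zeta>' n)"
    "\<And>n x. x \<notin> {c' n..d' n} \<Longrightarrow> \<zeta> n x = 0"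
    "\<And>n x. x \<in> {c..d} \<Longrightarrow> \<bar>\<zeta> n x\<bar> \<le> B"
    "\<And>x. x \<in> {c<..<d} \<Longrightarrow> (\<lambda>n. \<zeta> n x) \<longlonglongrightarrow> \<psi> x"
proof -
  have "\<exists>p. polynomial_function p \<and> (\<forall>x\<in>{c..d}. norm (\<psi> x - p x) < inverse (real (Suc n)))" for n
    using Stone_Weierstrass_polynomial_function[of "{c..d}" \<psi> "inverse (real (Suc n))"] \<psi> by auto
  then obtain p where p: "\<And>n. polynomial_function (p n)"
      "\<And>n x. x \<in> {c..d} \<Longrightarrow> norm (\<psi> x - p n x) < inverse (real (Suc n))" by metis
  have "\<exists>p'. polynomial_function p' \<and> (\<forall>x. (p n has_vector_derivative p' x) (at x))" for n
    using has_vector_derivative_polynomial_function[OF p(1)[of n]] by metis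
  then obtain p' where p': "\<And>n. polynomial_function (p' n)"
      "\<And>n x. (p n has_vector_derivative p' n x) (at x)" by metis
  have "bounded (\<psi> ` {c..d})"
    using compact_imp_bounded[OF compact_continuous_image[OF \<psi>]] by simp
  then obtain B where B: "\<And>x. x \<in> {c..d} \<Longrightarrow> \<bar>\<psi> x\<bar> \<le> B"
    unfolding bounded_iff by (metis image_eqI real_norm_def)
  let ?\<delta> = "cut_width c d"
  define \<zeta> where "\<zeta> = (\<lambda>n x. p n x * cutoff c d (?\<delta> n) x)"
  show thesis
  proof (rule that[of "\<lambda>n. c + ?\<delta> n" "\<lambda>n. d - ?\<delta> n" \<zeta>
        "\<lambda>n x. p' n x * cutoff c d (?\<delta> n) x + cutoff' c d (?\<delta> n) x * p n x" "B + 1"])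
    show "c < c + ?\<delta> n" "d - ?\<delta> n < d" for n using cut_width[OF cd] by auto
    show "(\<zeta> n has_real_derivative p' n x * cutoff c d (?\<delta> n) x + cutoff' c d (?\<delta> n) x * p n x) (at x)" for n x
      unfolding \<zeta>_def
      using DERIV_mult[OF _ DERIV_cutoff] p'(2)[of n x] by (simp add: has_real_derivative_iff_has_vector_derivative)
    show "continuous_on UNIV (\<lambda>x. p' n x * cutoff c d (?\<delta> n) x + cutoff' c d (?\<delta> n) x * p n x)" for n
      by (intro continuous_intros continuous_on_cutoff continuous_on_cutoff' continuous_on_polymonial_function p p')
    show "\<zeta> n x = 0" if "x \<notin> {c + ?\<delta> n..d - ?\<delta> n}" for n x
      using that cutoff_eq_0 cut_width[OF cd, of n] by (auto simp: \<zeta>_def)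
    show "\<bar>\<zeta> n x\<bar> \<le> B + 1" if "x \<in> {c..d}" for n x
    proof -
      have "inverse (real (Suc n)) \<le> 1" by (simp add: field_simps)
      then have "\<bar>p n x\<bar> \<le> B + 1" using p(2)[OF that, of n] B[OF that] by auto
      moreover have "\<bar>\<zeta> n x\<bar> \<le> \<bar>p n x\<bar> * 1"
        unfolding \<zeta>_def abs_mult by (intro mult_left_mono abs_cutoff_le) auto
      ultimately show ?thesis by simp
    qed
    show "(\<lambda>n. \<zeta> n x) \<longlonglongrightarrow> \<psi> x" if x: "x \<in> {c<..<d}" for x
    proof -
      have "(\<lambda>n. p n x - \<psi> x) \<longlonglongrightarrow> 0"
      proof (rule Lim_null_comparison[OF _ LIMSEQ_inverse_real_of_nat])
        show "\<forall>\<^sub>F n in sequentially. norm (p n x - \<psi> x) \<le> inverse (real (Suc n))"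
          using p(2)[of x] x by (intro always_eventually) (auto simp: abs_minus_commute less_imp_le)
      qed
      from tendsto_mult[OF LIM_zero_cancel[OF this] cutoff_tendsto[OF cd, of x]] show ?thesis
        using x by (simp add: \<zeta>_def)
    qed
  qed
qed

text \<open>The approximants of \<open>test_function_approx\<close> vanish at both end points, so
  convergence in the second variable can fail on two horizontal lines; these are null sets.\<close>

lemma AE_lborel_snd_neq: "AE z in (lborel :: (real \<times> real) measure). snd z \<noteq> c"
proof -
  have "emeasure (lborel \<Otimes>\<^sub>M lborel) ((UNIV :: real set) \<times> {c}) = emeasure lborel (UNIV :: real set) * emeasure lborel {c::real}"
    by (rule lborel.emeasure_pair_measure_Times) auto
  then have "UNIV \<times> {c} \<in> null_sets (lborel :: (real \<times> real) measure)"
    unfolding lborel_prod[symmetric] by (intro null_setsI) auto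
  then have "AE z in (lborel :: (real \<times> real) measure). z \<notin> UNIV \<times> {c}" by (rule AE_not_in)
  then show ?thesis by eventually_elim auto
qed

lemma test_function_product:
  assumes "a < c1" "d1 < b" "c < c2" "d2 < d"
    and e: "\<And>x. (\<eta> has_real_derivative \<eta>' x) (at x)" "continuous_on UNIV \<eta>'"
      "\<And>x. x \<notin> {c1..d1} \<Longrightarrow> \<eta> x = 0"
    and z: "\<And>x. (\<zeta> has_real_derivative \<zeta>' x) (at x)" "continuous_on UNIV \<zeta>'"
      "\<And>x. x \<notin> {c2..d2} \<Longrightarrow> \<zeta> x = 0"
  shows "test_function ({a..b} \<times> {c..d}) (\<lambda>z. \<eta> (fst z) * \<zeta> (snd z))"
    "frechet_derivative (\<lambda>z. \<eta> (fst z) * \<zeta> (snd z)) (at z) (1, 0) = \<eta>' (fst z) * \<zeta> (snd z)"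
proof -
  have D: "((\<lambda>z. \<eta> (fst z) * \<zeta> (snd z)) has_derivative
      (\<lambda>h. \<eta> (fst z) * (\<zeta>' (snd z) * snd h) + \<eta>' (fst z) * fst h * \<zeta> (snd z))) (at z)" for z
  proof (rule has_derivative_mult)
    show "((\<lambda>z. \<eta> (fst z)) has_derivative (\<lambda>h. \<eta>' (fst z) * fst h)) (at z)"
      using has_derivative_compose[OF has_derivative_fst[OF has_derivative_ident] e(1)[unfolded has_field_derivative_def]] .
    show "((\<lambda>z. \<zeta> (snd z)) has_derivative (\<lambda>h. \<zeta>' (snd z) * snd h)) (at z)"
      using has_derivative_compose[OF has_derivative_snd[OF has_derivative_ident] z(1)[unfolded has_field_derivative_def]] .
  qed
  have fd: "frechet_derivative (\<lambda>z. \<eta> (fst z) * \<zeta> (snd z)) (at z) =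
      (\<lambda>h. \<eta> (fst z) * (\<zeta>' (snd z) * snd h) + \<eta>' (fst z) * fst h * \<zeta> (snd z))" for z
    using frechet_derivative_at[OF D] by simp
  show "frechet_derivative (\<lambda>z. \<eta> (fst z) * \<zeta> (snd z)) (at z) (1, 0) = \<eta>' (fst z) * \<zeta> (snd z)"
    by (simp add: fd)
  have ce: "continuous_on UNIV \<eta>" "continuous_on UNIV \<zeta>"
    using DERIV_continuous[OF e(1)] DERIV_continuous[OF z(1)] by (simp_all add: continuous_at_imp_continuous_on)
  note [continuous_intros] = continuous_on_compose2[OF ce(1)] continuous_on_compose2[OF ce(2)]
    continuous_on_compose2[OF e(2)] continuous_on_compose2[OF z(2)]
  show "test_function ({a..b} \<times> {c..d}) (\<lambda>z. \<eta> (fst z) * \<zeta> (snd z))"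
    unfolding test_function_def
  proof (intro conjI allI ballI)
    show "(\<lambda>z. \<eta> (fst z) * \<zeta> (snd z)) differentiable at z" for z
      using D by (rule differentiableI)
    show "continuous_on UNIV (\<lambda>z. frechet_derivative (\<lambda>z. \<eta> (fst z) * \<zeta> (snd z)) (at z) h)" for h
      unfolding fd by (intro continuous_intros) auto
    show "\<exists>C. compact C \<and> C \<subseteq> interior ({a..b} \<times> {c..d}) \<and> (\<forall>z. z \<notin> C \<longrightarrow> \<eta> (fst z) * \<zeta> (snd z) = 0)"
      using assms by (intro exI[of _ "{c1..d1} \<times> {c2..d2}"]) (auto intro!: compact_Times simp: interior_Times)
  qed
qed

text \<open>In a product test function the second factor is not differentiated by the partial
  derivative in direction \<open>(1, 0)\<close>. Only its values enter, so it may be replaced in the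
  limit by any continuous \<open>\<psi>\<close>, whatever its boundary values.\<close>

lemma weak_partial_against_continuous:
  fixes R :: "real \<times> real \<Rightarrow> 'a::euclidean_space"
  assumes R: "R \<in> W2 ({a..b} \<times> {c..d})" and cd: "c < d"
    and \<psi>: "continuous_on {c..d} \<psi>"
    and e: "a < c1" "d1 < b" "\<And>x. (\<eta> has_real_derivative \<eta>' x) (at x)" "continuous_on UNIV \<eta>'"
      "\<And>x. x \<notin> {c1..d1} \<Longrightarrow> \<eta> x = 0"
  defines "g \<equiv> weak_partial (1, 0) ({a..b} \<times> {c..d}) R"
  shows "(LBINT z:{a..b} \<times> {c..d}. (\<eta>' (fst z) * \<psi> (snd z)) *\<^sub>R R z)
      = - (LBINT z:{a..b} \<times> {c..d}. (\<eta> (fst z) * \<psi> (snd z)) *\<^sub>R g z)"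
proof -
  let ?D = "{a..b} \<times> {c..d}"
  have cpt: "compact ?D" by (intro compact_Times) auto
  have w: "has_weak_partial R g (1, 0) ?D"
    unfolding g_def by (rule W2_weak_partial[OF R]) (simp add: Basis_prod_def)
  have ig: "set_integrable lborel ?D g"
    unfolding g_def by (rule W2_weak_partial_integrable[OF R _ cpt]) (simp add: Basis_prod_def)
  have iR: "set_integrable lborel ?D R"
    using W2_continuous[OF R] cpt by (intro set_integrable_continuous)
  have ce: "continuous_on S \<eta>" for S
    using DERIV_continuous[OF e(3)] by (simp add: continuous_at_imp_continuous_on)
  have ce': "continuous_on S \<eta>'" for S using e(4) continuous_on_subset by blast
  obtain \<zeta> \<zeta>' c' d' B where \<zeta>: "\<And>n::nat. c < c' n" "\<And>n. d' n < d"
    "\<And>n x. (\<zeta> n has_real_derivative \<zeta>' n x) (at x)" "\<And>n. continuous_on UNIV (\<zeta>' n)"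
    "\<And>n x. x \<notin> {c' n..d' n} \<Longrightarrow> \<zeta> n x = 0"
    "\<And>n x. x \<in> {c..d} \<Longrightarrow> \<bar>\<zeta> n x\<bar> \<le> B"
    "\<And>x. x \<in> {c<..<d} \<Longrightarrow> (\<lambda>n. \<zeta> n x) \<longlonglongrightarrow> \<psi> x"
    by (rule test_function_approx[OF cd \<psi>]) (rule that, assumption+)
  have c\<zeta>: "continuous_on S (\<zeta> n)" for S n
    using DERIV_continuous[OF \<zeta>(3)] by (simp add: continuous_at_imp_continuous_on)
  have eq: "(LBINT z:?D. (\<eta>' (fst z) * \<zeta> n (snd z)) *\<^sub>R R z)
      = - (LBINT z:?D. (\<eta> (fst z) * \<zeta> n (snd z)) *\<^sub>R g z)" for n
  proof -
    have t: "test_function ?D (\<lambda>z. \<eta> (fst z) * \<zeta> n (snd z))"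
      "frechet_derivative (\<lambda>z. \<eta> (fst z) * \<zeta> n (snd z)) (at z) (1, 0) = \<eta>' (fst z) * \<zeta> n (snd z)" for z
      by (rule test_function_product[OF e(1,2) \<zeta>(1)[of n] \<zeta>(2)[of n]], (rule e \<zeta> | assumption)+)+
    show ?thesis
      using w[unfolded has_weak_partial_def, THEN conjunct2, rule_format, OF t(1)]
      unfolding t(2) .
  qed
  \<comment> \<open>Both sides of \<open>eq\<close> have this shape: \<open>\<eta>'\<close> with
    \<open>R\<close> on the left, \<open>\<eta>\<close> with \<open>g\<close> on the right.\<close>
  have lim: "(\<lambda>n. LBINT z:?D. (h (fst z) * \<zeta> n (snd z)) *\<^sub>R G z)
      \<longlonglongrightarrow> (LBINT z:?D. (h (fst z) * \<psi> (snd z)) *\<^sub>R G z)"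
    if G: "set_integrable lborel ?D G" and h: "\<And>S. continuous_on S h" for h and G :: "real \<times> real \<Rightarrow> 'a"
  proof (rule set_integral_dominated_convergence)
    have cst: "continuous_on ?D (\<lambda>z. h (fst z))"
      by (rule continuous_on_compose2[OF h[of UNIV]]) (auto intro: continuous_intros)
    have "continuous_on ?D (\<lambda>z. h (fst z) * \<zeta> n (snd z))" for n
      by (intro continuous_on_mult cst continuous_on_compose2[OF c\<zeta>[of UNIV]]) (auto intro: continuous_intros)
    then show "set_integrable lborel ?D (\<lambda>z. (h (fst z) * \<zeta> n (snd z)) *\<^sub>R G z)" for n
      by (intro set_integrable_scaleR_continuous G cpt)
    have "continuous_on ?D (\<lambda>z. h (fst z) * \<psi> (snd z))"
      by (intro continuous_on_mult cst continuous_on_compose2[OF \<psi>]) (auto intro: continuous_intros)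
    then show "set_integrable lborel ?D (\<lambda>z. (h (fst z) * \<psi> (snd z)) *\<^sub>R G z)"
      by (intro set_integrable_scaleR_continuous G cpt)
    show "set_integrable lborel ?D (\<lambda>z. norm ((B * h (fst z)) *\<^sub>R G z))"
      by (intro set_integrable_norm set_integrable_scaleR_continuous G cpt continuous_intros cst)
    show "norm ((h (fst z) * \<zeta> n (snd z)) *\<^sub>R G z) \<le> norm ((B * h (fst z)) *\<^sub>R G z)" if "z \<in> ?D" for n z
    proof -
      have "\<bar>\<zeta> n (snd z)\<bar> \<le> \<bar>B\<bar>" using \<zeta>(6)[of "snd z" n] that by auto
      then have "\<bar>h (fst z)\<bar> * \<bar>\<zeta> n (snd z)\<bar> * norm (G z) \<le> \<bar>h (fst z)\<bar> * \<bar>B\<bar> * norm (G z)"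
        by (intro mult_right_mono mult_left_mono) auto
      then show ?thesis by (simp add: abs_mult mult_ac)
    qed
    show "AE z in lborel. z \<in> ?D \<longrightarrow> (\<lambda>n. (h (fst z) * \<zeta> n (snd z)) *\<^sub>R G z) \<longlonglongrightarrow> (h (fst z) * \<psi> (snd z)) *\<^sub>R G z"
      using AE_lborel_snd_neq[of c] AE_lborel_snd_neq[of d]
    proof eventually_elim
      fix z :: "real \<times> real" assume "snd z \<noteq> c" "snd z \<noteq> d"
      then show "z \<in> ?D \<longrightarrow> (\<lambda>n. (h (fst z) * \<zeta> n (snd z)) *\<^sub>R G z) \<longlonglongrightarrow> (h (fst z) * \<psi> (snd z)) *\<^sub>R G z"
        by (intro impI tendsto_scaleR tendsto_mult tendsto_const \<zeta>(7)) (auto simp: less_le)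
    qed
  qed
  show ?thesis
    using LIMSEQ_unique[OF lim[OF iR ce', unfolded eq] tendsto_minus[OF lim[OF ig ce]]] .
qed

lemma matrix_vector_mult_Basis_sum:
  fixes M :: "real ^ 'n::finite ^ 'm::finite"
  shows "M *v v = (\<Sum>e\<in>Basis. (v \<bullet> e) *\<^sub>R (M *v e))"
proof -
  have "M *v v = M *v (\<Sum>e\<in>Basis. (v \<bullet> e) *\<^sub>R e)" by (simp add: euclidean_representation)
  also have "\<dots> = (\<Sum>e\<in>Basis. (v \<bullet> e) *\<^sub>R (M *v e))"
    by (simp add: matrix_vector_mult_scaleR
        linear_sum[OF matrix_vector_mul_linear])
  finally show ?thesis .
qed

lemma set_integrable_matrix_vector:
  fixes M :: "'a::euclidean_space \<Rightarrow> real ^ 'n::finite ^ 'm::finite"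
  assumes "set_integrable lborel D M" "compact D" "continuous_on D h"
  shows "set_integrable lborel D (\<lambda>x. M x *v h x)"
  using set_integrable_bilinear[OF bounded_bilinear_matrix_vector_mult assms] .

lemma continuous_on_matrix_integral:
  fixes R :: "real \<times> real \<Rightarrow> real ^ 'n::finite ^ 'm::finite"
  assumes R: "continuous_on (D \<times> {c..d}) R" and \<phi>: "continuous_on {c..d} \<phi>"
  shows "continuous_on D (\<lambda>s. LBINT \<theta>:{c..d}. R (s, \<theta>) *v \<phi> \<theta>)"
proof -
  have "continuous_on (D \<times> cbox c d) (\<lambda>(s, \<theta>). R (s, \<theta>) *v \<phi> \<theta>)"
    unfolding split_beta prod.collapse
    by (intro continuous_intros continuous_on_compose2[OF \<phi>]) (use R in \<open>auto intro: continuous_intros\<close>)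
  from integral_continuous_on_param[OF this]
  have "continuous_on D (\<lambda>s. integral {c..d} (\<lambda>\<theta>. R (s, \<theta>) *v \<phi> \<theta>))" by simp
  moreover have "integral {c..d} (\<lambda>\<theta>. R (s, \<theta>) *v \<phi> \<theta>) = (LBINT \<theta>:{c..d}. R (s, \<theta>) *v \<phi> \<theta>)"
    if "s \<in> D" for s
  proof (rule set_borel_integral_eq_integral(2)[symmetric])
    show "set_integrable lborel {c..d} (\<lambda>\<theta>. R (s, \<theta>) *v \<phi> \<theta>)"
      using that by (intro set_integrable_continuous continuous_intros \<phi> continuous_on_compose2[OF R]) auto
  qed
  ultimately show ?thesis by (simp cong: continuous_on_cong)
qed

text \<open>Differentiation under the integral sign for a kernel with only a weak derivative. By
  Fubini, testing the integral with \<open>\<eta>\<close> is testing \<open>R\<close> with a product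
  of \<open>\<eta>\<close> and \<open>\<phi>\<close>, so the integral has the expected weak
  derivative, and \<open>primitive_of_weak_derivative\<close> integrates it.\<close>

lemma is_primitive_matrix_integral:
  fixes R :: "real \<times> real \<Rightarrow> real ^ 'n::finite ^ 'm::finite"
  assumes R: "R \<in> W2 ({a..b} \<times> {c..d})" and cd: "c < d"
    and \<phi>: "continuous_on {c..d} \<phi>"
  defines "g \<equiv> weak_partial (1, 0) ({a..b} \<times> {c..d}) R"
  shows "is_primitive a b (\<lambda>s. LBINT \<theta>:{c..d}. g (s, \<theta>) *v \<phi> \<theta>)
           (\<lambda>s. LBINT \<theta>:{c..d}. R (s, \<theta>) *v \<phi> \<theta>)"
proof -
  let ?D = "{a..b} \<times> {c..d}"
  have cpt: "compact ?D" by (intro compact_Times) auto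
  have ig: "set_integrable lborel ?D g"
    unfolding g_def by (rule W2_weak_partial_integrable[OF R _ cpt]) (simp add: Basis_prod_def)
  have iR: "set_integrable lborel ?D R"
    using W2_continuous[OF R] cpt by (intro set_integrable_continuous)
  have c\<phi>: "continuous_on ?D (\<lambda>z. \<phi> (snd z))"
    by (rule continuous_on_compose2[OF \<phi>]) (auto intro: continuous_intros)
  note fub = set_integral_Fubini[OF set_integrable_matrix_vector[OF ig cpt c\<phi>]]
  show ?thesis
    unfolding is_primitive_def
  proof (intro conjI allI impI)
    show i: "set_integrable lborel {a..b} (\<lambda>s. LBINT \<theta>:{c..d}. g (s, \<theta>) *v \<phi> \<theta>)"
      using fub(1) by simp
    fix s t assume st: "a \<le> s" "s \<le> t" "t \<le> b"
    show "(LBINT \<theta>:{c..d}. R (t, \<theta>) *v \<phi> \<theta>) - (LBINT \<theta>:{c..d}. R (s, \<theta>) *v \<phi> \<theta>)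
        = (LBINT r:{s..t}. LBINT \<theta>:{c..d}. g (r, \<theta>) *v \<phi> \<theta>)"
    proof (rule primitive_of_weak_derivative[OF continuous_on_matrix_integral[OF W2_continuous[OF R] \<phi>] i _ st])
      fix \<eta> \<eta>' c1 d1
      assume h: "a < c1" "d1 < b" "\<And>x. (\<eta> has_real_derivative \<eta>' x) (at x)"
        "continuous_on UNIV \<eta>'" "\<And>x. x \<notin> {c1..d1} \<Longrightarrow> \<eta> x = 0"
      have ce: "continuous_on S \<eta>" for S
        using DERIV_continuous[OF h(3)] by (simp add: continuous_at_imp_continuous_on)
      have ce': "continuous_on S \<eta>'" for S using h(4) continuous_on_subset by blast
      \<comment> \<open>Expanding \<open>\<phi> \<theta>\<close> in the standard basis turns the
        vector-valued history into scalar weights \<open>\<phi> \<theta> \<bullet> e\<close>, to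
        which \<open>weak_partial_against_continuous\<close> applies.\<close>
      have expand: "(LBINT s:{a..b}. k s *\<^sub>R (LBINT \<theta>:{c..d}. G (s, \<theta>) *v \<phi> \<theta>))
          = (\<Sum>e\<in>Basis. (LBINT z:?D. (k (fst z) * (\<phi> (snd z) \<bullet> e)) *\<^sub>R G z) *v e)"
        if G: "set_integrable lborel ?D G" and k: "\<And>S. continuous_on S k" for k and G :: "real \<times> real \<Rightarrow> real ^ 'n ^ 'm"
      proof -
        have ck: "continuous_on ?D (\<lambda>z. k (fst z))"
          by (rule continuous_on_compose2[OF k[of UNIV]]) (auto intro: continuous_intros)
        have iG: "set_integrable lborel ?D (\<lambda>z. (k (fst z) * (\<phi> (snd z) \<bullet> e)) *\<^sub>R G z)" for e
          by (intro set_integrable_scaleR_continuous G cpt continuous_intros ck c\<phi>)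
        note lin = set_integral_bounded_linear[OF bounded_bilinear.bounded_linear_left[OF bounded_bilinear_matrix_vector_mult] iG]
        have i2: "set_integrable lborel ?D (\<lambda>z. k (fst z) *\<^sub>R (G z *v \<phi> (snd z)))"
          by (intro set_integrable_scaleR_continuous set_integrable_matrix_vector G cpt ck c\<phi>)
        have "(LBINT s:{a..b}. k s *\<^sub>R (LBINT \<theta>:{c..d}. G (s, \<theta>) *v \<phi> \<theta>))
            = (LBINT z:?D. k (fst z) *\<^sub>R (G z *v \<phi> (snd z)))"
          using set_integral_Fubini(2)[OF i2] by simp
        also have "\<dots> = (LBINT z:?D. \<Sum>e\<in>Basis. ((k (fst z) * (\<phi> (snd z) \<bullet> e)) *\<^sub>R G z) *v e)"
          by (subst matrix_vector_mult_Basis_sum)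
            (simp add: scaleR_sum_right scaleR_matrix_vector_assoc[symmetric] mult_ac)
        also have "\<dots> = (\<Sum>e\<in>Basis. (LBINT z:?D. (k (fst z) * (\<phi> (snd z) \<bullet> e)) *\<^sub>R G z) *v e)"
          by (subst set_integral_sum(2)) (auto simp: lin)
        finally show ?thesis .
      qed
      have "(LBINT z:?D. (\<eta>' (fst z) * (\<phi> (snd z) \<bullet> e)) *\<^sub>R R z)
          = - (LBINT z:?D. (\<eta> (fst z) * (\<phi> (snd z) \<bullet> e)) *\<^sub>R g z)" for e
        unfolding g_def
        by (rule weak_partial_against_continuous[OF R cd _ h]) (intro continuous_intros \<phi>)
      then show "(LBINT x:{a..b}. \<eta>' x *\<^sub>R (LBINT \<theta>:{c..d}. R (x, \<theta>) *v \<phi> \<theta>))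
          = - (LBINT x:{a..b}. \<eta> x *\<^sub>R (LBINT \<theta>:{c..d}. g (x, \<theta>) *v \<phi> \<theta>))"
        unfolding expand[OF iR ce'] expand[OF ig ce]
        by (simp add: sum_negf[symmetric] linear_neg[OF bounded_linear.linear[OF
              bounded_bilinear.bounded_linear_left[OF bounded_bilinear_matrix_vector_mult]]])
    qed
  qed
qed

section \<open>The product rule for a quadratic form\<close>

lemma set_integral_combine:
  fixes f :: "real \<Rightarrow> 'a::euclidean_space"
  assumes "set_integrable lborel {a..c} f" "a \<le> b" "b \<le> c"
  shows "(LBINT x:{a..c}. f x) = (LBINT x:{a..b}. f x) + (LBINT x:{b..c}. f x)"
proof -
  have "set_integrable lborel {a..b} f" "set_integrable lborel {b..c} f"
    using assms by (auto intro: set_integrable_subset[OF assms(1)])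
  then show ?thesis
    using Henstock_Kurzweil_Integration.integral_combine[OF assms(2,3) set_borel_integral_eq_integral(1)[OF assms(1)]] assms(1)
    by (simp add: set_borel_integral_eq_integral(2))
qed

text \<open>This is the product rule for \<open>\<phi> \<bullet> S \<phi>\<close> when only \<open>S\<close> and \<open>S \<phi>\<close> are known to be
  absolutely continuous.  For symmetric \<open>S\<close> the increment over \<open>[s, t]\<close> is exactly
  \<open>(\<phi> t + \<phi> s) \<bullet> (u t - u s) - \<phi> t \<bullet> (S t - S s) \<phi> s\<close>, which avoids increments of \<open>\<phi>\<close>; the
  error of replacing \<open>\<phi> t\<close> and \<open>\<phi> s\<close> by \<open>\<phi> r\<close> is additive and small on short intervals.\<close>

lemma quadratic_primitive:
  fixes \<phi> :: "real \<Rightarrow> real ^ 'n::finite" and S S' :: "real \<Rightarrow> real ^ 'n ^ 'n"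
  assumes ab: "a \<le> b" and \<phi>: "continuous_on {a..b} \<phi>"
    and S: "is_primitive a b S' S" and u: "is_primitive a b u' u"
    and sym: "\<And>s. s \<in> {a..b} \<Longrightarrow> transpose (S s) = S s"
    and eq: "\<And>s. s \<in> {a..b} \<Longrightarrow> u s = S s *v \<phi> s"
  shows "\<phi> b \<bullet> u b - \<phi> a \<bullet> u a =
    2 * (LBINT s:{a..b}. \<phi> s \<bullet> u' s) - (LBINT s:{a..b}. \<phi> s \<bullet> (S' s *v \<phi> s))"
proof -
  have bl1: "bounded_linear (\<lambda>v. x \<bullet> v)" for x :: "real ^ 'n" by (rule bounded_linear_inner_right)
  have bl2: "bounded_linear (\<lambda>M. x \<bullet> (M *v y))" for x y :: "real ^ 'n"
    by (rule bounded_linear_compose[OF bounded_linear_inner_right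
          bounded_bilinear.bounded_linear_left[OF bounded_bilinear_matrix_vector_mult]])
  have iu: "set_integrable lborel {a..b} u'" and iS: "set_integrable lborel {a..b} S'"
    using u S by (auto simp: is_primitive_def)
  have i1: "set_integrable lborel {a..b} (\<lambda>r. \<phi> r \<bullet> u' r)"
    using set_integrable_bilinear[OF bounded_bilinear_inner iu _ \<phi>] by (simp add: inner_commute)
  have i2: "set_integrable lborel {a..b} (\<lambda>r. \<phi> r \<bullet> (S' r *v \<phi> r))"
    using set_integrable_bilinear[OF bounded_bilinear_inner set_integrable_matrix_vector[OF iS _ \<phi>] _ \<phi>]
    by (simp add: inner_commute)
  define q where "q = (\<lambda>r. 2 * (\<phi> r \<bullet> u' r) - \<phi> r \<bullet> (S' r *v \<phi> r))"
  have iq: "set_integrable lborel {a..b} q" unfolding q_def by (intro set_integral_diff set_integrable_mult_right i1 i2)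
  obtain C where C: "\<And>M v. norm (M *v v :: real ^ 'n) \<le> norm (M :: real ^ 'n ^ 'n) * norm v * C" "0 \<le> C"
    using bounded_bilinear.nonneg_bounded[OF bounded_bilinear_matrix_vector_mult] by metis
  have "bounded (\<phi> ` {a..b})" using compact_imp_bounded[OF compact_continuous_image[OF \<phi>]] by simp
  then obtain B where B: "\<And>r. r \<in> {a..b} \<Longrightarrow> norm (\<phi> r) \<le> B"
    unfolding bounded_iff by (metis image_eqI)
  have B0: "0 \<le> B" using B[of a] ab order_trans[OF norm_ge_zero, of "\<phi> a" B] by simp
  \<comment> \<open>Bounds the error density per unit of oscillation of \<open>\<phi>\<close>: four
    error terms arise, two pairing an increment of \<open>\<phi>\<close> with \<open>u' r\<close>
    and two containing \<open>S' r\<close>, with \<open>\<phi>\<close> bounded by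
    \<open>B\<close>.\<close>
  define m where "m = (\<lambda>r. 2 * norm (u' r) + (2 * B * C) * norm (S' r))"
  have im: "set_integrable lborel {a..b} m"
    unfolding m_def by (intro set_integral_add set_integrable_mult_right set_integrable_norm iu iS)
  \<comment> \<open>The defect of the claimed identity on \<open>[s, t]\<close>; it is additive over
    adjacent intervals.\<close>
  define D where "D = (\<lambda>s t. \<phi> t \<bullet> u t - \<phi> s \<bullet> u s - (LBINT r:{s..t}. q r))"
  have sub: "set_integrable lborel {s..t} f" if "a \<le> s" "t \<le> b" "set_integrable lborel {a..b} f"
    for s t and f :: "real \<Rightarrow> 'b::euclidean_space"
    using that by (auto intro: set_integrable_subset)
  have step: "\<bar>D s t\<bar> \<le> \<omega> * (LBINT r:{s..t}. m r)"
    if st: "a \<le> s" "s \<le> t" "t \<le> b"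
      and close: "\<And>r. r \<in> {s..t} \<Longrightarrow> norm (\<phi> s - \<phi> r) \<le> \<omega>" "\<And>r. r \<in> {s..t} \<Longrightarrow> norm (\<phi> t - \<phi> r) \<le> \<omega>"
    for s t \<omega>
  proof -
    have "0 \<le> \<omega>" using close(1)[of s] st by simp
    have "\<phi> t \<bullet> u t - \<phi> s \<bullet> u s = (\<phi> t + \<phi> s) \<bullet> (u t - u s) - \<phi> t \<bullet> ((S t - S s) *v \<phi> s)"
    proof -
      \<comment> \<open>Symmetry of \<open>S t\<close> moves it from \<open>\<phi> t\<close> onto
        \<open>\<phi> s\<close>; all mixed terms then have the form
        \<open>\<phi> t \<bullet> (M *v \<phi> s)\<close>.\<close>
      have "\<phi> s \<bullet> u t = \<phi> t \<bullet> (S t *v \<phi> s)"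
        using eq[of t] sym[of t] st inner_matrix_vector_transpose[of "\<phi> s" "S t" "\<phi> t"]
        by (simp add: inner_commute)
      moreover have "\<phi> t \<bullet> u s = \<phi> t \<bullet> (S s *v \<phi> s)" using eq[of s] st by simp
      ultimately show ?thesis
        by (simp add: inner_add_left inner_diff_right matrix_vector_mult_diff_rdistrib)
    qed
    also have "u t - u s = (LBINT r:{s..t}. u' r)" using is_primitiveD[OF u st] .
    also have "S t - S s = (LBINT r:{s..t}. S' r)" using is_primitiveD[OF S st] .
    also have "(\<phi> t + \<phi> s) \<bullet> (LBINT r:{s..t}. u' r) = (LBINT r:{s..t}. (\<phi> t + \<phi> s) \<bullet> u' r)"
      by (rule set_integral_bounded_linear(2)[OF bl1 sub[OF st(1,3) iu], symmetric])
    also have "\<phi> t \<bullet> ((LBINT r:{s..t}. S' r) *v \<phi> s) = (LBINT r:{s..t}. \<phi> t \<bullet> (S' r *v \<phi> s))"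
      by (rule set_integral_bounded_linear(2)[OF bl2 sub[OF st(1,3) iS], symmetric])
    finally have "D s t = (LBINT r:{s..t}. (\<phi> t + \<phi> s) \<bullet> u' r - \<phi> t \<bullet> (S' r *v \<phi> s) - q r)"
      unfolding D_def
      using set_integral_bounded_linear(1)[OF bl1 sub[OF st(1,3) iu]] set_integral_bounded_linear(1)[OF bl2 sub[OF st(1,3) iS]]
        sub[OF st(1,3) iq] by (subst set_integral_diff(2) | intro set_integral_diff | simp)+
    then have "\<bar>D s t\<bar> \<le> (LBINT r:{s..t}. norm ((\<phi> t + \<phi> s) \<bullet> u' r - \<phi> t \<bullet> (S' r *v \<phi> s) - q r))"
      using norm_set_integral_le[of lborel "{s..t}" "\<lambda>r. (\<phi> t + \<phi> s) \<bullet> u' r - \<phi> t \<bullet> (S' r *v \<phi> s) - q r"] by simp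
    also have "\<dots> \<le> (LBINT r:{s..t}. \<omega> * m r)"
    proof (rule set_integral_mono)
      show "set_integrable lborel {s..t} (\<lambda>r. norm ((\<phi> t + \<phi> s) \<bullet> u' r - \<phi> t \<bullet> (S' r *v \<phi> s) - q r))"
        by (intro set_integrable_norm set_integral_diff sub[OF st(1,3) iq]
            set_integral_bounded_linear(1)[OF bl1 sub[OF st(1,3) iu]] set_integral_bounded_linear(1)[OF bl2 sub[OF st(1,3) iS]])
      show "set_integrable lborel {s..t} (\<lambda>r. \<omega> * m r)" using sub[OF st(1,3) im] by simp
      fix r assume r: "r \<in> {s..t}"
      let ?x = "\<phi> r" and ?p = "\<phi> t - \<phi> r" and ?q = "\<phi> s - \<phi> r"
      have "(\<phi> t + \<phi> s) \<bullet> u' r - \<phi> t \<bullet> (S' r *v \<phi> s) - q r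
          = ?p \<bullet> u' r + ?q \<bullet> u' r - ?p \<bullet> (S' r *v \<phi> s) - ?x \<bullet> (S' r *v ?q)"
        unfolding q_def by (simp add: inner_add_left inner_diff_left inner_diff_right matrix_vector_mult_diff_distrib)
      then have "norm ((\<phi> t + \<phi> s) \<bullet> u' r - \<phi> t \<bullet> (S' r *v \<phi> s) - q r)
          \<le> \<bar>?p \<bullet> u' r\<bar> + \<bar>?q \<bullet> u' r\<bar> + \<bar>?p \<bullet> (S' r *v \<phi> s)\<bar> + \<bar>?x \<bullet> (S' r *v ?q)\<bar>" by simp
      moreover have "\<bar>?p \<bullet> u' r\<bar> \<le> \<omega> * norm (u' r)" "\<bar>?q \<bullet> u' r\<bar> \<le> \<omega> * norm (u' r)"
        using order_trans[OF Cauchy_Schwarz_ineq2 mult_right_mono[OF close(2)[OF r] norm_ge_zero]]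
          order_trans[OF Cauchy_Schwarz_ineq2 mult_right_mono[OF close(1)[OF r] norm_ge_zero]] by auto
      moreover have "\<bar>?p \<bullet> (S' r *v \<phi> s)\<bar> \<le> \<omega> * (norm (S' r) * B * C)"
      proof -
        have "\<bar>?p \<bullet> (S' r *v \<phi> s)\<bar> \<le> norm ?p * norm (S' r *v \<phi> s)" by (rule Cauchy_Schwarz_ineq2)
        also have "\<dots> \<le> \<omega> * (norm (S' r) * B * C)"
          using B[of s] st C(2) close(2)[OF r] \<open>0 \<le> \<omega>\<close>
          by (intro mult_mono order_trans[OF C(1)] mult_right_mono mult_left_mono) auto
        finally show ?thesis .
      qed
      moreover have "\<bar>?x \<bullet> (S' r *v ?q)\<bar> \<le> B * (norm (S' r) * \<omega> * C)"
      proof -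
        have "\<bar>?x \<bullet> (S' r *v ?q)\<bar> \<le> norm ?x * norm (S' r *v ?q)" by (rule Cauchy_Schwarz_ineq2)
        also have "\<dots> \<le> B * (norm (S' r) * \<omega> * C)"
          using B[of r] r st C(2) close(1)[OF r] B0
          by (intro mult_mono order_trans[OF C(1)] mult_right_mono mult_left_mono) auto
        finally show ?thesis .
      qed
      ultimately show "norm ((\<phi> t + \<phi> s) \<bullet> u' r - \<phi> t \<bullet> (S' r *v \<phi> s) - q r) \<le> \<omega> * m r"
        unfolding m_def by (simp add: algebra_simps)
    qed
    finally show ?thesis by simp
  qed
  have small: "\<bar>D a b\<bar> \<le> \<omega> * (LBINT r:{a..b}. m r)" if "0 < \<omega>" for \<omega>
  proof -
    \<comment> \<open>The bisection principle \<open>Bolzano\<close> ranges over all short intervals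
      around a point, and these may leave \<open>[a, b]\<close>; hence the two premises inside
      \<open>Pr\<close>.\<close>
    define Pr where "Pr = (\<lambda>s t. a \<le> s \<longrightarrow> t \<le> b \<longrightarrow> \<bar>D s t\<bar> \<le> \<omega> * (LBINT r:{s..t}. m r))"
    have "Pr a b"
    proof (induction rule: Bolzano[OF ab])
      case (1 s c t)
      show ?case unfolding Pr_def
      proof (intro impI)
        assume h: "a \<le> s" "t \<le> b"
        have "D s t = D s c + D c t"
          unfolding D_def using set_integral_combine[OF sub[OF h iq] 1(3,4)] by simp
        moreover have "(LBINT r:{s..t}. m r) = (LBINT r:{s..c}. m r) + (LBINT r:{c..t}. m r)"
          by (rule set_integral_combine[OF sub[OF h im] 1(3,4)])
        moreover have "\<bar>D s c\<bar> \<le> \<omega> * (LBINT r:{s..c}. m r)" "\<bar>D c t\<bar> \<le> \<omega> * (LBINT r:{c..t}. m r)"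
          using 1 h by (auto simp: Pr_def)
        ultimately show "\<bar>D s t\<bar> \<le> \<omega> * (LBINT r:{s..t}. m r)"
          by (simp add: distrib_left)
      qed
    next
      case (2 x)
      then obtain d where d: "0 < d" "\<And>r. r \<in> {a..b} \<Longrightarrow> dist r x < d \<Longrightarrow> dist (\<phi> r) (\<phi> x) < \<omega> / 2"
        using \<phi> \<open>0 < \<omega>\<close> unfolding continuous_on_iff by (metis atLeastAtMost_iff half_gt_zero)
      show ?case unfolding Pr_def
      proof (intro exI[of _ d] conjI d(1) allI impI)
        fix s t assume h: "s \<le> x \<and> x \<le> t \<and> t - s < d" "a \<le> s" "t \<le> b"
        have cl: "norm (\<phi> p - \<phi> r) \<le> \<omega>" if "p \<in> {s..t}" "r \<in> {s..t}" for p r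
        proof -
          have "dist (\<phi> p) (\<phi> x) < \<omega> / 2" "dist (\<phi> r) (\<phi> x) < \<omega> / 2"
            using that h by (intro d(2); auto simp: dist_real_def)+
          then show ?thesis using dist_triangle_half_l[of "\<phi> p" "\<phi> x" \<omega> "\<phi> r"]
            by (simp add: dist_norm norm_minus_commute)
        qed
        show "\<bar>D s t\<bar> \<le> \<omega> * (LBINT r:{s..t}. m r)"
          using h by (intro step cl) auto
      qed
    qed
    then show ?thesis by (simp add: Pr_def)
  qed
  have "D a b = 0"
  proof (rule ccontr)
    assume n: "D a b \<noteq> 0"
    \<comment> \<open>With \<open>\<omega> = \<bar>D a b\<bar> / (2 * M)\<close> the bound
      \<open>small\<close> yields at most half of \<open>\<bar>D a b\<bar>\<close>; adding 1 keeps
      \<open>M\<close> positive.\<close>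
    define M where "M = \<bar>LBINT r:{a..b}. m r\<bar> + 1"
    have "0 < M" by (simp add: M_def)
    have "\<bar>D a b\<bar> \<le> \<bar>D a b\<bar> / (2 * M) * (LBINT r:{a..b}. m r)"
      using n \<open>0 < M\<close> by (intro small) auto
    also have "\<dots> \<le> \<bar>D a b\<bar> / (2 * M) * M"
      using \<open>0 < M\<close> by (intro mult_left_mono) (auto simp: M_def)
    also have "\<dots> = \<bar>D a b\<bar> / 2" using \<open>0 < M\<close> by simp
    finally show False using n by simp
  qed
  moreover have "(LBINT r:{a..b}. q r) = 2 * (LBINT s:{a..b}. \<phi> s \<bullet> u' s) - (LBINT s:{a..b}. \<phi> s \<bullet> (S' s *v \<phi> s))"
    unfolding q_def by (subst set_integral_diff(2)) (auto simp: i1 i2)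
  ultimately show ?thesis unfolding D_def by simp
qed

section \<open>Auxiliary inequalities and exchanges of integration\<close>

text \<open>Cauchy-Schwarz against the constant 1, obtained as nonnegativity of the variance:
  \<open>m\<close> is the mean of \<open>f\<close>.\<close>

lemma set_integral_square_le:
  fixes f :: "real \<Rightarrow> real"
  assumes ab: "a < b" and f: "continuous_on {a..b} f"
  shows "(LBINT s:{a..b}. f s)\<^sup>2 \<le> (b - a) * (LBINT s:{a..b}. (f s)\<^sup>2)"
proof -
  define m where "m = (LBINT s:{a..b}. f s) / (b - a)"
  have i: "set_integrable lborel {a..b} f" "set_integrable lborel {a..b} (\<lambda>s. (f s)\<^sup>2)"
    "set_integrable lborel {a..b} (\<lambda>s. m\<^sup>2)"
    by (intro set_integrable_continuous continuous_intros f; simp)+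
  have "0 \<le> (LBINT s:{a..b}. (f s - m)\<^sup>2)"
    unfolding set_lebesgue_integral_def by (intro integral_nonneg_AE) (auto simp: indicator_def)
  also have "\<dots> = (LBINT s:{a..b}. (f s)\<^sup>2 - (2 * m) * f s + m\<^sup>2)"
    by (simp add: power2_diff algebra_simps)
  also have "\<dots> = (LBINT s:{a..b}. (f s)\<^sup>2) - 2 * m * (LBINT s:{a..b}. f s) + m\<^sup>2 * (b - a)"
  proof -
    have "(LBINT s:{a..b}. m\<^sup>2) = m\<^sup>2 * (b - a)"
      using ab by (simp add: set_lebesgue_integral_def)
    then show ?thesis
      using i by (subst set_integral_add(2) set_integral_diff(2); simp)+
  qed
  also have "\<dots> = (LBINT s:{a..b}. (f s)\<^sup>2) - (LBINT s:{a..b}. f s)\<^sup>2 / (b - a)"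
  proof -
    have "m * (b - a) = (LBINT s:{a..b}. f s)" using ab by (simp add: m_def)
    then have "m\<^sup>2 * (b - a) = m * (LBINT s:{a..b}. f s)" by (simp add: power2_eq_square)
    moreover have "m * (LBINT s:{a..b}. f s) = (LBINT s:{a..b}. f s)\<^sup>2 / (b - a)"
      by (simp add: m_def power2_eq_square)
    ultimately show ?thesis by simp
  qed
  finally show ?thesis using ab by (simp add: field_simps)
qed

text \<open>The inner product with \<open>\<phi> s\<close> passes through the inner integral for
  almost every \<open>s\<close>, namely where the section of \<open>f\<close> is integrable; this
  suffices under the outer integral.\<close>

lemma set_integral_inner_Fubini:
  fixes f :: "'a::euclidean_space \<times> 'b::euclidean_space \<Rightarrow> 'c::euclidean_space"
  assumes f: "set_integrable lborel (D \<times> D') f" and D: "compact D" "compact D'" and \<phi>: "continuous_on D \<phi>"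
  shows "set_integrable lborel (D \<times> D') (\<lambda>z. \<phi> (fst z) \<bullet> f z)"
    "set_integrable lborel D (\<lambda>s. \<phi> s \<bullet> (LBINT \<theta>:D'. f (s, \<theta>)))"
    "(LBINT s:D. \<phi> s \<bullet> (LBINT \<theta>:D'. f (s, \<theta>))) = (LBINT z:D \<times> D'. \<phi> (fst z) \<bullet> f z)"
proof -
  note fub = set_integral_Fubini[OF f]
  have c: "continuous_on (D \<times> D') (\<lambda>z. \<phi> (fst z))"
    by (rule continuous_on_compose2[OF \<phi>]) (auto intro: continuous_intros)
  show i: "set_integrable lborel (D \<times> D') (\<lambda>z. \<phi> (fst z) \<bullet> f z)"
    using set_integrable_bilinear[OF bounded_bilinear_inner f compact_Times[OF D] c] by (simp add: inner_commute)
  show i2: "set_integrable lborel D (\<lambda>s. \<phi> s \<bullet> (LBINT \<theta>:D'. f (s, \<theta>)))"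
    using set_integrable_bilinear[OF bounded_bilinear_inner fub(1) D(1) \<phi>] by (simp add: inner_commute)
  have "(LBINT s:D. \<phi> s \<bullet> (LBINT \<theta>:D'. f (s, \<theta>)))
      = (LBINT s:D. LBINT \<theta>:D'. \<phi> s \<bullet> f (s, \<theta>))"
    unfolding set_lebesgue_integral_def[of lborel D]
  proof (rule integral_cong_AE)
    show "AE s in lborel. indicator D s *\<^sub>R (\<phi> s \<bullet> (LBINT \<theta>:D'. f (s, \<theta>)))
        = indicator D s *\<^sub>R (LBINT \<theta>:D'. \<phi> s \<bullet> f (s, \<theta>))"
      using fub(3)
    proof eventually_elim
      fix s assume "s \<in> D \<longrightarrow> set_integrable lborel D' (\<lambda>\<theta>. f (s, \<theta>))"
      then show "indicator D s *\<^sub>R (\<phi> s \<bullet> (LBINT \<theta>:D'. f (s, \<theta>)))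
        = indicator D s *\<^sub>R (LBINT \<theta>:D'. \<phi> s \<bullet> f (s, \<theta>))"
        using set_integral_bounded_linear(2)[OF bounded_linear_inner_right, of lborel D' "\<lambda>\<theta>. f (s, \<theta>)" "\<phi> s"]
        by (auto simp: indicator_def)
    qed
  qed (use i2 set_integral_Fubini(1)[OF i] in \<open>auto simp: set_integrable_def\<close>)
  also have "\<dots> = (LBINT z:D \<times> D'. \<phi> (fst z) \<bullet> f z)"
    using set_integral_Fubini(2)[OF i] by simp
  finally show "(LBINT s:D. \<phi> s \<bullet> (LBINT \<theta>:D'. f (s, \<theta>))) = (LBINT z:D \<times> D'. \<phi> (fst z) \<bullet> f z)" .
qed

lemma set_integral_swap:
  fixes f :: "'a::euclidean_space \<times> 'b::euclidean_space \<Rightarrow> 'c::euclidean_space"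
  assumes f: "set_integrable lborel (D \<times> D') f"
  shows "set_integrable lborel (D' \<times> D) (\<lambda>z. f (snd z, fst z))"
    "(LBINT z:D' \<times> D. f (snd z, fst z)) = (LBINT z:D \<times> D'. f z)"
proof -
  define h where "h = (\<lambda>z. indicator (D \<times> D') z *\<^sub>R f z)"
  have h: "integrable (lborel \<Otimes>\<^sub>M lborel) h"
    using f unfolding set_integrable_def h_def lborel_prod .
  have eq: "(\<lambda>z. indicator (D' \<times> D) z *\<^sub>R f (snd z, fst z)) = (\<lambda>(x, y). h (y, x))"
    by (auto simp: h_def indicator_def fun_eq_iff)
  show "set_integrable lborel (D' \<times> D) (\<lambda>z. f (snd z, fst z))"
    using lborel_pair.integrable_product_swap[OF h] unfolding set_integrable_def eq lborel_prod .
  show "(LBINT z:D' \<times> D. f (snd z, fst z)) = (LBINT z:D \<times> D'. f z)"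
    using lborel_pair.integral_product_swap[of h] h
    unfolding set_lebesgue_integral_def eq lborel_prod h_def[symmetric]
    by (auto dest: borel_measurable_integrable simp: lborel_prod)
qed

lemma quadratic_form_transpose:
  fixes M :: "real ^ 'n::finite ^ 'n"
  shows "x \<bullet> (transpose M *v x) = x \<bullet> (M *v x)"
  using inner_matrix_vector_transpose[of x M x] by (simp only: inner_commute)

lemma sum_matrix_vector_mult:
  fixes M :: "'i \<Rightarrow> real ^ 'n::finite ^ 'm::finite"
  shows "(\<Sum>i\<in>I. M i) *v x = (\<Sum>i\<in>I. M i *v x)"
  using linear_sum[OF bounded_linear.linear[OF bounded_bilinear.bounded_linear_left[OF bounded_bilinear_matrix_vector_mult]], of M I x] .

text \<open>Meant for the remainder of the Lyapunov function, of which only the size is accessible.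
  The bound at \<open>r = t\<close> already gives \<open>W t = 0\<close>.\<close>

lemma DERIV_zero_of_quadratic_bound:
  fixes W :: "real \<Rightarrow> real"
  assumes "0 < \<delta>" and b: "\<And>r. \<bar>r - t\<bar> < \<delta> \<Longrightarrow> \<bar>W r\<bar> \<le> M * (r - t)\<^sup>2"
  shows "(W has_real_derivative 0) (at t)"
  unfolding DERIV_def
proof (rule Lim_null_comparison)
  have "W t = 0" using b[of t] assms(1) by simp
  have "\<forall>\<^sub>F h in at (0::real). \<bar>h\<bar> < \<delta> \<and> h \<noteq> 0"
    using assms(1) by (auto simp: eventually_at dist_real_def intro!: exI[of _ \<delta>])
  then show "\<forall>\<^sub>F h in at 0. norm ((W (t + h) - W t) / h) \<le> M * \<bar>h\<bar>"
  proof eventually_elim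
    case (elim h)
    have "\<bar>W (t + h)\<bar> \<le> M * h\<^sup>2" using b[of "t + h"] elim by simp
    moreover have "h\<^sup>2 = \<bar>h\<bar> * \<bar>h\<bar>" by (simp add: power2_eq_square)
    ultimately have "\<bar>W (t + h)\<bar> \<le> M * \<bar>h\<bar> * \<bar>h\<bar>" by (simp only: mult.assoc)
    then show ?case using elim \<open>W t = 0\<close> by (simp add: divide_le_eq)
  qed
  show "((\<lambda>h. M * \<bar>h\<bar>) \<longlongrightarrow> 0) (at 0)" by (rule tendsto_eq_intros refl)+ simp
qed

lemma norm_diff_le_derivative_bound:
  fixes f :: "real \<Rightarrow> 'a::euclidean_space"
  assumes f: "\<And>x. x \<in> {a..b} \<Longrightarrow> (f has_vector_derivative f' x) (at x)"
    and B: "\<And>x. x \<in> {a..b} \<Longrightarrow> norm (f' x) \<le> B" and "p \<in> {a..b}" "q \<in> {a..b}"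
  shows "norm (f p - f q) \<le> B * \<bar>p - q\<bar>"
proof -
  have *: "norm (f q - f p) \<le> B * (q - p)" if pq: "p < q" "a \<le> p" "q \<le> b" for p q
  proof -
    have "norm (f q - f p) \<le> B * q - B * p"
    proof (rule differentiable_bound_general[OF pq(1)])
      show "continuous_on {p..q} f"
        using has_vector_derivative_continuous[OF f] pq by (simp add: continuous_at_imp_continuous_on)
      show "continuous_on {p..q} (\<lambda>x. B * x)" by (intro continuous_intros)
      show "((\<lambda>x. B * x) has_vector_derivative B) (at x)" for x
        by (rule derivative_eq_intros refl | simp)+
      show "(f has_vector_derivative f' x) (at x)" "norm (f' x) \<le> B" if "p < x" "x < q" for x
        using that pq by (auto intro: f B)
    qed
    then show ?thesis by (simp add: right_diff_distrib)
  qed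
  consider "p < q" | "p = q" | "q < p" by linarith
  then show ?thesis
  proof cases
    case 1
    then show ?thesis using *[of p q] assms(3,4) by (simp add: norm_minus_commute)
  next
    case 3
    then show ?thesis using *[of q p] assms(3,4) by simp
  qed simp
qed

section \<open>The operator on continuous histories\<close>

text \<open>Gathers what concerns the operator alone. The system matrices enter in
  \<open>delay_stability\<close>, so the inversion of the operator is independent of the
  dynamics.\<close>

locale delay_operator =
  fixes K :: nat and \<tau> :: "nat \<Rightarrow> real"
    and P :: "real ^ 'n::finite ^ 'n"
    and Q S :: "nat \<Rightarrow> real \<Rightarrow> real ^ 'n ^ 'n"
    and R :: "nat \<Rightarrow> nat \<Rightarrow> real \<times> real \<Rightarrow> real ^ 'n ^ 'n"
    and \<epsilon> :: real
  assumes K: "1 \<le> K" and \<tau>1: "0 < \<tau> 1" and mono: "strict_mono_on {1..K} \<tau>"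
    and S_W2: "\<And>i. i \<in> {1..K} \<Longrightarrow> S i \<in> W2 {-\<tau> i..0}"
    and R_W2: "\<And>i j. i \<in> {1..K} \<Longrightarrow> j \<in> {1..K} \<Longrightarrow> R i j \<in> W2 ({-\<tau> i..0} \<times> {-\<tau> j..0})"
    and Q_W2: "\<And>j. j \<in> {1..K} \<Longrightarrow> Q j \<in> W2 {-\<tau> j..0}"
    and S_sym: "\<And>i s. i \<in> {1..K} \<Longrightarrow> s \<in> {-\<tau> i..0} \<Longrightarrow> S i s = transpose (S i s)"
    and R_sym: "\<And>i j s \<theta>. i \<in> {1..K} \<Longrightarrow> j \<in> {1..K} \<Longrightarrow> s \<in> {-\<tau> i..0} \<Longrightarrow> \<theta> \<in> {-\<tau> j..0} \<Longrightarrow>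
           R i j (s, \<theta>) = transpose (R j i (\<theta>, s))"
    and P_eq: "\<And>i. i \<in> {1..K} \<Longrightarrow> P = \<tau> K *\<^sub>R transpose (Q i 0) + \<tau> K *\<^sub>R S i 0"
    and Q_eq: "\<And>i j s. i \<in> {1..K} \<Longrightarrow> j \<in> {1..K} \<Longrightarrow> s \<in> {-\<tau> j..0} \<Longrightarrow> Q j s = R i j (0, s)"
    and \<epsilon>: "0 < \<epsilon>"
    and coercive: "\<And>z. z \<in> X_space K \<tau> \<Longrightarrow>
           Z_inner inner K \<tau> z (P_op K \<tau> P Q S R z) \<ge> \<epsilon> * (Z_norm K \<tau> z)\<^sup>2"
begin

abbreviation I :: "nat \<Rightarrow> real set" where
  "I i \<equiv> {-\<tau> i..0}"

lemma \<tau>_pos: "i \<in> {1..K} \<Longrightarrow> 0 < \<tau> i"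
  using mono \<tau>1 unfolding strict_mono_on_def by (metis atLeastAtMost_iff le_eq_less_or_eq less_trans order_refl order_trans)

lemma \<tau>_le: "i \<in> {1..K} \<Longrightarrow> \<tau> i \<le> \<tau> K"
  using strict_mono_on_leD[OF mono, of i K] by auto

lemma \<tau>K_pos: "0 < \<tau> K" using \<tau>_pos[of K] K by simp

lemma one_mem: "1 \<in> {1..K}" using K by simp

lemma zero_mem: "i \<in> {1..K} \<Longrightarrow> 0 \<in> I i" and left_mem: "i \<in> {1..K} \<Longrightarrow> -\<tau> i \<in> I i"
  using \<tau>_pos by (simp_all add: less_imp_le)

lemma S_cont: "i \<in> {1..K} \<Longrightarrow> continuous_on (I i) (S i)"
  and Q_cont: "i \<in> {1..K} \<Longrightarrow> continuous_on (I i) (Q i)"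
  and R_cont: "i \<in> {1..K} \<Longrightarrow> j \<in> {1..K} \<Longrightarrow> continuous_on (I i \<times> I j) (R i j)"
  by (rule W2_continuous[OF S_W2] W2_continuous[OF Q_W2] W2_continuous[OF R_W2]; assumption)+

text \<open>Comes from the corner of the kernel: \<open>Q 1 0 = R 1 1 (0, 0)\<close> is symmetric by
  the symmetry of \<open>R\<close>, and \<open>S 1 0\<close> is symmetric.\<close>

lemma P_sym: "transpose P = P"
proof -
  have "Q 1 0 = R 1 1 (0, 0)" using Q_eq[OF one_mem one_mem zero_mem[OF one_mem]] .
  then have "transpose (Q 1 0) = Q 1 0"
    using R_sym[OF one_mem one_mem zero_mem[OF one_mem] zero_mem[OF one_mem]] by simp
  then show ?thesis
    using P_eq[OF one_mem] S_sym[OF one_mem zero_mem[OF one_mem]]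
      linear_add[OF bounded_linear.linear[OF bounded_linear_transpose]]
      linear_scale[OF bounded_linear.linear[OF bounded_linear_transpose]] by metis
qed

text \<open>The head \<open>x\<close> of a state \<open>(x, \<phi>)\<close> is recovered from \<open>\<phi> \<in> E\<close> as \<open>\<phi> 1 0\<close>; the conditions on
  \<open>P\<close> and \<open>Q\<close> are what makes the operator preserve \<open>E\<close>.\<close>

definition E :: "(nat \<Rightarrow> real \<Rightarrow> real ^ 'n) set" where
  "E = {\<phi>. \<forall>i\<in>{1..K}. continuous_on (I i) (\<phi> i) \<and> \<phi> i 0 = \<phi> 1 0}"

definition ip :: "(nat \<Rightarrow> real \<Rightarrow> real ^ 'n) \<Rightarrow> (nat \<Rightarrow> real \<Rightarrow> real ^ 'n) \<Rightarrow> real" where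
  "ip \<phi> \<psi> = \<tau> K * (\<phi> 1 0 \<bullet> \<psi> 1 0) + (\<Sum>i=1..K. LBINT s:I i. \<phi> i s \<bullet> \<psi> i s)"

definition T :: "(nat \<Rightarrow> real \<Rightarrow> real ^ 'n) \<Rightarrow> nat \<Rightarrow> real \<Rightarrow> real ^ 'n" where
  "T \<phi> i s = \<tau> K *\<^sub>R (transpose (Q i s) *v \<phi> 1 0) + \<tau> K *\<^sub>R (S i s *v \<phi> i s)
     + (\<Sum>j=1..K. LBINT \<theta>:I j. R i j (s, \<theta>) *v \<phi> j \<theta>)"

lemma E_cont: "\<phi> \<in> E \<Longrightarrow> i \<in> {1..K} \<Longrightarrow> continuous_on (I i) (\<phi> i)"
  and E_zero: "\<phi> \<in> E \<Longrightarrow> i \<in> {1..K} \<Longrightarrow> \<phi> i 0 = \<phi> 1 0"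
  unfolding E_def by blast+

lemma E_I:
  "(\<And>i. i \<in> {1..K} \<Longrightarrow> continuous_on (I i) (\<phi> i)) \<Longrightarrow> (\<And>i. i \<in> {1..K} \<Longrightarrow> \<phi> i 0 = \<phi> 1 0) \<Longrightarrow> \<phi> \<in> E"
  unfolding E_def by blast

lemma E_diff: "\<phi> \<in> E \<Longrightarrow> \<psi> \<in> E \<Longrightarrow> (\<lambda>i s. \<phi> i s - \<psi> i s) \<in> E"
  by (rule E_I) (rule continuous_on_diff, (rule E_cont; assumption)+, simp only: E_zero)

lemma E_scale: "\<phi> \<in> E \<Longrightarrow> (\<lambda>i s. c *\<^sub>R \<phi> i s) \<in> E"
  by (rule E_I) (rule continuous_on_scaleR[OF continuous_on_const], (rule E_cont; assumption)+, simp only: E_zero)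

lemma R_section:
  assumes "i \<in> {1..K}" "j \<in> {1..K}" "s \<in> I i"
  shows "continuous_on (I j) (\<lambda>\<theta>. R i j (s, \<theta>))"
  using assms by (intro continuous_on_compose2[OF R_cont[OF assms(1,2)]] continuous_intros) auto

lemma R_term_integrable:
  assumes "i \<in> {1..K}" "j \<in> {1..K}" "s \<in> I i" "\<phi> \<in> E"
  shows "set_integrable lborel (I j) (\<lambda>\<theta>. R i j (s, \<theta>) *v \<phi> j \<theta>)"
  by (intro set_integrable_continuous continuous_on_matrix_vector_mult compact_Icc
      R_section[OF assms(1-3)] E_cont[OF assms(4,2)])

lemma inner_integrable:
  assumes "\<phi> \<in> E" "\<psi> \<in> E" "i \<in> {1..K}"
  shows "set_integrable lborel (I i) (\<lambda>s. \<phi> i s \<bullet> \<psi> i s)"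
  by (intro set_integrable_continuous continuous_on_inner compact_Icc
      E_cont[OF assms(1,3)] E_cont[OF assms(2,3)])

lemma ip_commute: "ip \<phi> \<psi> = ip \<psi> \<phi>"
  by (simp add: ip_def inner_commute)

lemma ip_diff_left:
  assumes "\<phi> \<in> E" "\<phi>' \<in> E" "\<psi> \<in> E"
  shows "ip (\<lambda>i s. \<phi> i s - \<phi>' i s) \<psi> = ip \<phi> \<psi> - ip \<phi>' \<psi>"
proof -
  have "(\<Sum>i=1..K. LBINT s:I i. (\<phi> i s - \<phi>' i s) \<bullet> \<psi> i s)
      = (\<Sum>i=1..K. (LBINT s:I i. \<phi> i s \<bullet> \<psi> i s) - (LBINT s:I i. \<phi>' i s \<bullet> \<psi> i s))"
    using assms by (intro sum.cong refl) (simp add: inner_diff_left set_integral_diff(2) inner_integrable)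
  then show ?thesis by (simp add: ip_def inner_diff_left sum_subtractf algebra_simps)
qed

lemma ip_diff_right:
  assumes "\<phi> \<in> E" "\<phi>' \<in> E" "\<psi> \<in> E"
  shows "ip \<psi> (\<lambda>i s. \<phi> i s - \<phi>' i s) = ip \<psi> \<phi> - ip \<psi> \<phi>'"
  using ip_diff_left[OF assms] by (simp add: ip_commute)

lemma ip_scale_left: "ip (\<lambda>i s. c *\<^sub>R \<phi> i s) \<psi> = c * ip \<phi> \<psi>"
  by (simp add: ip_def sum_distrib_left algebra_simps)

lemma ip_scale_right: "ip \<psi> (\<lambda>i s. c *\<^sub>R \<phi> i s) = c * ip \<psi> \<phi>"
  using ip_scale_left ip_commute by metis

lemma ip_parts_nonneg: "0 \<le> (LBINT s:I i. \<phi> i s \<bullet> (\<phi> i s :: real ^ 'n))"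
  unfolding set_lebesgue_integral_def by (intro integral_nonneg_AE) (auto simp: indicator_def)

lemma ip_nonneg: "0 \<le> ip \<phi> \<phi>"
  unfolding ip_def using \<tau>K_pos by (intro add_nonneg_nonneg sum_nonneg ip_parts_nonneg) auto

lemma Z_inner_eq: "Z_inner inner K \<tau> (\<phi> 1 0, \<phi>) (\<psi> 1 0, \<psi>) = ip \<phi> \<psi>"
  by (simp add: Z_inner_def ip_def)

lemma Z_norm_eq: "(Z_norm K \<tau> (\<phi> 1 0, \<phi>))\<^sup>2 = ip \<phi> \<phi>"
  unfolding Z_norm_def Z_inner_eq by (simp only: real_sqrt_pow2 ip_nonneg)

text \<open>At \<open>s = 0\<close> the kernels reduce to \<open>Q j\<close>, and
  \<open>Q i 0\<close> and \<open>S i 0\<close> combine to \<open>P\<close>. The value is therefore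
  independent of \<open>i\<close> and is the first component of \<open>P_op\<close>.\<close>

lemma T_zero:
  assumes \<phi>: "\<phi> \<in> E" and i: "i \<in> {1..K}"
  shows "T \<phi> i 0 = P *v \<phi> 1 0 + (\<Sum>j=1..K. LBINT \<theta>:I j. Q j \<theta> *v \<phi> j \<theta>)"
proof -
  have "(\<Sum>j=1..K. LBINT \<theta>:I j. R i j (0, \<theta>) *v \<phi> j \<theta>)
      = (\<Sum>j=1..K. LBINT \<theta>:I j. Q j \<theta> *v \<phi> j \<theta>)"
    using Q_eq[OF i] by (intro sum.cong refl set_lebesgue_integral_cong) auto
  moreover have "\<tau> K *\<^sub>R (transpose (Q i 0) *v \<phi> 1 0) + \<tau> K *\<^sub>R (S i 0 *v \<phi> 1 0) = P *v \<phi> 1 0"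
    unfolding P_eq[OF i] by (simp add: matrix_vector_mult_add_rdistrib scaleR_matrix_vector_assoc
        del: transpose_matrix_vector)
  ultimately show ?thesis by (simp add: T_def E_zero[OF \<phi> i])
qed

lemma P_op_eq:
  assumes \<phi>: "\<phi> \<in> E"
  shows "P_op K \<tau> P Q S R (\<phi> 1 0, \<phi>) = (T \<phi> 1 0, T \<phi>)"
  unfolding P_op_def prod.case T_zero[OF \<phi> one_mem] by (simp add: T_def fun_eq_iff)

lemma T_in_E:
  assumes \<phi>: "\<phi> \<in> E"
  shows "T \<phi> \<in> E"
proof (rule E_I)
  fix i assume i: "i \<in> {1..K}"
  show "T \<phi> i 0 = T \<phi> 1 0" by (simp only: T_zero[OF \<phi> i] T_zero[OF \<phi> one_mem])
  show "continuous_on (I i) (T \<phi> i)"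
    unfolding T_def
    by (intro continuous_intros continuous_on_matrix_integral Q_cont S_cont R_cont E_cont \<phi> i)
qed

lemma T_diff:
  assumes "\<phi> \<in> E" "\<psi> \<in> E" "i \<in> {1..K}" "s \<in> I i"
  shows "T (\<lambda>i s. \<phi> i s - \<psi> i s) i s = T \<phi> i s - T \<psi> i s"
proof -
  have "(\<Sum>j=1..K. LBINT \<theta>:I j. R i j (s, \<theta>) *v (\<phi> j \<theta> - \<psi> j \<theta>))
     = (\<Sum>j=1..K. (LBINT \<theta>:I j. R i j (s, \<theta>) *v \<phi> j \<theta>) - (LBINT \<theta>:I j. R i j (s, \<theta>) *v \<psi> j \<theta>))"
    using assms by (intro sum.cong refl)
      (simp add: matrix_vector_mult_diff_distrib set_integral_diff(2) R_term_integrable)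
  then show ?thesis by (simp add: T_def matrix_vector_mult_diff_distrib sum_subtractf algebra_simps)
qed

lemma T_scale: "T (\<lambda>i s. c *\<^sub>R \<phi> i s) i s = c *\<^sub>R T \<phi> i s"
  by (simp add: T_def matrix_vector_mult_scaleR scaleR_sum_right algebra_simps)

text \<open>Bounded pointwise convergence, under which all forms below are continuous by dominated convergence.\<close>

definition bconv :: "(nat \<Rightarrow> nat \<Rightarrow> real \<Rightarrow> real ^ 'n) \<Rightarrow> (nat \<Rightarrow> real \<Rightarrow> real ^ 'n) \<Rightarrow> bool" where
  "bconv \<psi> \<phi> \<longleftrightarrow> (\<forall>n. \<psi> n \<in> E) \<and> \<phi> \<in> E \<and>
     (\<exists>B. \<forall>n. \<forall>i\<in>{1..K}. \<forall>s\<in>(I i). norm (\<psi> n i s) \<le> B) \<and>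
     (\<forall>i\<in>{1..K}. \<forall>s\<in>(I i). (\<lambda>n. \<psi> n i s) \<longlonglongrightarrow> \<phi> i s)"

lemma bconvD:
  assumes "bconv \<psi> \<phi>"
  shows "\<psi> n \<in> E" "\<phi> \<in> E" "i \<in> {1..K} \<Longrightarrow> s \<in> I i \<Longrightarrow> (\<lambda>n. \<psi> n i s) \<longlonglongrightarrow> \<phi> i s"
  using assms by (auto simp: bconv_def)

lemma bconv_bound:
  assumes "bconv \<psi> \<phi>"
  shows "\<exists>B\<ge>0. \<forall>n. \<forall>i\<in>{1..K}. \<forall>s\<in>(I i). norm (\<psi> n i s) \<le> B"
proof -
  obtain B where B: "\<forall>n. \<forall>i\<in>{1..K}. \<forall>s\<in>(I i). norm (\<psi> n i s) \<le> B"
    using assms unfolding bconv_def by blast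
  moreover have "0 \<le> B"
    using B one_mem zero_mem[OF one_mem] norm_ge_zero order_trans by blast
  ultimately show ?thesis by blast
qed

lemma bconv_integral_tendsto:
  fixes p :: "'b::euclidean_space \<Rightarrow> real ^ 'n \<Rightarrow> 'c::euclidean_space"
  assumes p: "bounded_bilinear p" and g: "set_integrable lborel (I i) g"
    and \<psi>: "bconv \<psi> \<phi>" and i: "i \<in> {1..K}"
  shows "(\<lambda>n. LBINT s:I i. p (g s) (\<psi> n i s)) \<longlonglongrightarrow> (LBINT s:I i. p (g s) (\<phi> i s))"
proof -
  interpret bounded_bilinear p by fact
  obtain C where C: "\<And>a b. norm (p a b) \<le> norm a * norm b * C" "0 \<le> C"
    using nonneg_bounded by blast
  obtain B where B: "0 \<le> B" "\<forall>n. \<forall>i\<in>{1..K}. \<forall>s\<in>(I i). norm (\<psi> n i s) \<le> B"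
    using bconv_bound[OF \<psi>] by blast
  show ?thesis
  proof (rule set_integral_dominated_convergence)
    show "set_integrable lborel (I i) (\<lambda>s. p (g s) (\<psi> n i s))" for n
      using set_integrable_bilinear[OF p g compact_Icc E_cont[OF bconvD(1)[OF \<psi>] i]] .
    show "set_integrable lborel (I i) (\<lambda>s. p (g s) (\<phi> i s))"
      using set_integrable_bilinear[OF p g compact_Icc E_cont[OF bconvD(2)[OF \<psi>] i]] .
    show "set_integrable lborel (I i) (\<lambda>s. (B * C) * norm (g s))"
      by (intro set_integrable_mult_right set_integrable_norm g)
    show "AE s in lborel. s \<in> I i \<longrightarrow> (\<lambda>n. p (g s) (\<psi> n i s)) \<longlonglongrightarrow> p (g s) (\<phi> i s)"
    proof (rule AE_I2, rule impI)
      fix s assume "s \<in> I i"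
      from tendsto[OF tendsto_const bconvD(3)[OF \<psi> i this]]
      show "(\<lambda>n. p (g s) (\<psi> n i s)) \<longlonglongrightarrow> p (g s) (\<phi> i s)" .
    qed
    show "norm (p (g s) (\<psi> n i s)) \<le> (B * C) * norm (g s)" if "s \<in> I i" for n s
    proof -
      have "norm (p (g s) (\<psi> n i s)) \<le> norm (g s) * norm (\<psi> n i s) * C" by (rule C)
      also have "\<dots> \<le> norm (g s) * B * C" using B(2) i that C(2) by (intro mult_right_mono mult_left_mono) auto
      finally show ?thesis by (simp add: mult_ac)
    qed
  qed
qed

lemma T_tendsto:
  assumes \<psi>: "bconv \<psi> \<phi>" and i: "i \<in> {1..K}" and s: "s \<in> I i"
  shows "(\<lambda>n. T (\<psi> n) i s) \<longlonglongrightarrow> T \<phi> i s"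
  unfolding T_def
proof (intro tendsto_add tendsto_scaleR tendsto_const tendsto_sum
    bounded_linear.tendsto[OF matrix_vector_mul_bounded_linear])
  show "(\<lambda>n. \<psi> n 1 0) \<longlonglongrightarrow> \<phi> 1 0" using bconvD(3)[OF \<psi> one_mem zero_mem[OF one_mem]] .
  show "(\<lambda>n. \<psi> n i s) \<longlonglongrightarrow> \<phi> i s" using bconvD(3)[OF \<psi> i s] .
  fix j assume j: "j \<in> {1..K}"
  have "set_integrable lborel (I j) (\<lambda>\<theta>. R i j (s, \<theta>))"
    by (intro set_integrable_continuous R_section i j s) auto
  then show "(\<lambda>n. LBINT \<theta>:I j. R i j (s, \<theta>) *v \<psi> n j \<theta>)
      \<longlonglongrightarrow> (LBINT \<theta>:I j. R i j (s, \<theta>) *v \<phi> j \<theta>)"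
    by (rule bconv_integral_tendsto[OF bounded_bilinear_matrix_vector_mult _ \<psi> j])
qed

section \<open>The Hilbert norm and boundedness of the operator\<close>

definition nrm :: "(nat \<Rightarrow> real \<Rightarrow> real ^ 'n) \<Rightarrow> real" where
  "nrm \<phi> = sqrt (ip \<phi> \<phi>)"

lemma nrm_square: "(nrm \<phi>)\<^sup>2 = ip \<phi> \<phi>" and nrm_nonneg: "0 \<le> nrm \<phi>"
  by (simp_all add: nrm_def ip_nonneg)

lemma nrm_part:
  assumes "i \<in> {1..K}"
  shows "(LBINT s:I i. \<phi> i s \<bullet> \<phi> i s) \<le> (nrm \<phi>)\<^sup>2"
proof -
  have "(LBINT s:I i. \<phi> i s \<bullet> \<phi> i s) \<le> (\<Sum>i=1..K. LBINT s:I i. \<phi> i s \<bullet> \<phi> i s)"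
    by (rule member_le_sum[OF assms]) (rule ip_parts_nonneg, simp)
  moreover have "0 \<le> \<tau> K * (\<phi> 1 0 \<bullet> \<phi> 1 0)" using \<tau>K_pos by simp
  ultimately show ?thesis unfolding nrm_square ip_def by linarith
qed

lemma norm_head_le: "norm (\<phi> 1 0) \<le> nrm \<phi> / sqrt (\<tau> K)"
proof -
  have "0 \<le> (\<Sum>i=1..K. LBINT s:I i. \<phi> i s \<bullet> \<phi> i s)"
    by (intro sum_nonneg ip_parts_nonneg)
  then have "\<tau> K * (\<phi> 1 0 \<bullet> \<phi> 1 0) \<le> ip \<phi> \<phi>"
    unfolding ip_def by linarith
  then have "(norm (\<phi> 1 0) * sqrt (\<tau> K))\<^sup>2 \<le> (nrm \<phi>)\<^sup>2"
    unfolding nrm_square dot_square_norm power_mult_distrib real_sqrt_pow2[OF less_imp_le[OF \<tau>K_pos]]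
    by (simp only: mult.commute)
  then have "norm (\<phi> 1 0) * sqrt (\<tau> K) \<le> nrm \<phi>"
    using nrm_nonneg by (rule power2_le_imp_le)
  then show ?thesis using \<tau>K_pos by (simp only: pos_le_divide_eq real_sqrt_gt_0_iff)
qed

lemma integral_norm_le:
  assumes \<phi>: "\<phi> \<in> E" and i: "i \<in> {1..K}"
  shows "(LBINT s:I i. norm (\<phi> i s)) \<le> sqrt (\<tau> i) * nrm \<phi>"
proof -
  have "(LBINT s:I i. norm (\<phi> i s))\<^sup>2 \<le> (0 - - \<tau> i) * (LBINT s:I i. (norm (\<phi> i s))\<^sup>2)"
    using \<tau>_pos[OF i] by (intro set_integral_square_le continuous_on_norm E_cont[OF \<phi> i]) auto
  also have "\<dots> = \<tau> i * (LBINT s:I i. \<phi> i s \<bullet> \<phi> i s)" by (simp only: dot_square_norm diff_minus_eq_add add_0)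
  also have "\<dots> \<le> \<tau> i * (nrm \<phi>)\<^sup>2"
    by (rule mult_left_mono[OF nrm_part[OF i] less_imp_le[OF \<tau>_pos[OF i]]])
  also have "\<dots> = (sqrt (\<tau> i) * nrm \<phi>)\<^sup>2"
    unfolding power_mult_distrib real_sqrt_pow2[OF less_imp_le[OF \<tau>_pos[OF i]]] ..
  finally show ?thesis
    by (rule power2_le_imp_le) (intro mult_nonneg_nonneg nrm_nonneg real_sqrt_ge_zero less_imp_le[OF \<tau>_pos[OF i]])
qed

text \<open>Separates multiplication by \<open>\<tau> K *\<^sub>R S i s\<close>, controlled by the
  value of \<open>\<phi>\<close> at the same point, from the head and integral terms, controlled
  everywhere by the Hilbert norm. Both the bump argument and the Neumann series rest on this
  splitting.\<close>

lemma T_bounds: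
  obtains C where "0 < C"
    "\<And>i s v. i \<in> {1..K} \<Longrightarrow> s \<in> I i \<Longrightarrow> norm (\<tau> K *\<^sub>R (S i s *v v)) \<le> C * norm v"
    "\<And>\<phi> i s. \<phi> \<in> E \<Longrightarrow> i \<in> {1..K} \<Longrightarrow> s \<in> I i \<Longrightarrow>
      norm (T \<phi> i s - \<tau> K *\<^sub>R (S i s *v \<phi> i s)) \<le> C * nrm \<phi>"
proof -
  obtain M where M: "\<And>A v. norm ((A :: real ^ 'n ^ 'n) *v v) \<le> norm A * norm v * M" "0 \<le> M"
    using bounded_bilinear.nonneg_bounded[OF bounded_bilinear_matrix_vector_mult] by metis
  have bd: "\<exists>B\<ge>0. \<forall>z\<in>D. norm (f z) \<le> B" if "compact D" "continuous_on D f"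
    for D :: "'x::euclidean_space set" and f :: "'x \<Rightarrow> real ^ 'n ^ 'n"
  proof -
    have "bounded (f ` D)" using compact_imp_bounded[OF compact_continuous_image[OF that(2,1)]] .
    then obtain B where "0 < B" "\<forall>y\<in>f ` D. norm y \<le> B" unfolding bounded_pos by blast
    then show ?thesis by (intro exI[of _ B]) auto
  qed
  have "\<exists>B\<ge>0. \<forall>s\<in>(I i). norm (S i s) \<le> B" if "i \<in> {1..K}" for i
    using bd[OF compact_Icc S_cont[OF that]] .
  then obtain bS where bS: "\<And>i s. i \<in> {1..K} \<Longrightarrow> s \<in> I i \<Longrightarrow> norm (S i s) \<le> bS i"
    "\<And>i. i \<in> {1..K} \<Longrightarrow> 0 \<le> bS i" by metis
  have "\<exists>B\<ge>0. \<forall>s\<in>(I i). norm (transpose (Q i s)) \<le> B" if "i \<in> {1..K}" for i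
    using bd[OF compact_Icc continuous_on_transpose[OF Q_cont[OF that]]] .
  then obtain bQ where bQ: "\<And>i s. i \<in> {1..K} \<Longrightarrow> s \<in> I i \<Longrightarrow> norm (transpose (Q i s)) \<le> bQ i"
    "\<And>i. i \<in> {1..K} \<Longrightarrow> 0 \<le> bQ i" by metis
  have "\<exists>B\<ge>0. \<forall>z\<in>I i \<times> I j. norm (R i j z) \<le> B" if "i \<in> {1..K}" "j \<in> {1..K}" for i j
    using bd[OF compact_Times[OF compact_Icc compact_Icc] R_cont[OF that]] .
  then obtain bR where bR: "\<And>i j z. i \<in> {1..K} \<Longrightarrow> j \<in> {1..K} \<Longrightarrow> z \<in> I i \<times> I j \<Longrightarrow> norm (R i j z) \<le> bR i j"
    "\<And>i j. i \<in> {1..K} \<Longrightarrow> j \<in> {1..K} \<Longrightarrow> 0 \<le> bR i j" by metis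
  \<comment> \<open>Summing over \<open>i\<close> dominates each single constant and so gives bounds
    uniform in \<open>i\<close>; the final \<open>+ 1\<close> makes the constant positive.\<close>
  define C1 where "C1 = (\<Sum>i=1..K. \<tau> K * (bS i * M))"
  define c2 where "c2 i = \<tau> K * (bQ i * (1 / sqrt (\<tau> K)) * M) + (\<Sum>j=1..K. bR i j * M * sqrt (\<tau> j))" for i
  define C2 where "C2 = (\<Sum>i=1..K. c2 i)"
  have c2: "0 \<le> c2 i" if "i \<in> {1..K}" for i
    unfolding c2_def using that bQ bR \<tau>K_pos M(2) \<tau>_pos
    by (intro add_nonneg_nonneg sum_nonneg mult_nonneg_nonneg) (auto simp: less_imp_le)
  have C1: "0 \<le> C1" unfolding C1_def using bS \<tau>K_pos M(2) by (intro sum_nonneg) auto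
  have C2: "0 \<le> C2" unfolding C2_def using c2 by (intro sum_nonneg) auto
  show thesis
  proof (rule that[of "C1 + C2 + 1"])
    show "0 < C1 + C2 + 1" using C1 C2 by simp
    fix i s assume i: "i \<in> {1..K}" and s: "s \<in> I i"
    have a: "norm (S i s *v v) \<le> norm v * (bS i * M)" for v
    proof -
      have "norm (S i s *v v) \<le> norm (S i s) * norm v * M" by (rule M)
      also have "\<dots> \<le> bS i * norm v * M" using bS[OF i] s M(2) by (intro mult_right_mono) auto
      finally show ?thesis by (simp add: mult_ac)
    qed
    have "\<tau> K * (bS i * M) \<le> C1"
      unfolding C1_def using bS M(2) \<tau>K_pos i by (intro member_le_sum) auto
    then have b: "\<tau> K * (bS i * M) \<le> C1 + C2 + 1" using C2 by simp
    show "norm (\<tau> K *\<^sub>R (S i s *v v)) \<le> (C1 + C2 + 1) * norm v" for v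
    proof -
      have "norm (\<tau> K *\<^sub>R (S i s *v v)) \<le> \<tau> K * (norm v * (bS i * M))" using a[of v] \<tau>K_pos by simp
      also have "\<dots> = (\<tau> K * (bS i * M)) * norm v" by simp
      also have "\<dots> \<le> (C1 + C2 + 1) * norm v" using b by (intro mult_right_mono) auto
      finally show ?thesis .
    qed
    fix \<phi> assume \<phi>: "\<phi> \<in> E"
    have "norm (T \<phi> i s - \<tau> K *\<^sub>R (S i s *v \<phi> i s))
        \<le> norm (\<tau> K *\<^sub>R (transpose (Q i s) *v \<phi> 1 0)) + norm (\<Sum>j=1..K. LBINT \<theta>:I j. R i j (s, \<theta>) *v \<phi> j \<theta>)"
      unfolding T_def by (rule order_trans[OF _ norm_triangle_ineq]) (simp add: algebra_simps)
    also have "\<dots> \<le> \<tau> K * (bQ i * (nrm \<phi> / sqrt (\<tau> K)) * M) + (\<Sum>j=1..K. bR i j * M * (sqrt (\<tau> j) * nrm \<phi>))"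
    proof (rule add_mono)
      have "norm (transpose (Q i s) *v \<phi> 1 0) \<le> norm (transpose (Q i s)) * norm (\<phi> 1 0) * M" by (rule M)
      also have "\<dots> \<le> bQ i * (nrm \<phi> / sqrt (\<tau> K)) * M"
        using bQ[OF i] s M(2) norm_head_le[of \<phi>] by (intro mult_right_mono mult_mono) auto
      finally show "norm (\<tau> K *\<^sub>R (transpose (Q i s) *v \<phi> 1 0)) \<le> \<tau> K * (bQ i * (nrm \<phi> / sqrt (\<tau> K)) * M)"
        unfolding norm_scaleR abs_of_pos[OF \<tau>K_pos] by (rule mult_left_mono[OF _ less_imp_le[OF \<tau>K_pos]])
      show "norm (\<Sum>j=1..K. LBINT \<theta>:I j. R i j (s, \<theta>) *v \<phi> j \<theta>)
          \<le> (\<Sum>j=1..K. bR i j * M * (sqrt (\<tau> j) * nrm \<phi>))"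
      proof (rule sum_norm_le)
        fix j assume j: "j \<in> {1..K}"
        have "norm (LBINT \<theta>:I j. R i j (s, \<theta>) *v \<phi> j \<theta>)
            \<le> (LBINT \<theta>:I j. norm (R i j (s, \<theta>) *v \<phi> j \<theta>))" by (rule norm_set_integral_le)
        also have "\<dots> \<le> (LBINT \<theta>:I j. (bR i j * M) * norm (\<phi> j \<theta>))"
        proof (rule set_integral_mono)
          show "set_integrable lborel (I j) (\<lambda>\<theta>. norm (R i j (s, \<theta>) *v \<phi> j \<theta>))"
            by (intro set_integrable_norm R_term_integrable i j s \<phi>)
          show "set_integrable lborel (I j) (\<lambda>\<theta>. (bR i j * M) * norm (\<phi> j \<theta>))"
            by (intro set_integrable_mult_right set_integrable_norm set_integrable_continuous compact_Icc E_cont[OF \<phi> j])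
          fix \<theta> assume t: "\<theta> \<in> I j"
          have "norm (R i j (s, \<theta>) *v \<phi> j \<theta>) \<le> norm (R i j (s, \<theta>)) * norm (\<phi> j \<theta>) * M" by (rule M)
          also have "\<dots> \<le> bR i j * norm (\<phi> j \<theta>) * M"
            using bR(1)[OF i j, of "(s, \<theta>)"] s t M(2) by (intro mult_right_mono) auto
          finally show "norm (R i j (s, \<theta>) *v \<phi> j \<theta>) \<le> (bR i j * M) * norm (\<phi> j \<theta>)" by (simp add: mult_ac)
        qed
        also have "\<dots> = (bR i j * M) * (LBINT \<theta>:I j. norm (\<phi> j \<theta>))" by simp
        also have "\<dots> \<le> (bR i j * M) * (sqrt (\<tau> j) * nrm \<phi>)"
          using bR(2)[OF i j] M(2) by (intro mult_left_mono integral_norm_le \<phi> j) auto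
        finally show "norm (LBINT \<theta>:I j. R i j (s, \<theta>) *v \<phi> j \<theta>) \<le> bR i j * M * (sqrt (\<tau> j) * nrm \<phi>)" .
      qed
    qed
    also have "\<dots> = c2 i * nrm \<phi>"
      unfolding c2_def by (simp add: algebra_simps sum_distrib_left)
    also have "\<dots> \<le> (C1 + C2 + 1) * nrm \<phi>"
    proof (rule mult_right_mono[OF _ nrm_nonneg])
      have "c2 i \<le> C2" unfolding C2_def using c2 i by (intro member_le_sum) auto
      then show "c2 i \<le> C1 + C2 + 1" using C1 by simp
    qed
    finally show "norm (T \<phi> i s - \<tau> K *\<^sub>R (S i s *v \<phi> i s)) \<le> (C1 + C2 + 1) * nrm \<phi>" .
  qed
qed

section \<open>Density of the state space and coercivity on continuous histories\<close>

text \<open>Approximate every component uniformly by polynomials, then shift the component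
  \<open>i\<close> by the constant \<open>\<phi> 1 0 - p n i 0\<close>. This restores the common
  value at 0 and at most doubles the error.\<close>

lemma X_dense:
  assumes \<phi>: "\<phi> \<in> E"
  shows "\<exists>\<psi>. bconv \<psi> \<phi> \<and> (\<forall>n. (\<psi> n 1 0, \<psi> n) \<in> X_space K \<tau>)"
proof -
  have ex: "\<exists>p. polynomial_function p \<and> (\<forall>s\<in>(I i). norm (\<phi> i s - p s) < inverse (real (Suc n)))"
    if "i \<in> {1..K}" for i n
    by (rule Stone_Weierstrass_polynomial_function[OF compact_Icc E_cont[OF \<phi> that]]) simp
  define p where "p n i = (SOME p. polynomial_function p \<and>
    (\<forall>s\<in>(I i). norm (\<phi> i s - p s) < inverse (real (Suc n))))" for n i
  have "polynomial_function (p n i) \<and> (\<forall>s\<in>(I i). norm (\<phi> i s - p n i s) < inverse (real (Suc n)))"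
    if "i \<in> {1..K}" for n i
    unfolding p_def using someI_ex[OF ex[OF that, of n]] .
  then have p: "\<And>n i. i \<in> {1..K} \<Longrightarrow> polynomial_function (p n i)"
    "\<And>n i s. i \<in> {1..K} \<Longrightarrow> s \<in> I i \<Longrightarrow> norm (\<phi> i s - p n i s) < inverse (real (Suc n))"
    by blast+
  define \<psi> where "\<psi> = (\<lambda>n i s. p n i s - p n i 0 + \<phi> 1 0)"
  have zero: "\<psi> n i 0 = \<phi> 1 0" for n i by (simp add: \<psi>_def)
  have close: "norm (\<psi> n i s - \<phi> i s) \<le> 2 * inverse (real (Suc n))" if i: "i \<in> {1..K}" and s: "s \<in> I i" for n i s
  proof -
    have "\<psi> n i s - \<phi> i s = (\<phi> i 0 - p n i 0) - (\<phi> i s - p n i s)"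
      unfolding \<psi>_def E_zero[OF \<phi> i] by simp
    then have "norm (\<psi> n i s - \<phi> i s) \<le> norm (\<phi> i 0 - p n i 0) + norm (\<phi> i s - p n i s)"
      by (simp only: norm_triangle_ineq4)
    then show ?thesis using p(2)[OF i s, of n] p(2)[OF i zero_mem[OF i], of n] by linarith
  qed
  have C1: "\<exists>q. (\<forall>x. (\<psi> n i has_vector_derivative q x) (at x)) \<and> continuous_on UNIV q" if i: "i \<in> {1..K}" for n i
  proof -
    obtain q where q: "polynomial_function q" "\<And>x. (p n i has_vector_derivative q x) (at x)"
      using has_vector_derivative_polynomial_function[OF p(1)[OF i, of n]] by metis
    have "(\<psi> n i has_vector_derivative q x) (at x)" for x
      unfolding \<psi>_def has_vector_derivative_add_const has_vector_derivative_diff_const by (rule q(2))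
    then show ?thesis using continuous_on_polymonial_function[OF q(1)] by (intro exI[of _ q]) simp
  qed
  have W: "\<psi> n i \<in> W2 (I i)" if i: "i \<in> {1..K}" for n i
  proof -
    obtain q where "\<And>x. (\<psi> n i has_vector_derivative q x) (at x)" "continuous_on UNIV q"
      using C1[OF i] by blast
    then show ?thesis using \<tau>_pos[OF i] by (intro W2_of_C1[of _ _ _ q]) simp_all
  qed
  have E: "\<psi> n \<in> E" for n
    by (rule E_I) (erule W2_continuous[OF W], simp only: zero)
  have X: "(\<psi> n 1 0, \<psi> n) \<in> X_space K \<tau>" for n
  proof -
    have "\<psi> n i \<in> L2 (I i)" if "i \<in> {1..K}" for i
      by (rule W2_L2[OF W[OF that]])
    then show ?thesis unfolding X_space_def Z_space_def mem_Collect_eq prod.case zero using W by blast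
  qed
  have lim: "(\<lambda>n. \<psi> n i s) \<longlonglongrightarrow> \<phi> i s" if "i \<in> {1..K}" "s \<in> I i" for i s
  proof -
    have "(\<lambda>n. 2 * inverse (real (Suc n))) \<longlonglongrightarrow> 2 * 0" by (intro tendsto_intros LIMSEQ_inverse_real_of_nat)
    then have z: "(\<lambda>n. 2 * inverse (real (Suc n))) \<longlonglongrightarrow> 0" by (simp only: mult_zero_right)
    have "(\<lambda>n. \<psi> n i s - \<phi> i s) \<longlonglongrightarrow> 0"
      by (rule Lim_null_comparison[OF _ z], rule always_eventually, rule allI, rule close[OF that])
    then show ?thesis by (rule LIM_zero_cancel)
  qed
  have "\<exists>B. \<forall>s\<in>(I i). norm (\<phi> i s) \<le> B" if "i \<in> {1..K}" for i
    using compact_imp_bounded[OF compact_continuous_image[OF E_cont[OF \<phi> that] compact_Icc]]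
    by (simp add: bounded_iff)
  then obtain b where b: "\<And>i s. i \<in> {1..K} \<Longrightarrow> s \<in> I i \<Longrightarrow> norm (\<phi> i s) \<le> b i" by metis
  have bound: "norm (\<psi> n i s) \<le> (\<Sum>i=1..K. \<bar>b i\<bar>) + 2" if i: "i \<in> {1..K}" and s: "s \<in> I i" for n i s
  proof -
    have "norm (\<psi> n i s) \<le> norm (\<psi> n i s - \<phi> i s) + norm (\<phi> i s)"
      by (metis diff_add_cancel norm_triangle_ineq)
    moreover have "2 * inverse (real (Suc n)) \<le> 2" by (simp add: field_simps)
    moreover have "\<bar>b i\<bar> \<le> (\<Sum>i=1..K. \<bar>b i\<bar>)" by (rule member_le_sum[OF i]) auto
    ultimately show ?thesis using close[OF i s, of n] b[OF i s] by linarith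
  qed
  have "bconv \<psi> \<phi>" unfolding bconv_def
  proof (intro conjI allI ballI exI)
    show "\<psi> n \<in> E" for n by (rule E)
    show "\<phi> \<in> E" by (rule \<phi>)
    show "norm (\<psi> n i s) \<le> (\<Sum>i=1..K. \<bar>b i\<bar>) + 2" if "i \<in> {1..K}" "s \<in> I i" for n i s
      using that by (rule bound)
    show "(\<lambda>n. \<psi> n i s) \<longlonglongrightarrow> \<phi> i s" if "i \<in> {1..K}" "s \<in> I i" for i s
      using that by (rule lim)
  qed
  then show ?thesis using X by blast
qed

lemma ip_tendsto:
  assumes \<psi>: "bconv \<psi> \<phi>" and \<psi>': "bconv \<psi>' \<phi>'"
  shows "(\<lambda>n. ip (\<psi> n) (\<psi>' n)) \<longlonglongrightarrow> ip \<phi> \<phi>'"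
  unfolding ip_def
proof (intro tendsto_add tendsto_mult tendsto_const tendsto_sum tendsto_inner)
  show "(\<lambda>n. \<psi> n 1 0) \<longlonglongrightarrow> \<phi> 1 0" using bconvD(3)[OF \<psi> one_mem zero_mem[OF one_mem]] .
  show "(\<lambda>n. \<psi>' n 1 0) \<longlonglongrightarrow> \<phi>' 1 0" using bconvD(3)[OF \<psi>' one_mem zero_mem[OF one_mem]] .
  fix i assume i: "i \<in> {1..K}"
  obtain B where B: "0 \<le> B" "\<forall>n. \<forall>i\<in>{1..K}. \<forall>s\<in>(I i). norm (\<psi> n i s) \<le> B"
    using bconv_bound[OF \<psi>] by blast
  obtain B' where B': "0 \<le> B'" "\<forall>n. \<forall>i\<in>{1..K}. \<forall>s\<in>(I i). norm (\<psi>' n i s) \<le> B'"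
    using bconv_bound[OF \<psi>'] by blast
  show "(\<lambda>n. LBINT s:I i. \<psi> n i s \<bullet> \<psi>' n i s) \<longlonglongrightarrow> (LBINT s:I i. \<phi> i s \<bullet> \<phi>' i s)"
  proof (rule set_integral_dominated_convergence)
    show "set_integrable lborel (I i) (\<lambda>s. \<psi> n i s \<bullet> \<psi>' n i s)" for n
      by (rule inner_integrable[OF bconvD(1)[OF \<psi>] bconvD(1)[OF \<psi>'] i])
    show "set_integrable lborel (I i) (\<lambda>s. \<phi> i s \<bullet> \<phi>' i s)"
      by (rule inner_integrable[OF bconvD(2)[OF \<psi>] bconvD(2)[OF \<psi>'] i])
    show "set_integrable lborel (I i) (\<lambda>s. B * B')"
      by (intro set_integrable_continuous) auto
    show "AE s in lborel. s \<in> I i \<longrightarrow> (\<lambda>n. \<psi> n i s \<bullet> \<psi>' n i s) \<longlonglongrightarrow> \<phi> i s \<bullet> \<phi>' i s"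
    proof (rule AE_I2, rule impI)
      fix s assume "s \<in> I i"
      from tendsto_inner[OF bconvD(3)[OF \<psi> i this] bconvD(3)[OF \<psi>' i this]]
      show "(\<lambda>n. \<psi> n i s \<bullet> \<psi>' n i s) \<longlonglongrightarrow> \<phi> i s \<bullet> \<phi>' i s" .
    qed
    show "norm (\<psi> n i s \<bullet> \<psi>' n i s) \<le> B * B'" if "s \<in> I i" for n s
    proof -
      have "norm (\<psi> n i s \<bullet> \<psi>' n i s) \<le> norm (\<psi> n i s) * norm (\<psi>' n i s)"
        by (simp add: Cauchy_Schwarz_ineq2)
      also have "\<dots> \<le> B * B'" using B B' i that by (intro mult_mono) auto
      finally show ?thesis .
    qed
  qed
qed

text \<open>The pointwise bound combines the common bound on the \<open>\<psi> n\<close> with a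
  bound on their Hilbert norms, which form a convergent sequence.\<close>

lemma bconv_T:
  assumes \<psi>: "bconv \<psi> \<phi>"
  shows "bconv (\<lambda>n. T (\<psi> n)) (T \<phi>)"
proof -
  have "(\<lambda>n. nrm (\<psi> n)) \<longlonglongrightarrow> nrm \<phi>"
    unfolding nrm_def by (intro tendsto_real_sqrt ip_tendsto \<psi>)
  then obtain N where N: "\<And>n. norm (nrm (\<psi> n)) \<le> N"
    using convergentI convergent_imp_Bseq BseqE by metis
  obtain B where B: "0 \<le> B" "\<forall>n. \<forall>i\<in>{1..K}. \<forall>s\<in>(I i). norm (\<psi> n i s) \<le> B"
    using bconv_bound[OF \<psi>] by blast
  obtain C where C: "0 < C"
    "\<forall>i s v. i \<in> {1..K} \<longrightarrow> s \<in> I i \<longrightarrow> norm (\<tau> K *\<^sub>R (S i s *v v)) \<le> C * norm v"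
    "\<forall>\<phi> i s. \<phi> \<in> E \<longrightarrow> i \<in> {1..K} \<longrightarrow> s \<in> I i \<longrightarrow>
      norm (T \<phi> i s - \<tau> K *\<^sub>R (S i s *v \<phi> i s)) \<le> C * nrm \<phi>"
    using T_bounds by metis
  have "norm (T (\<psi> n) i s) \<le> C * B + C * N" if i: "i \<in> {1..K}" and s: "s \<in> I i" for n i s
  proof -
    have "norm (T (\<psi> n) i s) \<le> norm (T (\<psi> n) i s - \<tau> K *\<^sub>R (S i s *v \<psi> n i s)) + norm (\<tau> K *\<^sub>R (S i s *v \<psi> n i s))"
      by (metis diff_add_cancel norm_triangle_ineq)
    also have "\<dots> \<le> C * nrm (\<psi> n) + C * norm (\<psi> n i s)"
      using C(2,3) i s bconvD(1)[OF \<psi>] by (intro add_mono) blast+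
    also have "\<dots> \<le> C * N + C * B"
      using C(1) B(2) i s N[of n] by (intro add_mono mult_left_mono) auto
    finally show ?thesis by linarith
  qed
  then show ?thesis
    unfolding bconv_def using T_in_E bconvD(1,2)[OF \<psi>] T_tendsto[OF \<psi>] by blast
qed

lemma coercive_E:
  assumes \<phi>: "\<phi> \<in> E"
  shows "\<epsilon> * ip \<phi> \<phi> \<le> ip \<phi> (T \<phi>)"
proof -
  obtain \<psi> where \<psi>: "bconv \<psi> \<phi>" "\<And>n. (\<psi> n 1 0, \<psi> n) \<in> X_space K \<tau>"
    using X_dense[OF \<phi>] by blast
  have "\<epsilon> * ip (\<psi> n) (\<psi> n) \<le> ip (\<psi> n) (T (\<psi> n))" for n
    using coercive[OF \<psi>(2)[of n]] unfolding P_op_eq[OF bconvD(1)[OF \<psi>(1)]] Z_norm_eq Z_inner_eq .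
  then show ?thesis
    by (intro LIMSEQ_le[OF tendsto_mult_left[OF ip_tendsto[OF \<psi>(1) \<psi>(1)]] ip_tendsto[OF \<psi>(1) bconv_T[OF \<psi>(1)]]]) blast
qed

lemma nrm_T_le:
  "\<exists>L>0. \<forall>\<phi>\<in>E. nrm (T \<phi>) \<le> L * nrm \<phi>"
proof -
  obtain C where C: "0 < C"
    "\<forall>i s v. i \<in> {1..K} \<longrightarrow> s \<in> I i \<longrightarrow> norm (\<tau> K *\<^sub>R (S i s *v v)) \<le> C * norm v"
    "\<forall>\<phi> i s. \<phi> \<in> E \<longrightarrow> i \<in> {1..K} \<longrightarrow> s \<in> I i \<longrightarrow>
      norm (T \<phi> i s - \<tau> K *\<^sub>R (S i s *v \<phi> i s)) \<le> C * nrm \<phi>"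
    using T_bounds by metis
  \<comment> \<open>The pointwise estimate \<open>C * norm (\<phi> i s) + C * nrm \<phi>\<close> is
    squared and integrated. Its second term is constant in \<open>s\<close> and picks up the total
    mass \<open>\<tau> K + (\<Sum>i=1..K. \<tau> i)\<close>.\<close>
  define M where "M = 2 * C\<^sup>2 * (1 + \<tau> K + (\<Sum>i=1..K. \<tau> i))"
  have sum0: "0 \<le> (\<Sum>i=1..K. \<tau> i)" using \<tau>_pos by (intro sum_nonneg) (auto intro: less_imp_le)
  have M: "0 < M" unfolding M_def using C(1) \<tau>K_pos sum0 by (intro mult_pos_pos) auto
  have "nrm (T \<phi>) \<le> sqrt M * nrm \<phi>" if \<phi>: "\<phi> \<in> E" for \<phi>
  proof -
    define N where "N = (nrm \<phi>)\<^sup>2"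
    have pt: "T \<phi> i s \<bullet> T \<phi> i s \<le> 2 * C\<^sup>2 * (\<phi> i s \<bullet> \<phi> i s) + 2 * C\<^sup>2 * N" if i: "i \<in> {1..K}" and s: "s \<in> I i" for i s
    proof -
      have "norm (T \<phi> i s) \<le> norm (\<tau> K *\<^sub>R (S i s *v \<phi> i s)) + norm (T \<phi> i s - \<tau> K *\<^sub>R (S i s *v \<phi> i s))"
        by (rule norm_triangle_sub)
      also have "\<dots> \<le> C * norm (\<phi> i s) + C * nrm \<phi>"
        using C(2,3) i s \<phi> by (intro add_mono) blast+
      finally have "(norm (T \<phi> i s))\<^sup>2 \<le> (C * norm (\<phi> i s) + C * nrm \<phi>)\<^sup>2"
        by (intro power_mono) auto
      also have "\<dots> \<le> 2 * (C * norm (\<phi> i s))\<^sup>2 + 2 * (C * nrm \<phi>)\<^sup>2"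
        using zero_le_power2[of "C * norm (\<phi> i s) - C * nrm \<phi>"] by (simp add: power2_sum power2_diff)
      finally show ?thesis by (simp add: dot_square_norm power_mult_distrib N_def)
    qed
    have TE: "T \<phi> \<in> E" by (rule T_in_E[OF \<phi>])
    have part: "(LBINT s:I i. T \<phi> i s \<bullet> T \<phi> i s)
        \<le> 2 * C\<^sup>2 * (LBINT s:I i. \<phi> i s \<bullet> \<phi> i s) + 2 * C\<^sup>2 * N * \<tau> i" if i: "i \<in> {1..K}" for i
    proof -
      have i1: "set_integrable lborel (I i) (\<lambda>s. 2 * C\<^sup>2 * (\<phi> i s \<bullet> \<phi> i s))"
        by (intro set_integrable_mult_right inner_integrable[OF \<phi> \<phi> i])
      have i2: "set_integrable lborel (I i) (\<lambda>s. 2 * C\<^sup>2 * N)"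
        by (intro set_integrable_continuous) auto
      have "(LBINT s:I i. T \<phi> i s \<bullet> T \<phi> i s)
          \<le> (LBINT s:I i. 2 * C\<^sup>2 * (\<phi> i s \<bullet> \<phi> i s) + 2 * C\<^sup>2 * N)"
        by (rule set_integral_mono[OF inner_integrable[OF TE TE i] set_integral_add(1)[OF i1 i2] pt[OF i]])
      also have "\<dots> = 2 * C\<^sup>2 * (LBINT s:I i. \<phi> i s \<bullet> \<phi> i s) + (LBINT s:I i. 2 * C\<^sup>2 * N)"
        unfolding set_integral_add(2)[OF i1 i2] set_integral_mult_right ..
      also have "(LBINT s:I i. 2 * C\<^sup>2 * N) = 2 * C\<^sup>2 * N * \<tau> i"
        using \<tau>_pos[OF i] by (simp add: set_lebesgue_integral_def)
      finally show ?thesis .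
    qed
    have "ip (T \<phi>) (T \<phi>) \<le> \<tau> K * (2 * C\<^sup>2 * (\<phi> 1 0 \<bullet> \<phi> 1 0) + 2 * C\<^sup>2 * N)
        + (\<Sum>i=1..K. 2 * C\<^sup>2 * (LBINT s:I i. \<phi> i s \<bullet> \<phi> i s) + 2 * C\<^sup>2 * N * \<tau> i)"
      unfolding ip_def
      by (intro add_mono sum_mono part mult_left_mono pt one_mem zero_mem less_imp_le[OF \<tau>K_pos])
    also have "\<dots> = 2 * C\<^sup>2 * ip \<phi> \<phi> + 2 * C\<^sup>2 * N * (\<tau> K + (\<Sum>i=1..K. \<tau> i))"
      unfolding ip_def by (simp add: sum.distrib sum_distrib_left algebra_simps)
    also have "\<dots> = M * N" unfolding M_def N_def nrm_square by (simp add: algebra_simps)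
    finally have "(nrm (T \<phi>))\<^sup>2 \<le> (sqrt M * nrm \<phi>)\<^sup>2"
      using M unfolding nrm_square power_mult_distrib N_def by (simp add: nrm_square)
    then show ?thesis by (rule power2_le_imp_le) (use M nrm_nonneg in simp)
  qed
  then show ?thesis using M by (intro exI[of _ "sqrt M"]) auto
qed

section \<open>Inversion of the operator\<close>

lemma ip_single_component:
  assumes \<phi>: "\<And>j s. j \<noteq> i \<Longrightarrow> \<phi> j s = 0" and 0: "\<phi> 1 0 = 0" and i: "i \<in> {1..K}"
  shows "ip \<phi> \<psi> = (LBINT s:I i. \<phi> i s \<bullet> \<psi> i s)"
proof -
  have "(\<Sum>j=1..K. LBINT s:I j. \<phi> j s \<bullet> \<psi> j s)
      = (\<Sum>j=1..K. if j = i then LBINT s:I i. \<phi> i s \<bullet> \<psi> i s else 0)"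
    by (rule sum.cong) (auto simp: \<phi>)
  also have "\<dots> = (LBINT s:I i. \<phi> i s \<bullet> \<psi> i s)" using i by simp
  finally show ?thesis unfolding ip_def 0 by simp
qed

text \<open>Coercivity is tested on bumps concentrated near \<open>s0\<close>, for which the integral operator is
  negligible compared with multiplication by \<open>S i\<close>.\<close>

lemma S_lower_bound:
  assumes i: "i \<in> {1..K}" and s0: "s0 \<in> I i"
  shows "\<epsilon> * (v \<bullet> v) \<le> v \<bullet> (\<tau> K *\<^sub>R (S i s0 *v v))"
proof (rule ccontr)
  assume neg: "\<not> \<epsilon> * (v \<bullet> v) \<le> v \<bullet> (\<tau> K *\<^sub>R (S i s0 *v v))"
  define f where "f s = \<epsilon> * (v \<bullet> v) - v \<bullet> (\<tau> K *\<^sub>R (S i s *v v))" for s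
  have f0: "0 < f s0" using neg by (simp add: f_def)
  have cf: "continuous_on (I i) f"
    unfolding f_def by (intro continuous_intros S_cont[OF i])
  \<comment> \<open>Half of the violation at \<open>s0\<close>; by continuity the violation stays
    above \<open>c\<close> near \<open>s0\<close>.\<close>
  define c where "c = f s0 / 2"
  have c: "0 < c" using f0 by (simp add: c_def)
  obtain d where d: "0 < d" "\<And>s. s \<in> I i \<Longrightarrow> dist s s0 < d \<Longrightarrow> dist (f s) (f s0) < c"
    using cf s0 c unfolding continuous_on_iff by metis
  have fc: "c < f s" if "s \<in> I i" "\<bar>s - s0\<bar> < d" for s
    using d(2)[OF that(1)] that(2) unfolding dist_real_def c_def by linarith
  obtain C where C: "0 < C"
    "\<forall>\<phi> i s. \<phi> \<in> E \<longrightarrow> i \<in> {1..K} \<longrightarrow> s \<in> I i \<longrightarrow>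
      norm (T \<phi> i s - \<tau> K *\<^sub>R (S i s *v \<phi> i s)) \<le> C * nrm \<phi>"
    using T_bounds by metis
  \<comment> \<open>Arranged so that \<open>C * (norm v)\<^sup>2 * b\<close> is smaller than
    \<open>c\<close> by exactly \<open>b\<close>, which gives the final contradiction.\<close>
  define b where "b = c / (C * (norm v)\<^sup>2 + 1)"
  have Cv: "0 < C * (norm v)\<^sup>2 + 1" using C(1) by (simp add: add_nonneg_pos)
  have b: "0 < b" unfolding b_def using c Cv by simp
  \<comment> \<open>The width of the bump. The three bounds keep it where the violation persists,
    let it fit into the interval on one side of \<open>s0\<close>, and give
    \<open>sqrt l \<le> b\<close>.\<close>
  define l where "l = min (min (d / 2) (\<tau> i / 2)) (b\<^sup>2)"
  have l: "0 < l" "l < d" "l \<le> \<tau> i / 2" "sqrt l \<le> b"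
    using d(1) \<tau>_pos[OF i] b by (auto simp: l_def intro!: real_le_lsqrt)
  \<comment> \<open>The bump lies to the left of \<open>s0\<close> if there is room. Otherwise it
    lies to the right, and \<open>2 * l \<le> \<tau> i\<close> keeps it below 0.\<close>
  define p where "p = (if s0 - l \<ge> -\<tau> i then s0 - l else s0)"
  define q where "q = p + l"
  have pq: "-\<tau> i \<le> p" "q \<le> 0" "p < q" "p < 0"
    using l s0 \<tau>_pos[OF i] by (auto simp: p_def q_def)
  have near: "\<bar>s - s0\<bar> < d" if "s \<in> {p..q}" for s
    using that l by (auto simp: p_def q_def split: if_splits)
  \<comment> \<open>The positive part of a parabola with zeros at \<open>p\<close> and
    \<open>q\<close>. As \<open>q \<le> 0\<close> it vanishes at 0, so the bump has zero head and
    its other components can be zero.\<close>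
  define k where "k s = max 0 ((s - p) * (q - s))" for s
  have ck: "continuous_on D k" for D unfolding k_def by (intro continuous_intros)
  have k0: "0 \<le> k s" for s by (simp add: k_def)
  have kout: "k s = 0" if "s \<notin> {p..q}" for s
    using that pq(3) by (auto simp: k_def max_def mult_le_0_iff zero_le_mult_iff)
  have kzero: "k 0 = 0" using pq by (auto simp: k_def max_def mult_le_0_iff)
  define \<phi> where "\<phi> = (\<lambda>j s. if j = i then k s *\<^sub>R v else 0)"
  have \<phi>E: "\<phi> \<in> E"
  proof (rule E_I)
    fix j assume "j \<in> {1..K}"
    show "continuous_on (I j) (\<phi> j)"
      by (cases "j = i") (simp_all add: \<phi>_def continuous_on_scaleR ck)
    show "\<phi> j 0 = \<phi> 1 0" by (simp add: \<phi>_def kzero)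
  qed
  have hz: "ip \<phi> \<psi> = (LBINT s:I i. k s *\<^sub>R v \<bullet> \<psi> i s)" for \<psi>
    using ip_single_component[of i \<phi> \<psi>] i by (simp add: \<phi>_def kzero)
  define m where "m = (LBINT s:I i. (k s)\<^sup>2)"
  have ik: "set_integrable lborel (I i) k" and ik2: "set_integrable lborel (I i) (\<lambda>s. (k s)\<^sup>2)"
    by (intro set_integrable_continuous continuous_intros ck compact_Icc)+
  have restrict: "(LBINT s:I i. h s) = (LBINT s:{p..q}. h s)"
    if "\<And>s. s \<notin> {p..q} \<Longrightarrow> h s = 0" for h :: "real \<Rightarrow> real"
    unfolding set_lebesgue_integral_def using that pq
    by (intro Bochner_Integration.integral_cong refl) (auto simp: indicator_def)
  have m_pq: "m = (LBINT s:{p..q}. (k s)\<^sup>2)" unfolding m_def by (rule restrict) (simp add: kout)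
  \<comment> \<open>Here the small support enters: the integral of \<open>k\<close> is at most
    \<open>sqrt l\<close> times its root mean square norm, so the head and integral terms of
    \<open>T\<close> become negligible.\<close>
  have "(LBINT s:{p..q}. k s)\<^sup>2 \<le> (q - p) * m"
    unfolding m_pq by (rule set_integral_square_le[OF pq(3) ck])
  then have ksq: "(LBINT s:I i. k s)\<^sup>2 \<le> l * m"
    by (subst restrict) (simp_all add: kout q_def)
  have m: "0 < m"
  proof -
    have "m = integral {p..q} (\<lambda>s. (k s)\<^sup>2)" unfolding m_pq
      by (intro set_borel_integral_eq_integral set_integrable_continuous continuous_intros ck compact_Icc)
    moreover have "0 \<le> integral {p..q} (\<lambda>s. (k s)\<^sup>2)" by (rule integral_nonneg)
        (auto intro!: integrable_continuous_real continuous_intros ck)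
    moreover have "integral {p..q} (\<lambda>s. (k s)\<^sup>2) \<noteq> 0"
    proof
      assume "integral {p..q} (\<lambda>s. (k s)\<^sup>2) = 0"
      moreover have "continuous_on {p..q} (\<lambda>s. (k s)\<^sup>2)" by (intro continuous_intros ck)
      ultimately have "(k ((p + q) / 2))\<^sup>2 = 0"
        using integral_eq_0_iff[of p q "\<lambda>s. (k s)\<^sup>2"] pq(3) by simp
      moreover have "0 < ((p + q) / 2 - p) * (q - (p + q) / 2)" using pq(3) by (intro mult_pos_pos) auto
      ultimately show False by (simp add: k_def)
    qed
    ultimately show ?thesis by linarith
  qed
  have ip\<phi>: "ip \<phi> \<phi> = (v \<bullet> v) * m"
    unfolding hz m_def by (simp add: \<phi>_def power2_eq_square algebra_simps flip: set_integral_mult_right)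
  have nrm\<phi>: "nrm \<phi> = norm v * sqrt m"
    unfolding nrm_def ip\<phi> by (simp add: real_sqrt_mult norm_eq_sqrt_inner)
  have "(LBINT s:I i. k s) \<le> sqrt (l * m)"
    using ksq by (rule real_le_rsqrt)
  then have kle: "(LBINT s:I i. k s) \<le> b * sqrt m"
    using l(4) m by (simp add: real_sqrt_mult) (meson less_imp_le mult_right_mono order_trans real_sqrt_ge_zero)
  have "ip \<phi> (T \<phi>) \<le> (LBINT s:I i. (\<epsilon> * (v \<bullet> v) - c) * (k s)\<^sup>2 + (norm v * (C * nrm \<phi>)) * k s)"
    unfolding hz
  proof (rule set_integral_mono)
    show "set_integrable lborel (I i) (\<lambda>s. k s *\<^sub>R v \<bullet> T \<phi> i s)"
      by (intro set_integrable_continuous continuous_on_inner continuous_on_scaleR continuous_on_const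
          ck compact_Icc E_cont[OF T_in_E[OF \<phi>E] i])
    show "set_integrable lborel (I i) (\<lambda>s. (\<epsilon> * (v \<bullet> v) - c) * (k s)\<^sup>2 + (norm v * (C * nrm \<phi>)) * k s)"
      by (intro set_integral_add(1) set_integrable_mult_right ik ik2)
    fix s assume s: "s \<in> I i"
    define r where "r = T \<phi> i s - \<tau> K *\<^sub>R (S i s *v \<phi> i s)"
    have "k s *\<^sub>R v \<bullet> T \<phi> i s = (k s)\<^sup>2 * (v \<bullet> (\<tau> K *\<^sub>R (S i s *v v))) + k s * (v \<bullet> r)"
      unfolding r_def by (simp add: \<phi>_def matrix_vector_mult_scaleR inner_diff_right power2_eq_square algebra_simps)
    moreover have "(k s)\<^sup>2 * (v \<bullet> (\<tau> K *\<^sub>R (S i s *v v))) \<le> (k s)\<^sup>2 * (\<epsilon> * (v \<bullet> v) - c)"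
    proof (cases "s \<in> {p..q}")
      case True
      then show ?thesis using fc[OF s near[OF True]] by (intro mult_left_mono) (auto simp: f_def)
    next
      case False
      then show ?thesis by (simp add: kout)
    qed
    moreover have "k s * (v \<bullet> r) \<le> k s * (norm v * (C * nrm \<phi>))"
    proof (rule mult_left_mono[OF _ k0])
      have "norm r \<le> C * nrm \<phi>" unfolding r_def using C(2) \<phi>E i s by blast
      then have "norm v * norm r \<le> norm v * (C * nrm \<phi>)" by (rule mult_left_mono) simp
      then show "v \<bullet> r \<le> norm v * (C * nrm \<phi>)" using norm_cauchy_schwarz[of v r] by linarith
    qed
    ultimately show "k s *\<^sub>R v \<bullet> T \<phi> i s \<le> (\<epsilon> * (v \<bullet> v) - c) * (k s)\<^sup>2 + (norm v * (C * nrm \<phi>)) * k s"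
      by (simp only: mult.commute)
  qed
  also have "\<dots> = (\<epsilon> * (v \<bullet> v) - c) * m + (norm v * (C * nrm \<phi>)) * (LBINT s:I i. k s)"
    by (subst set_integral_add(2)) (auto simp: m_def intro!: set_integrable_mult_right ik ik2 simp del: set_integrable_mult_right_iff)
  also have "\<dots> \<le> (\<epsilon> * (v \<bullet> v) - c) * m + (norm v * (C * nrm \<phi>)) * (b * sqrt m)"
    using C(1) nrm_nonneg by (intro add_left_mono mult_left_mono kle mult_nonneg_nonneg) auto
  also have "(norm v * (C * nrm \<phi>)) * (b * sqrt m) = C * (norm v)\<^sup>2 * b * m"
    unfolding nrm\<phi> using m by (simp add: power2_eq_square)
  finally have "\<epsilon> * ip \<phi> \<phi> \<le> (\<epsilon> * (v \<bullet> v) - c) * m + C * (norm v)\<^sup>2 * b * m"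
    using coercive_E[OF \<phi>E] by linarith
  then have "c * m \<le> (C * (norm v)\<^sup>2 * b) * m" unfolding ip\<phi> by (simp add: algebra_simps)
  then have "c \<le> C * (norm v)\<^sup>2 * b" using m by simp
  moreover have "(C * (norm v)\<^sup>2 + 1) * b = c" unfolding b_def using Cv by simp
  ultimately show False using b by (simp add: distrib_right)
qed

text \<open>The solution is a Neumann series for \<open>G = id - \<eta> T\<close>.  As \<open>G\<close> contracts the Hilbert norm, and
  contracts pointwise up to a multiple of the Hilbert norm, the quantity
  \<open>norm (\<phi> i s) + \<kappa> * nrm \<phi>\<close> is contracted for large \<open>\<kappa>\<close>; the series therefore converges
  uniformly, and completeness of \<open>L\<^sup>2\<close> is not needed.\<close>

lemma T_surjective:
  assumes w: "w \<in> E"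
  shows "\<exists>\<phi>\<in>E. \<forall>i\<in>{1..K}. \<forall>s\<in>(I i). T \<phi> i s = w i s"
proof -
  obtain C where C: "0 < C"
    "\<forall>i s v. i \<in> {1..K} \<longrightarrow> s \<in> I i \<longrightarrow> norm (\<tau> K *\<^sub>R (S i s *v v)) \<le> C * norm v"
    "\<forall>\<phi> i s. \<phi> \<in> E \<longrightarrow> i \<in> {1..K} \<longrightarrow> s \<in> I i \<longrightarrow>
      norm (T \<phi> i s - \<tau> K *\<^sub>R (S i s *v \<phi> i s)) \<le> C * nrm \<phi>"
    using T_bounds by metis
  obtain L1 where L1: "0 < L1" "\<forall>\<phi>\<in>E. nrm (T \<phi>) \<le> L1 * nrm \<phi>" using nrm_T_le by blast
  \<comment> \<open>One constant above the pointwise and the Hilbert bounds of \<open>T\<close>;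
    being larger than \<open>\<epsilon>\<close>, it makes \<open>\<rho>\<close> positive.\<close>
  define L where "L = C + L1 + \<epsilon> + 1"
  have L: "0 < L" "C \<le> L" "L1 \<le> L" "\<epsilon> < L" using C(1) L1(1) \<epsilon> by (auto simp: L_def)
  \<comment> \<open>The step size minimises
    \<open>\<eta>\<^sup>2 * L\<^sup>2 - 2 * \<eta> * \<epsilon> + 1\<close>; the minimum is
    \<open>\<rho>\<^sup>2\<close>.\<close>
  define \<eta> where "\<eta> = \<epsilon> / L\<^sup>2"
  have \<eta>: "0 < \<eta>" using \<epsilon> L(1) by (simp add: \<eta>_def)
  define \<rho> where "\<rho> = sqrt (1 - \<epsilon>\<^sup>2 / L\<^sup>2)"
  have "\<epsilon>\<^sup>2 / L\<^sup>2 < 1" using L \<epsilon> by (simp add: power_strict_mono)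
  then have \<rho>: "0 < \<rho>" "\<rho> < 1" "\<rho>\<^sup>2 = 1 - \<epsilon>\<^sup>2 / L\<^sup>2"
    using \<epsilon> L(1,4) by (auto simp: \<rho>_def)
  have contract: "\<eta>\<^sup>2 * L\<^sup>2 - 2 * \<eta> * \<epsilon> + 1 = \<rho>\<^sup>2"
    unfolding \<rho>(3) \<eta>_def using L(1) by (simp add: field_simps power2_eq_square)
  \<comment> \<open>\<open>r\<close> lies halfway between \<open>\<rho>\<close> and 1, and
    \<open>\<kappa>\<close> solves \<open>\<eta> * L + \<kappa> * \<rho> = \<kappa> * r\<close>: the
    cross term produced by the pointwise estimate is then paid for by the gap between
    \<open>r\<close> and \<open>\<rho>\<close>.\<close>
  define r where "r = (1 + \<rho>) / 2"
  have r: "0 < r" "r < 1" "\<rho> < r" using \<rho> by (auto simp: r_def)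
  define \<kappa> where "\<kappa> = \<eta> * L / (r - \<rho>)"
  have \<kappa>: "0 < \<kappa>" "\<eta> * L + \<kappa> * \<rho> = \<kappa> * r"
    using \<eta> L(1) r(3) by (auto simp: \<kappa>_def field_simps)
  define G where "G \<phi> = (\<lambda>i s. \<phi> i s - \<eta> *\<^sub>R T \<phi> i s)" for \<phi>
  have GE: "G \<phi> \<in> E" if "\<phi> \<in> E" for \<phi>
    unfolding G_def by (intro E_diff E_scale T_in_E that)
  have Gnrm: "nrm (G \<phi>) \<le> \<rho> * nrm \<phi>" if \<phi>: "\<phi> \<in> E" for \<phi>
  proof -
    let ?T = "\<lambda>i s. \<eta> *\<^sub>R T \<phi> i s"
    have TE: "?T \<in> E" by (intro E_scale T_in_E \<phi>)
    have "ip (G \<phi>) (G \<phi>) = ip \<phi> \<phi> - 2 * \<eta> * ip \<phi> (T \<phi>) + \<eta>\<^sup>2 * ip (T \<phi>) (T \<phi>)"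
      unfolding G_def ip_diff_left[OF \<phi> TE E_diff[OF \<phi> TE]] ip_diff_right[OF \<phi> TE \<phi>] ip_diff_right[OF \<phi> TE TE]
        ip_scale_left ip_scale_right ip_commute[of "T \<phi>" \<phi>]
      by (simp add: power2_eq_square algebra_simps)
    also have "\<dots> \<le> ip \<phi> \<phi> - 2 * \<eta> * (\<epsilon> * ip \<phi> \<phi>) + \<eta>\<^sup>2 * (L\<^sup>2 * ip \<phi> \<phi>)"
    proof (intro add_mono diff_left_mono mult_left_mono coercive_E \<phi> order_refl)
      have "nrm (T \<phi>) \<le> L * nrm \<phi>"
        using L1(2) \<phi> mult_right_mono[OF L(3) nrm_nonneg[of \<phi>]] by (blast intro: order_trans)
      then have "(nrm (T \<phi>))\<^sup>2 \<le> (L * nrm \<phi>)\<^sup>2" by (rule power_mono[OF _ nrm_nonneg])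
      then show "ip (T \<phi>) (T \<phi>) \<le> L\<^sup>2 * ip \<phi> \<phi>" unfolding nrm_square power_mult_distrib .
    qed (use \<eta> in auto)
    also have "\<dots> = (\<eta>\<^sup>2 * L\<^sup>2 - 2 * \<eta> * \<epsilon> + 1) * ip \<phi> \<phi>" by (simp add: algebra_simps)
    finally have "(nrm (G \<phi>))\<^sup>2 \<le> (\<rho> * nrm \<phi>)\<^sup>2"
      unfolding contract nrm_square power_mult_distrib .
    then show ?thesis by (rule power2_le_imp_le) (use \<rho> nrm_nonneg in simp)
  qed
  \<comment> \<open>By \<open>S_lower_bound\<close>, multiplication by
    \<open>\<tau> K *\<^sub>R S i s\<close> obeys pointwise the same bounds
    \<open>\<epsilon>\<close> and \<open>L\<close> that \<open>T\<close> obeys in the Hilbert norm,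
    so the same \<open>\<rho>\<close> results.\<close>
  have Gpt: "norm (G \<phi> i s) \<le> \<rho> * norm (\<phi> i s) + \<eta> * (L * nrm \<phi>)"
    if \<phi>: "\<phi> \<in> E" and i: "i \<in> {1..K}" and s: "s \<in> I i" for \<phi> i s
  proof -
    define v where "v = \<phi> i s"
    define y where "y = \<tau> K *\<^sub>R (S i s *v v)"
    have "norm y \<le> L * norm v"
    proof -
      have "norm y \<le> C * norm v" unfolding y_def using C(2) i s by blast
      also have "\<dots> \<le> L * norm v" by (rule mult_right_mono[OF L(2) norm_ge_zero])
      finally show ?thesis .
    qed
    then have "(norm y)\<^sup>2 \<le> (L * norm v)\<^sup>2" by (rule power_mono) simp
    then have y2: "y \<bullet> y \<le> L\<^sup>2 * (v \<bullet> v)" unfolding dot_square_norm power_mult_distrib .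
    have "(v - \<eta> *\<^sub>R y) \<bullet> (v - \<eta> *\<^sub>R y) = v \<bullet> v - 2 * \<eta> * (v \<bullet> y) + \<eta>\<^sup>2 * (y \<bullet> y)"
      by (simp add: inner_diff_left inner_diff_right inner_commute power2_eq_square algebra_simps)
    also have "\<dots> \<le> v \<bullet> v - 2 * \<eta> * (\<epsilon> * (v \<bullet> v)) + \<eta>\<^sup>2 * (L\<^sup>2 * (v \<bullet> v))"
      using \<eta> S_lower_bound[OF i s, of v] y2 unfolding y_def[symmetric]
      by (intro add_mono diff_left_mono mult_left_mono) auto
    also have "\<dots> = (\<eta>\<^sup>2 * L\<^sup>2 - 2 * \<eta> * \<epsilon> + 1) * (v \<bullet> v)" by (simp add: algebra_simps)
    finally have "(norm (v - \<eta> *\<^sub>R y))\<^sup>2 \<le> (\<rho> * norm v)\<^sup>2"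
      unfolding contract dot_square_norm power_mult_distrib .
    then have a: "norm (v - \<eta> *\<^sub>R y) \<le> \<rho> * norm v" by (rule power2_le_imp_le) (use \<rho> in simp)
    have "norm (T \<phi> i s - y) \<le> C * nrm \<phi>" unfolding y_def v_def using C(3) \<phi> i s by blast
    also have "\<dots> \<le> L * nrm \<phi>" by (rule mult_right_mono[OF L(2) nrm_nonneg])
    finally have b: "\<eta> * norm (T \<phi> i s - y) \<le> \<eta> * (L * nrm \<phi>)" using \<eta> by (intro mult_left_mono) auto
    have "G \<phi> i s = (v - \<eta> *\<^sub>R y) - \<eta> *\<^sub>R (T \<phi> i s - y)" unfolding G_def v_def by (simp add: algebra_simps)
    then have "norm (G \<phi> i s) \<le> norm (v - \<eta> *\<^sub>R y) + \<eta> * norm (T \<phi> i s - y)"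
      using norm_triangle_ineq4[of "v - \<eta> *\<^sub>R y" "\<eta> *\<^sub>R (T \<phi> i s - y)"] \<eta> by simp
    then show ?thesis using a b unfolding v_def by linarith
  qed
  define d where "d n = (G ^^ n) w" for n
  have dE: "d n \<in> E" for n unfolding d_def by (induction n) (auto simp: w GE)
  have d_Suc: "d (Suc n) = G (d n)" for n by (simp add: d_def)
  have decay: "norm (d n i s) + \<kappa> * nrm (d n) \<le> r ^ n * (norm (w i s) + \<kappa> * nrm w)"
    if i: "i \<in> {1..K}" and s: "s \<in> I i" for n i s
  proof (induction n)
    case 0
    then show ?case by (simp add: d_def)
  next
    case (Suc n)
    have "norm (d (Suc n) i s) + \<kappa> * nrm (d (Suc n))
        \<le> (\<rho> * norm (d n i s) + \<eta> * (L * nrm (d n))) + \<kappa> * (\<rho> * nrm (d n))"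
      unfolding d_Suc using \<kappa>(1) by (intro add_mono mult_left_mono Gpt[OF dE i s] Gnrm[OF dE]) auto
    also have "\<dots> = \<rho> * norm (d n i s) + (\<eta> * L + \<kappa> * \<rho>) * nrm (d n)" by (simp add: algebra_simps)
    also have "\<dots> \<le> r * norm (d n i s) + (\<kappa> * r) * nrm (d n)"
      unfolding \<kappa>(2) using r(3) by (intro add_mono mult_right_mono[of \<rho> r] order_refl) auto
    also have "\<dots> = r * (norm (d n i s) + \<kappa> * nrm (d n))" by (simp add: algebra_simps)
    also have "\<dots> \<le> r * (r ^ n * (norm (w i s) + \<kappa> * nrm w))" using Suc r(1) by (intro mult_left_mono) auto
    finally show ?case by (simp add: mult.assoc)
  qed
  have "\<exists>B. \<forall>s\<in>(I i). norm (w i s) \<le> B" if "i \<in> {1..K}" for i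
    using compact_imp_bounded[OF compact_continuous_image[OF E_cont[OF w that] compact_Icc]]
    by (simp add: bounded_iff)
  then obtain b where b: "\<And>i s. i \<in> {1..K} \<Longrightarrow> s \<in> I i \<Longrightarrow> norm (w i s) \<le> b i" by metis
  define D where "D = (\<Sum>i=1..K. \<bar>b i\<bar>) + \<kappa> * nrm w"
  have D: "0 \<le> D" unfolding D_def using \<kappa>(1) nrm_nonneg by (intro add_nonneg_nonneg sum_nonneg) auto
  have d_le: "norm (d n i s) \<le> D * r ^ n" if i: "i \<in> {1..K}" and s: "s \<in> I i" for n i s
  proof -
    have "norm (d n i s) \<le> r ^ n * (norm (w i s) + \<kappa> * nrm w)"
      using decay[OF i s, of n] mult_nonneg_nonneg[OF less_imp_le[OF \<kappa>(1)] nrm_nonneg[of "d n"]] by linarith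
    also have "\<dots> \<le> r ^ n * D"
    proof (rule mult_left_mono)
      have "\<bar>b i\<bar> \<le> (\<Sum>i=1..K. \<bar>b i\<bar>)" by (rule member_le_sum[OF i]) auto
      then show "norm (w i s) + \<kappa> * nrm w \<le> D" using b[OF i s] unfolding D_def by linarith
    qed (use r in simp)
    finally show ?thesis by (simp add: mult.commute)
  qed
  \<comment> \<open>Partial sums of the Neumann series. Since \<open>\<eta>\<close> times
    \<open>T\<close> is the identity minus \<open>G\<close>, applying \<open>T\<close> telescopes
    and leaves the error \<open>d n\<close>.\<close>
  define z where "z n = (\<lambda>i s. \<Sum>k<n. \<eta> *\<^sub>R d k i s)" for n
  have z_Suc: "z (Suc n) = (\<lambda>i s. z n i s - (-\<eta>) *\<^sub>R d n i s)" for n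
    by (simp add: z_def)
  have zE: "z n \<in> E" for n
  proof (induction n)
    case 0
    show ?case unfolding z_def by (rule E_I) simp_all
  next
    case (Suc n)
    then show ?case unfolding z_Suc by (intro E_diff E_scale dE)
  qed
  have Tz: "T (z n) i s = w i s - d n i s" if i: "i \<in> {1..K}" and s: "s \<in> I i" for n i s
  proof (induction n)
    case 0
    show ?case by (simp add: z_def d_def T_def)
  next
    case (Suc n)
    have "T (z (Suc n)) i s = T (z n) i s - (-\<eta>) *\<^sub>R T (d n) i s"
      unfolding z_Suc T_diff[OF zE E_scale[OF dE] i s] T_scale ..
    then show ?case unfolding d_Suc G_def Suc by (simp add: algebra_simps)
  qed
  define \<phi> where "\<phi> i s = (\<Sum>k. \<eta> *\<^sub>R d k i s)" for i s
  have summ: "summable (\<lambda>n. \<eta> * D * r ^ n)"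
    using r by (intro summable_mult summable_geometric) auto
  have term_le: "norm (\<eta> *\<^sub>R d k i s) \<le> \<eta> * D * r ^ k" if "i \<in> {1..K}" "s \<in> I i" for k i s
    using mult_left_mono[OF d_le[OF that, of k] less_imp_le[OF \<eta>]] \<eta> by (simp add: mult_ac)
  have unif: "uniform_limit (I i) (\<lambda>n s. z n i s) (\<phi> i) sequentially" if i: "i \<in> {1..K}" for i
    unfolding z_def \<phi>_def by (rule Weierstrass_m_test[OF term_le[OF i] summ])
  have lim: "(\<lambda>n. z n i s) \<longlonglongrightarrow> \<phi> i s" if "i \<in> {1..K}" "s \<in> I i" for i s
    using tendsto_uniform_limitI[OF unif[OF that(1)] that(2)] .
  have \<phi>E: "\<phi> \<in> E"
  proof (rule E_I)
    fix i assume i: "i \<in> {1..K}"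
    show "continuous_on (I i) (\<phi> i)"
      using uniform_limit_theorem[OF always_eventually[OF allI] unif[OF i]] E_cont[OF zE i] by simp
    have "z n i 0 = z n 1 0" for n by (rule E_zero[OF zE i])
    then have "(\<lambda>n. z n 1 0) \<longlonglongrightarrow> \<phi> i 0" using lim[OF i zero_mem[OF i]] by (simp only:)
    then show "\<phi> i 0 = \<phi> 1 0" by (rule LIMSEQ_unique) (rule lim[OF one_mem zero_mem[OF one_mem]])
  qed
  have "bconv z \<phi>"
    unfolding bconv_def
  proof (intro conjI allI ballI exI)
    show "z n \<in> E" for n by (rule zE)
    show "\<phi> \<in> E" by (rule \<phi>E)
    show "(\<lambda>n. z n i s) \<longlonglongrightarrow> \<phi> i s" if "i \<in> {1..K}" "s \<in> I i" for i s using that by (rule lim)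
    show "norm (z n i s) \<le> (\<Sum>k. \<eta> * D * r ^ k)" if h: "i \<in> {1..K}" "s \<in> I i" for n i s
    proof -
      have "norm (z n i s) \<le> (\<Sum>k<n. \<eta> * D * r ^ k)" unfolding z_def by (rule sum_norm_le) (rule term_le[OF h])
      also have "\<dots> \<le> (\<Sum>k. \<eta> * D * r ^ k)"
        using \<eta> D r by (intro sum_le_suminf summ) auto
      finally show ?thesis .
    qed
  qed
  have "T \<phi> i s = w i s" if h: "i \<in> {1..K}" "s \<in> I i" for i s
  proof -
    have "(\<lambda>n. D * r ^ n) \<longlonglongrightarrow> D * 0" using r by (intro tendsto_mult tendsto_const LIMSEQ_power_zero) auto
    then have D0: "(\<lambda>n. D * r ^ n) \<longlonglongrightarrow> 0" by simp
    have "(\<lambda>n. d n i s) \<longlonglongrightarrow> 0"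
      by (rule Lim_null_comparison[OF _ D0], rule always_eventually, rule allI, rule d_le[OF h])
    then have "(\<lambda>n. w i s - d n i s) \<longlonglongrightarrow> w i s - 0" by (intro tendsto_diff tendsto_const)
    then have "(\<lambda>n. T (z n) i s) \<longlonglongrightarrow> w i s" unfolding Tz[OF h] by simp
    with T_tendsto[OF \<open>bconv z \<phi>\<close> h] show ?thesis by (rule LIMSEQ_unique)
  qed
  then show ?thesis using \<phi>E by blast
qed

section \<open>Self-adjointness of the operator\<close>

lemma R_product_integrable:
  assumes "\<phi> \<in> E" "\<psi> \<in> E" "i \<in> {1..K}" "j \<in> {1..K}"
  shows "set_integrable lborel (I i \<times> I j) (\<lambda>z. R i j z *v \<psi> j (snd z))"
    "set_integrable lborel (I i \<times> I j) (\<lambda>z. \<phi> i (fst z) \<bullet> (R i j z *v \<psi> j (snd z)))"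
proof -
  let ?D = "I i \<times> I j"
  have c: "continuous_on ?D (\<lambda>z. \<psi> j (snd z))" "continuous_on ?D (\<lambda>z. \<phi> i (fst z))"
    by (rule continuous_on_compose2[OF E_cont[OF assms(2,4)]]; auto intro: continuous_intros)
      (rule continuous_on_compose2[OF E_cont[OF assms(1,3)]]; auto intro: continuous_intros)
  show "set_integrable lborel ?D (\<lambda>z. R i j z *v \<psi> j (snd z))"
    by (intro set_integrable_continuous compact_Times compact_Icc continuous_on_matrix_vector_mult
        R_cont[OF assms(3,4)] c)
  show "set_integrable lborel ?D (\<lambda>z. \<phi> i (fst z) \<bullet> (R i j z *v \<psi> j (snd z)))"
    by (intro set_integrable_continuous compact_Times compact_Icc continuous_on_inner
        continuous_on_matrix_vector_mult R_cont[OF assms(3,4)] c)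
qed

text \<open>The factor \<open>\<tau> K\<close> before \<open>transpose (Q i s)\<close> in
  \<open>T\<close> equals the weight of the head in \<open>ip\<close>. Exchanging
  \<open>\<phi>\<close> and \<open>\<psi>\<close> therefore interchanges the two \<open>Q\<close>
  terms, and the other terms are symmetric by the symmetry of \<open>P\<close>, \<open>S\<close> and
  \<open>R\<close>.\<close>

lemma ip_T_expand:
  assumes \<phi>: "\<phi> \<in> E" and \<psi>: "\<psi> \<in> E"
  shows "ip \<phi> (T \<psi>) = \<tau> K * (\<phi> 1 0 \<bullet> (P *v \<psi> 1 0))
    + \<tau> K * (\<Sum>i=1..K. \<phi> 1 0 \<bullet> (LBINT s:I i. Q i s *v \<psi> i s))
    + \<tau> K * (\<Sum>i=1..K. \<psi> 1 0 \<bullet> (LBINT s:I i. Q i s *v \<phi> i s))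
    + \<tau> K * (\<Sum>i=1..K. LBINT s:I i. \<phi> i s \<bullet> (S i s *v \<psi> i s))
    + (\<Sum>i=1..K. \<Sum>j=1..K. LBINT z:I i \<times> I j. \<phi> i (fst z) \<bullet> (R i j z *v \<psi> j (snd z)))"
proof -
  have part: "(LBINT s:I i. \<phi> i s \<bullet> T \<psi> i s)
     = \<tau> K * (\<psi> 1 0 \<bullet> (LBINT s:I i. Q i s *v \<phi> i s))
      + \<tau> K * (LBINT s:I i. \<phi> i s \<bullet> (S i s *v \<psi> i s))
      + (\<Sum>j=1..K. LBINT z:I i \<times> I j. \<phi> i (fst z) \<bullet> (R i j z *v \<psi> j (snd z)))"
    if i: "i \<in> {1..K}" for i
  proof -
    have iQ: "set_integrable lborel (I i) (\<lambda>s. Q i s *v \<phi> i s)"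
      by (intro set_integrable_continuous compact_Icc continuous_on_matrix_vector_mult Q_cont[OF i] E_cont[OF \<phi> i])
    have i1: "set_integrable lborel (I i) (\<lambda>s. \<tau> K * (\<psi> 1 0 \<bullet> (Q i s *v \<phi> i s)))"
      by (intro set_integrable_mult_right set_integral_bounded_linear(1)[OF bounded_linear_inner_right iQ])
    have i2: "set_integrable lborel (I i) (\<lambda>s. \<tau> K * (\<phi> i s \<bullet> (S i s *v \<psi> i s)))"
      by (intro set_integrable_mult_right set_integrable_continuous compact_Icc continuous_on_inner
          continuous_on_matrix_vector_mult S_cont[OF i] E_cont[OF \<phi> i] E_cont[OF \<psi> i])
    note fub = set_integral_inner_Fubini[OF R_product_integrable(1)[OF \<phi> \<psi> i] compact_Icc compact_Icc E_cont[OF \<phi> i]]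
    have eq: "\<phi> i s \<bullet> T \<psi> i s = \<tau> K * (\<psi> 1 0 \<bullet> (Q i s *v \<phi> i s)) + \<tau> K * (\<phi> i s \<bullet> (S i s *v \<psi> i s))
        + (\<Sum>j=1..K. \<phi> i s \<bullet> (LBINT \<theta>:I j. R i j (s, \<theta>) *v \<psi> j \<theta>))" for s
      unfolding T_def inner_add_right inner_scaleR_right inner_sum_right
      using inner_matrix_vector_transpose[of "\<psi> 1 0" "Q i s" "\<phi> i s"] by (simp only: inner_commute)
    have i3: "set_integrable lborel (I i) (\<lambda>s. \<Sum>j=1..K. \<phi> i s \<bullet> (LBINT \<theta>:I j. R i j (s, \<theta>) *v \<psi> j \<theta>))"
      by (rule set_integral_sum(1)) (use fub(2) in simp)
    have "(LBINT s:I i. \<Sum>j=1..K. \<phi> i s \<bullet> (LBINT \<theta>:I j. R i j (s, \<theta>) *v \<psi> j \<theta>))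
        = (\<Sum>j=1..K. LBINT s:I i. \<phi> i s \<bullet> (LBINT \<theta>:I j. R i j (s, \<theta>) *v \<psi> j \<theta>))"
      by (rule set_integral_sum(2)) (use fub(2) in simp)
    also have "\<dots> = (\<Sum>j=1..K. LBINT z:I i \<times> I j. \<phi> i (fst z) \<bullet> (R i j z *v \<psi> j (snd z)))"
      by (rule sum.cong[OF refl]) (use fub(3) in simp)
    finally have s3: "(LBINT s:I i. \<Sum>j=1..K. \<phi> i s \<bullet> (LBINT \<theta>:I j. R i j (s, \<theta>) *v \<psi> j \<theta>))
      = (\<Sum>j=1..K. LBINT z:I i \<times> I j. \<phi> i (fst z) \<bullet> (R i j z *v \<psi> j (snd z)))" .
    show ?thesis
      unfolding eq set_integral_add(2)[OF set_integral_add(1)[OF i1 i2] i3] set_integral_add(2)[OF i1 i2] s3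
        set_integral_mult_right set_integral_bounded_linear(2)[OF bounded_linear_inner_right iQ] ..
  qed
  show ?thesis
    unfolding ip_def T_zero[OF \<psi> one_mem] inner_add_right inner_sum_right
    by (simp only: part sum.distrib sum_distrib_left distrib_left add.assoc cong: sum.cong)
qed

lemma T_self_adjoint:
  assumes \<phi>: "\<phi> \<in> E" and \<psi>: "\<psi> \<in> E"
  shows "ip \<phi> (T \<psi>) = ip (T \<phi>) \<psi>"
proof -
  have p: "\<phi> 1 0 \<bullet> (P *v \<psi> 1 0) = \<psi> 1 0 \<bullet> (P *v \<phi> 1 0)"
    using inner_matrix_vector_transpose[of "\<phi> 1 0" P "\<psi> 1 0"] P_sym by (simp only: inner_commute)
  have s: "(LBINT s:I i. \<phi> i s \<bullet> (S i s *v \<psi> i s)) = (LBINT s:I i. \<psi> i s \<bullet> (S i s *v \<phi> i s))"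
    if i: "i \<in> {1..K}" for i
  proof (rule set_lebesgue_integral_cong)
    have "\<phi> i s \<bullet> (S i s *v \<psi> i s) = \<psi> i s \<bullet> (S i s *v \<phi> i s)" if "s \<in> I i" for s
      using inner_matrix_vector_transpose[of "\<phi> i s" "S i s" "\<psi> i s"] S_sym[OF i that] by (simp only: inner_commute)
    then show "\<forall>s. s \<in> I i \<longrightarrow> \<phi> i s \<bullet> (S i s *v \<psi> i s) = \<psi> i s \<bullet> (S i s *v \<phi> i s)" by blast
  qed simp
  have r: "(LBINT z:I i \<times> I j. \<phi> i (fst z) \<bullet> (R i j z *v \<psi> j (snd z)))
      = (LBINT z:I j \<times> I i. \<psi> j (fst z) \<bullet> (R j i z *v \<phi> i (snd z)))"
    if i: "i \<in> {1..K}" and j: "j \<in> {1..K}" for i j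
  proof -
    have "(LBINT z:I i \<times> I j. \<phi> i (fst z) \<bullet> (R i j z *v \<psi> j (snd z)))
      = (LBINT z:I i \<times> I j. \<psi> j (fst (snd z, fst z)) \<bullet> (R j i (snd z, fst z) *v \<phi> i (snd (snd z, fst z))))"
    proof (rule set_lebesgue_integral_cong)
      have "\<phi> i s \<bullet> (R i j (s, t) *v \<psi> j t) = \<psi> j t \<bullet> (R j i (t, s) *v \<phi> i s)"
        if "s \<in> I i" "t \<in> I j" for s t
        using inner_matrix_vector_transpose[of "\<psi> j t" "R j i (t, s)" "\<phi> i s"] R_sym[OF i j that]
        by (simp only: inner_commute)
      then show "\<forall>z. z \<in> I i \<times> I j \<longrightarrow> \<phi> i (fst z) \<bullet> (R i j z *v \<psi> j (snd z))
          = \<psi> j (fst (snd z, fst z)) \<bullet> (R j i (snd z, fst z) *v \<phi> i (snd (snd z, fst z)))" by fastforce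
    qed (intro sets_lborel[THEN equalityD2, THEN subsetD] borel_closed closed_Times closed_atLeastAtMost)
    also have "\<dots> = (LBINT z:I j \<times> I i. \<psi> j (fst z) \<bullet> (R j i z *v \<phi> i (snd z)))"
      by (rule set_integral_swap(2)[OF R_product_integrable(2)[OF \<psi> \<phi> j i]])
    finally show ?thesis .
  qed
  have rr: "(\<Sum>i=1..K. \<Sum>j=1..K. LBINT z:I i \<times> I j. \<phi> i (fst z) \<bullet> (R i j z *v \<psi> j (snd z)))
      = (\<Sum>i=1..K. \<Sum>j=1..K. LBINT z:I i \<times> I j. \<psi> i (fst z) \<bullet> (R i j z *v \<phi> j (snd z)))"
    by (subst sum.swap) (simp only: r cong: sum.cong)
  have ss: "(\<Sum>i=1..K. LBINT s:I i. \<phi> i s \<bullet> (S i s *v \<psi> i s))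
      = (\<Sum>i=1..K. LBINT s:I i. \<psi> i s \<bullet> (S i s *v \<phi> i s))"
    by (rule sum.cong[OF refl s])
  show ?thesis
    unfolding ip_commute[of "T \<phi>"] ip_T_expand[OF \<phi> \<psi>] ip_T_expand[OF \<psi> \<phi>] p rr ss by simp
qed

end

section \<open>The dissipation form\<close>

locale delay_stability = delay_operator K \<tau> P Q S R \<epsilon>
  for K \<tau> and P :: "real ^ 'n::finite ^ 'n" and Q S R \<epsilon> +
  fixes A :: "nat \<Rightarrow> real ^ 'n ^ 'n"
  assumes dissipative: "\<And>x \<phi>. (x, \<phi>) \<in> X_space K \<tau> \<Longrightarrow>
           Z_inner (block_inner K) K \<tau> (boundary_vec \<tau> x \<phi>, \<phi>)
             (D_op K \<tau> A P Q S R (boundary_vec \<tau> x \<phi>, \<phi>)) \<le> - (Z_norm K \<tau> (x, \<phi>))\<^sup>2"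
begin

definition dS :: "nat \<Rightarrow> real \<Rightarrow> real ^ 'n ^ 'n" where "dS i = weak_partial 1 (I i) (S i)"
definition dQ :: "nat \<Rightarrow> real \<Rightarrow> real ^ 'n ^ 'n" where "dQ i = weak_partial 1 (I i) (Q i)"
definition dR :: "nat \<Rightarrow> nat \<Rightarrow> real \<times> real \<Rightarrow> real ^ 'n ^ 'n" where
  "dR i j = weak_partial (1, 0) (I i \<times> I j) (R i j)"

abbreviation Bf :: "nat \<Rightarrow> real \<Rightarrow> real ^ 'n ^ 'n" where "Bf \<equiv> B_fun K \<tau> A Q R"

lemma dS_integrable: "i \<in> {1..K} \<Longrightarrow> set_integrable lborel (I i) (dS i)"
  unfolding dS_def by (rule W2_weak_partial_integrable[OF S_W2]) simp_all

lemma dQ_integrable: "i \<in> {1..K} \<Longrightarrow> set_integrable lborel (I i) (dQ i)"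
  unfolding dQ_def by (rule W2_weak_partial_integrable[OF Q_W2]) simp_all

lemma dR_integrable:
  "i \<in> {1..K} \<Longrightarrow> j \<in> {1..K} \<Longrightarrow> set_integrable lborel (I i \<times> I j) (dR i j)"
  unfolding dR_def by (rule W2_weak_partial_integrable[OF R_W2]) (simp_all add: Basis_prod_def compact_Times)

lemma dQ_term_integrable: "\<phi> \<in> E \<Longrightarrow> i \<in> {1..K} \<Longrightarrow> set_integrable lborel (I i) (\<lambda>\<theta>. dQ i \<theta> *v \<phi> i \<theta>)"
  by (rule set_integrable_matrix_vector[OF dQ_integrable compact_Icc E_cont])

lemma dS_term_integrable:
  assumes "\<phi> \<in> E" "i \<in> {1..K}"
  shows "set_integrable lborel (I i) (\<lambda>s. \<phi> i s \<bullet> (dS i s *v \<phi> i s))"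
proof -
  have c: "continuous_on (I i) (\<phi> i)" by (rule E_cont[OF assms])
  show ?thesis
    using set_integrable_bilinear[OF bounded_bilinear_inner
        set_integrable_matrix_vector[OF dS_integrable[OF assms(2)] compact_Icc c] compact_Icc c]
    by (simp only: inner_commute)
qed

lemma dR_term_integrable:
  assumes "\<phi> \<in> E" "i \<in> {1..K}" "j \<in> {1..K}"
  shows "set_integrable lborel (I i \<times> I j) (\<lambda>z. dR i j z *v \<phi> j (snd z))"
  by (rule set_integrable_matrix_vector[OF dR_integrable[OF assms(2,3)] compact_Times[OF compact_Icc compact_Icc]
        continuous_on_compose2[OF E_cont[OF assms(1,3)]]]) (auto intro: continuous_intros)

definition J :: "nat \<Rightarrow> nat \<Rightarrow> (nat \<Rightarrow> real \<Rightarrow> real ^ 'n) \<Rightarrow> real" where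
  "J i j \<phi> = (LBINT z:I i \<times> I j. \<phi> i (fst z) \<bullet> (dR i j z *v \<phi> j (snd z)))"

lemma Bf_term:
  assumes \<phi>: "\<phi> \<in> E" and i: "i \<in> {1..K}"
  shows "set_integrable lborel (I i) (\<lambda>\<theta>. Bf i \<theta> *v \<phi> i \<theta>)"
    "(LBINT \<theta>:I i. Bf i \<theta> *v \<phi> i \<theta>) = A 0 *v (LBINT \<theta>:I i. Q i \<theta> *v \<phi> i \<theta>)
      + (LBINT \<theta>:I i. dQ i \<theta> *v \<phi> i \<theta>)
      + (\<Sum>j=1..K. A j *v (LBINT \<theta>:I i. R j i (-\<tau> j, \<theta>) *v \<phi> i \<theta>))"
proof -
  have iQ: "set_integrable lborel (I i) (\<lambda>s. Q i s *v \<phi> i s)"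
    by (intro set_integrable_continuous compact_Icc continuous_on_matrix_vector_mult Q_cont[OF i] E_cont[OF \<phi> i])
  have iR: "set_integrable lborel (I i) (\<lambda>\<theta>. R j i (-\<tau> j, \<theta>) *v \<phi> i \<theta>)" if j: "j \<in> {1..K}" for j
    by (rule R_term_integrable[OF j i left_mem[OF j] \<phi>])
  have lin: "bounded_linear (\<lambda>v. A j *v v)" for j by (rule matrix_vector_mul_bounded_linear)
  have eq: "Bf i \<theta> *v \<phi> i \<theta> = A 0 *v (Q i \<theta> *v \<phi> i \<theta>) + dQ i \<theta> *v \<phi> i \<theta>
      + (\<Sum>j=1..K. A j *v (R j i (-\<tau> j, \<theta>) *v \<phi> i \<theta>))" for \<theta>
    unfolding B_fun_def dQ_def[symmetric]
    by (simp only: matrix_vector_mult_add_rdistrib matrix_vector_mul_assoc sum_matrix_vector_mult)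
  note i1 = set_integral_bounded_linear[OF lin iQ]
  note i2 = dQ_term_integrable[OF \<phi> i]
  have i3: "set_integrable lborel (I i) (\<lambda>\<theta>. A j *v (R j i (-\<tau> j, \<theta>) *v \<phi> i \<theta>))" if "j \<in> {1..K}" for j
    by (rule set_integral_bounded_linear(1)[OF lin iR[OF that]])
  have i3s: "set_integrable lborel (I i) (\<lambda>s. \<Sum>j=1..K. A j *v (R j i (-\<tau> j, s) *v \<phi> i s))"
    "(LBINT s:I i. \<Sum>j=1..K. A j *v (R j i (-\<tau> j, s) *v \<phi> i s)) = (\<Sum>j=1..K. LBINT s:I i. A j *v (R j i (-\<tau> j, s) *v \<phi> i s))"
    by (rule set_integral_sum, rule i3, assumption)+
  show "set_integrable lborel (I i) (\<lambda>\<theta>. Bf i \<theta> *v \<phi> i \<theta>)"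
    unfolding eq by (intro set_integral_add(1) i1(1) i2 i3s(1))
  show "(LBINT \<theta>:I i. Bf i \<theta> *v \<phi> i \<theta>) = A 0 *v (LBINT \<theta>:I i. Q i \<theta> *v \<phi> i \<theta>)
      + (LBINT \<theta>:I i. dQ i \<theta> *v \<phi> i \<theta>)
      + (\<Sum>j=1..K. A j *v (LBINT \<theta>:I i. R j i (-\<tau> j, \<theta>) *v \<phi> i \<theta>))"
    unfolding eq set_integral_add(2)[OF set_integral_add(1)[OF i1(1) i2] i3s(1)] set_integral_add(2)[OF i1(1) i2] i1(2)
    by (simp only: i3s(2) set_integral_bounded_linear(2)[OF lin iR] cong: sum.cong)
qed

text \<open>The quadratic form of \<open>D_op\<close> with equal contributions collected, hence the
  factors 2.\<close>

definition D_form :: "(nat \<Rightarrow> real \<Rightarrow> real ^ 'n) \<Rightarrow> real" where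
  "D_form \<phi> = \<tau> K * (\<phi> 1 0 \<bullet> (C0_mat K \<tau> A P Q S *v \<phi> 1 0))
    + 2 * \<tau> K * (\<Sum>i=1..K. \<phi> 1 0 \<bullet> (C_mat K \<tau> A S i *v \<phi> i (-\<tau> i)))
    - \<tau> K * (\<Sum>i=1..K. \<phi> i (-\<tau> i) \<bullet> (S i (-\<tau> i) *v \<phi> i (-\<tau> i)))
    + 2 * \<tau> K * (\<Sum>i=1..K. \<phi> 1 0 \<bullet> (LBINT \<theta>:I i. Bf i \<theta> *v \<phi> i \<theta>))
    + \<tau> K * (\<Sum>i=1..K. LBINT s:I i. \<phi> i s \<bullet> (dS i s *v \<phi> i s))
    + 2 * (\<Sum>i=1..K. \<Sum>j=1..K. J i j \<phi>)"

text \<open>The second summand of \<open>G_fun\<close> is the first one for the pair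
  \<open>(j, i)\<close>, transposed and with the variables exchanged, so its form is
  \<open>J j i \<phi>\<close>. Only derivatives in the first variable of a kernel occur.\<close>

lemma G_term:
  assumes \<phi>: "\<phi> \<in> E" and i: "i \<in> {1..K}" and j: "j \<in> {1..K}"
  shows "set_integrable lborel (I i) (\<lambda>s. \<phi> i s \<bullet> (LBINT \<theta>:I j. G_fun \<tau> R i j s \<theta> *v \<phi> j \<theta>))"
    "(LBINT s:I i. \<phi> i s \<bullet> (LBINT \<theta>:I j. G_fun \<tau> R i j s \<theta> *v \<phi> j \<theta>)) = J i j \<phi> + J j i \<phi>"
proof -
  let ?D = "I i \<times> I j"
  note i1 = dR_term_integrable[OF \<phi> i j]
  have c: "continuous_on ?D (\<lambda>z. \<phi> j (snd z))"
    by (rule continuous_on_compose2[OF E_cont[OF \<phi> j]]) (auto intro: continuous_intros)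
  have i2: "set_integrable lborel ?D (\<lambda>z. transpose (dR j i (snd z, fst z)) *v \<phi> j (snd z))"
    by (rule set_integrable_matrix_vector[OF set_integral_bounded_linear(1)[OF bounded_linear_transpose
          set_integral_swap(1)[OF dR_integrable[OF j i]]] compact_Times[OF compact_Icc compact_Icc] c])
  have eq: "G_fun \<tau> R i j s \<theta> *v \<phi> j \<theta> = dR i j (s, \<theta>) *v \<phi> j (snd (s, \<theta>))
      + transpose (dR j i (snd (s, \<theta>), fst (s, \<theta>))) *v \<phi> j (snd (s, \<theta>))" for s \<theta>
    unfolding G_fun_def dR_def by (simp only: matrix_vector_mult_add_rdistrib fst_conv snd_conv)
  note fub = set_integral_inner_Fubini[OF set_integral_add(1)[OF i1 i2] compact_Icc compact_Icc E_cont[OF \<phi> i]]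
  note fub1 = set_integral_inner_Fubini(1)[OF i1 compact_Icc compact_Icc E_cont[OF \<phi> i]]
  note fub2 = set_integral_inner_Fubini(1)[OF i2 compact_Icc compact_Icc E_cont[OF \<phi> i]]
  show "set_integrable lborel (I i) (\<lambda>s. \<phi> i s \<bullet> (LBINT \<theta>:I j. G_fun \<tau> R i j s \<theta> *v \<phi> j \<theta>))"
    unfolding eq by (rule fub(2))
  have "(LBINT z:?D. \<phi> i (fst z) \<bullet> (transpose (dR j i (snd z, fst z)) *v \<phi> j (snd z)))
      = (LBINT z:?D. \<phi> j (fst (snd z, fst z)) \<bullet> (dR j i (snd z, fst z) *v \<phi> i (snd (snd z, fst z))))"
    unfolding fst_conv snd_conv
    by (simp only: inner_matrix_vector_transpose[of "\<phi> j _" "dR j i _"] inner_commute)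
  also have "\<dots> = J j i \<phi>" unfolding J_def
    by (rule set_integral_swap(2)[OF set_integral_inner_Fubini(1)[OF dR_term_integrable[OF \<phi> j i] compact_Icc compact_Icc E_cont[OF \<phi> j]]])
  finally show "(LBINT s:I i. \<phi> i s \<bullet> (LBINT \<theta>:I j. G_fun \<tau> R i j s \<theta> *v \<phi> j \<theta>)) = J i j \<phi> + J j i \<phi>"
    unfolding eq fub(3) inner_add_right set_integral_add(2)[OF fub1 fub2] by (simp only: J_def)
qed

text \<open>\<open>C_mat\<close> and its transpose contribute equally. So do \<open>B_fun\<close> in
  block 0 and its transpose in the history component, because the weight \<open>\<tau> K\<close> of
  the blocks equals the factor in front of that transpose. The two halves of \<open>G_fun\<close>
  agree after summation over both indices.\<close>

lemma D_op_eq_D_form: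
  assumes \<phi>: "\<phi> \<in> E"
  shows "Z_inner (block_inner K) K \<tau> (boundary_vec \<tau> (\<phi> 1 0) \<phi>, \<phi>)
    (D_op K \<tau> A P Q S R (boundary_vec \<tau> (\<phi> 1 0) \<phi>, \<phi>)) = D_form \<phi>"
proof -
  let ?x = "\<phi> 1 0" and ?v = "boundary_vec \<tau> (\<phi> 1 0) \<phi>"
  define y where "y k = (\<Sum>l=0..K. D_block K \<tau> A P Q S k l *v ?v l)
        + (\<Sum>i=1..K. LBINT \<theta>:I i. (if k = 0 then Bf i \<theta> else 0) *v \<phi> i \<theta>)" for k
  have vk: "?v k = \<phi> k (-\<tau> k)" if "k \<in> {1..K}" for k
    using that by (auto simp: boundary_vec_def)
  have v0: "?v 0 = ?x" by (simp add: boundary_vec_def)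
  have split: "(\<Sum>l=0..K. h l) = h 0 + (\<Sum>l=1..K. h l)" for h :: "nat \<Rightarrow> 'z::comm_monoid_add"
    by (simp add: sum.atLeast_Suc_atMost)
  have y0: "y 0 = C0_mat K \<tau> A P Q S *v ?x + (\<Sum>i=1..K. C_mat K \<tau> A S i *v \<phi> i (-\<tau> i))
      + (\<Sum>i=1..K. LBINT \<theta>:I i. Bf i \<theta> *v \<phi> i \<theta>)"
  proof -
    have "(\<Sum>l=1..K. D_block K \<tau> A P Q S 0 l *v ?v l) = (\<Sum>i=1..K. C_mat K \<tau> A S i *v \<phi> i (-\<tau> i))"
      by (rule sum.cong[OF refl]) (use vk in \<open>auto simp: D_block_def\<close>)
    then show ?thesis unfolding y_def split v0 by (simp add: D_block_def)
  qed
  have yk: "y k = transpose (C_mat K \<tau> A S k) *v ?x - S k (-\<tau> k) *v \<phi> k (-\<tau> k)" if k: "k \<in> {1..K}" for k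
  proof -
    have "(\<Sum>l=1..K. D_block K \<tau> A P Q S k l *v ?v l) = (\<Sum>l=1..K. if l = k then - (S k (-\<tau> k) *v \<phi> k (-\<tau> k)) else 0)"
      by (rule sum.cong[OF refl]) (use vk k in \<open>auto simp: D_block_def
          linear_neg[OF bounded_linear.linear[OF bounded_bilinear.bounded_linear_left[OF bounded_bilinear_matrix_vector_mult]]]\<close>)
    also have "\<dots> = - (S k (-\<tau> k) *v \<phi> k (-\<tau> k))" using k by simp
    finally show ?thesis unfolding y_def split v0 using k
      by (simp add: D_block_def del: transpose_matrix_vector)
  qed
  have block: "block_inner K ?v y = ?x \<bullet> (C0_mat K \<tau> A P Q S *v ?x)
      + 2 * (\<Sum>i=1..K. ?x \<bullet> (C_mat K \<tau> A S i *v \<phi> i (-\<tau> i)))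
      - (\<Sum>i=1..K. \<phi> i (-\<tau> i) \<bullet> (S i (-\<tau> i) *v \<phi> i (-\<tau> i)))
      + (\<Sum>i=1..K. ?x \<bullet> (LBINT \<theta>:I i. Bf i \<theta> *v \<phi> i \<theta>))"
  proof -
    have "(\<Sum>k=1..K. ?v k \<bullet> y k) = (\<Sum>i=1..K. ?x \<bullet> (C_mat K \<tau> A S i *v \<phi> i (-\<tau> i))
        - \<phi> i (-\<tau> i) \<bullet> (S i (-\<tau> i) *v \<phi> i (-\<tau> i)))"
      by (rule sum.cong[OF refl])
        (simp only: vk yk inner_diff_right inner_matrix_vector_transpose[of "\<phi> 1 0" "C_mat K \<tau> A S _"] inner_commute)
    then show ?thesis
      unfolding block_inner_def split v0 y0 inner_add_right inner_sum_right by (simp add: sum_subtractf)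
  qed
  have part: "(LBINT s:I i. \<phi> i s \<bullet> (\<tau> K *\<^sub>R (transpose (Bf i s) *v ?x)
        + \<tau> K *\<^sub>R (weak_partial 1 (I i) (S i) s *v \<phi> i s)
        + (\<Sum>j=1..K. LBINT \<theta>:I j. G_fun \<tau> R i j s \<theta> *v \<phi> j \<theta>)))
      = \<tau> K * (?x \<bullet> (LBINT \<theta>:I i. Bf i \<theta> *v \<phi> i \<theta>))
        + \<tau> K * (LBINT s:I i. \<phi> i s \<bullet> (dS i s *v \<phi> i s))
        + (\<Sum>j=1..K. J i j \<phi> + J j i \<phi>)" if i: "i \<in> {1..K}" for i
  proof -
    have eq: "\<phi> i s \<bullet> (\<tau> K *\<^sub>R (transpose (Bf i s) *v ?x)
        + \<tau> K *\<^sub>R (weak_partial 1 (I i) (S i) s *v \<phi> i s)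
        + (\<Sum>j=1..K. LBINT \<theta>:I j. G_fun \<tau> R i j s \<theta> *v \<phi> j \<theta>))
      = \<tau> K * (?x \<bullet> (Bf i s *v \<phi> i s)) + \<tau> K * (\<phi> i s \<bullet> (dS i s *v \<phi> i s))
        + (\<Sum>j=1..K. \<phi> i s \<bullet> (LBINT \<theta>:I j. G_fun \<tau> R i j s \<theta> *v \<phi> j \<theta>))" for s
      unfolding inner_add_right inner_scaleR_right inner_sum_right dS_def[symmetric]
        inner_matrix_vector_transpose[of "\<phi> 1 0" "Bf i s"] inner_commute[of "\<phi> i s" "transpose (Bf i s) *v ?x"] ..
    note i1 = set_integral_bounded_linear[OF bounded_linear_inner_right[of ?x] Bf_term(1)[OF \<phi> i]]
    note i2 = dS_term_integrable[OF \<phi> i]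
    have i3: "set_integrable lborel (I i) (\<lambda>s. \<Sum>j=1..K. \<phi> i s \<bullet> (LBINT \<theta>:I j. G_fun \<tau> R i j s \<theta> *v \<phi> j \<theta>))"
      "(LBINT s:I i. \<Sum>j=1..K. \<phi> i s \<bullet> (LBINT \<theta>:I j. G_fun \<tau> R i j s \<theta> *v \<phi> j \<theta>)) = (\<Sum>j=1..K. LBINT s:I i. \<phi> i s \<bullet> (LBINT \<theta>:I j. G_fun \<tau> R i j s \<theta> *v \<phi> j \<theta>))"
      by (rule set_integral_sum, rule G_term(1)[OF \<phi> i], assumption)+
    have I1: "set_integrable lborel (I i) (\<lambda>s. \<tau> K * (?x \<bullet> (Bf i s *v \<phi> i s)))"
      and I2: "set_integrable lborel (I i) (\<lambda>s. \<tau> K * (\<phi> i s \<bullet> (dS i s *v \<phi> i s)))"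
      by (intro set_integrable_mult_right i1(1) i2)+
    have "(\<Sum>j=1..K. LBINT s:I i. \<phi> i s \<bullet> (LBINT \<theta>:I j. G_fun \<tau> R i j s \<theta> *v \<phi> j \<theta>))
        = (\<Sum>j=1..K. J i j \<phi> + J j i \<phi>)"
      by (rule sum.cong[OF refl G_term(2)[OF \<phi> i]])
    then show ?thesis
      unfolding eq set_integral_add(2)[OF set_integral_add(1)[OF I1 I2] i3(1)]
        set_integral_add(2)[OF I1 I2] set_integral_mult_right i1(2) i3(2) by simp
  qed
  have JJ: "(\<Sum>i=1..K. \<Sum>j=1..K. J i j \<phi> + J j i \<phi>) = 2 * (\<Sum>i=1..K. \<Sum>j=1..K. J i j \<phi>)"
    using sum.swap[of "\<lambda>i j. J j i \<phi>" "{1..K}" "{1..K}"] by (simp add: sum.distrib)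
  have "Z_inner (block_inner K) K \<tau> (?v, \<phi>) (D_op K \<tau> A P Q S R (?v, \<phi>))
      = \<tau> K * block_inner K ?v y + (\<Sum>i=1..K. \<tau> K * (?x \<bullet> (LBINT \<theta>:I i. Bf i \<theta> *v \<phi> i \<theta>))
        + \<tau> K * (LBINT s:I i. \<phi> i s \<bullet> (dS i s *v \<phi> i s))
        + (\<Sum>j=1..K. J i j \<phi> + J j i \<phi>))"
    unfolding Z_inner_def D_op_def prod.case y_def[symmetric] v0
    by (simp only: part cong: sum.cong)
  also have "\<dots> = D_form \<phi>"
    unfolding block D_form_def sum.distrib[of _ _ "{1..K}"] JJ[unfolded sum.distrib[of _ _ "{1..K}"]]
    by (simp add: sum_distrib_left[symmetric] algebra_simps)
  finally show ?thesis .
qed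

section \<open>Integration by parts\<close>

text \<open>The left side is twice the inner product of \<open>\<phi>\<close> with the generator
  applied to \<open>T \<phi>\<close>: the head carries the delay equation, the histories the
  derivative \<open>f\<close>. In each component \<open>quadratic_primitive\<close> is applied to
  \<open>S i\<close> and \<open>S i s *v \<phi> i s\<close>. Its boundary term at 0 becomes the
  \<open>S i 0\<close> in \<open>C0_mat\<close>, the one at \<open>-\<tau> i\<close> the diagonal
  block \<open>- S i (-\<tau> i)\<close>.\<close>

lemma D_identity:
  assumes \<phi>: "\<phi> \<in> E"
    and f: "\<And>i. i \<in> {1..K} \<Longrightarrow> continuous_on (I i) (f i)"
    and deriv: "\<And>i s. i \<in> {1..K} \<Longrightarrow> s \<in> I i \<Longrightarrow>
      (T \<phi> i has_vector_derivative f i s) (at s within (I i))"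
  shows "2 * (\<tau> K * (\<phi> 1 0 \<bullet> (A 0 *v T \<phi> 1 0 + (\<Sum>i=1..K. A i *v T \<phi> i (-\<tau> i))))
      + (\<Sum>i=1..K. LBINT s:I i. \<phi> i s \<bullet> f i s)) = D_form \<phi>"
proof -
  let ?x = "\<phi> 1 0"
  let ?t = "\<tau> K"
  have part: "2 * (LBINT s:I i. \<phi> i s \<bullet> f i s)
      = ?t * (?x \<bullet> (S i 0 *v ?x)) - ?t * (\<phi> i (-\<tau> i) \<bullet> (S i (-\<tau> i) *v \<phi> i (-\<tau> i)))
        + ?t * (LBINT s:I i. \<phi> i s \<bullet> (dS i s *v \<phi> i s))
        + 2 * ?t * (?x \<bullet> (LBINT s:I i. dQ i s *v \<phi> i s)) + 2 * (\<Sum>j=1..K. J i j \<phi>)"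
    if i: "i \<in> {1..K}" for i
  proof -
    \<comment> \<open>\<open>F\<close> and \<open>q\<close> are densities of the kernel term and of
      the \<open>Q\<close> term of \<open>T \<phi> i\<close>. Solving the definition of
      \<open>T\<close> for \<open>S i s *v \<phi> i s\<close> then gives its density
      \<open>u'\<close>.\<close>
    define F where "F s = (\<Sum>j=1..K. LBINT \<theta>:I j. dR i j (s, \<theta>) *v \<phi> j \<theta>)" for s
    define q where "q s = ?t *\<^sub>R (transpose (dQ i s) *v ?x)" for s
    define u' where "u' s = (1 / ?t) *\<^sub>R (f i s - q s - F s)" for s
    have linq: "bounded_linear (\<lambda>M :: real ^ 'n ^ 'n. ?t *\<^sub>R (transpose M *v ?x))"
      by (rule bounded_linear_compose[OF bounded_linear_scaleR_right
            bounded_linear_compose[OF bounded_bilinear.bounded_linear_left[OF bounded_bilinear_matrix_vector_mult] bounded_linear_transpose]])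
    have pq: "is_primitive (-\<tau> i) 0 q (\<lambda>s. ?t *\<^sub>R (transpose (Q i s) *v ?x))"
      unfolding q_def dQ_def by (rule is_primitive_linear[OF linq W2_is_primitive[OF Q_W2[OF i]]])
    have pF: "is_primitive (-\<tau> i) 0 F (\<lambda>s. \<Sum>j=1..K. LBINT \<theta>:I j. R i j (s, \<theta>) *v \<phi> j \<theta>)"
      unfolding F_def dR_def
    proof (rule is_primitive_sum)
      fix j assume j: "j \<in> {1..K}"
      have "-\<tau> j < 0" using \<tau>_pos[OF j] by simp
      then show "is_primitive (-\<tau> i) 0
          (\<lambda>s. LBINT \<theta>:I j. weak_partial (1, 0) (I i \<times> I j) (R i j) (s, \<theta>) *v \<phi> j \<theta>)
          (\<lambda>s. LBINT \<theta>:I j. R i j (s, \<theta>) *v \<phi> j \<theta>)"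
        by (rule is_primitive_matrix_integral[OF R_W2[OF i j] _ E_cont[OF \<phi> j]])
    qed
    have pw: "is_primitive (-\<tau> i) 0 (f i) (T \<phi> i)"
      by (rule is_primitive_C1[OF f[OF i] deriv[OF i]])
    have pu: "is_primitive (-\<tau> i) 0 u' (\<lambda>s. (1 / ?t) *\<^sub>R (T \<phi> i s - ?t *\<^sub>R (transpose (Q i s) *v ?x)
        - (\<Sum>j=1..K. LBINT \<theta>:I j. R i j (s, \<theta>) *v \<phi> j \<theta>)))"
      unfolding u'_def by (rule is_primitive_linear[OF bounded_linear_scaleR_right is_primitive_diff[OF is_primitive_diff[OF pw pq] pF]])
    have u_eq: "(1 / ?t) *\<^sub>R (T \<phi> i s - ?t *\<^sub>R (transpose (Q i s) *v ?x)
        - (\<Sum>j=1..K. LBINT \<theta>:I j. R i j (s, \<theta>) *v \<phi> j \<theta>)) = S i s *v \<phi> i s" for s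
      unfolding T_def using \<tau>K_pos by simp
    have quad: "\<phi> i 0 \<bullet> (S i 0 *v \<phi> i 0) - \<phi> i (-\<tau> i) \<bullet> (S i (-\<tau> i) *v \<phi> i (-\<tau> i))
        = 2 * (LBINT s:I i. \<phi> i s \<bullet> u' s) - (LBINT s:I i. \<phi> i s \<bullet> (dS i s *v \<phi> i s))"
    proof (rule quadratic_primitive[where S = "S i" and u = "\<lambda>s. S i s *v \<phi> i s"])
      show "-\<tau> i \<le> 0" using \<tau>_pos[OF i] by simp
      show "continuous_on (I i) (\<phi> i)" by (rule E_cont[OF \<phi> i])
      show "is_primitive (-\<tau> i) 0 (dS i) (S i)" unfolding dS_def by (rule W2_is_primitive[OF S_W2[OF i]])
      show "is_primitive (-\<tau> i) 0 u' (\<lambda>s. S i s *v \<phi> i s)" using pu unfolding u_eq .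
      show "transpose (S i s) = S i s" if "s \<in> I i" for s using S_sym[OF i that] by simp
    qed simp
    have if': "set_integrable lborel (I i) (\<lambda>s. \<phi> i s \<bullet> f i s)"
      by (intro set_integrable_continuous compact_Icc continuous_on_inner E_cont[OF \<phi> i] f[OF i])
    note iq = set_integral_bounded_linear[OF bounded_linear_inner_right[of ?x] dQ_term_integrable[OF \<phi> i]]
    have iF': "set_integrable lborel (I i) (\<lambda>s. \<phi> i s \<bullet> (LBINT \<theta>:I j. dR i j (s, \<theta>) *v \<phi> j \<theta>))"
      and sF': "(LBINT s:I i. \<phi> i s \<bullet> (LBINT \<theta>:I j. dR i j (s, \<theta>) *v \<phi> j \<theta>)) = J i j \<phi>"
      if j: "j \<in> {1..K}" for j
      using set_integral_inner_Fubini(2,3)[OF dR_term_integrable[OF \<phi> i j] compact_Icc compact_Icc E_cont[OF \<phi> i]]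
      unfolding J_def snd_conv by blast+
    have iF: "set_integrable lborel (I i) (\<lambda>s. \<Sum>j=1..K. \<phi> i s \<bullet> (LBINT \<theta>:I j. dR i j (s, \<theta>) *v \<phi> j \<theta>))"
      "(LBINT s:I i. \<Sum>j=1..K. \<phi> i s \<bullet> (LBINT \<theta>:I j. dR i j (s, \<theta>) *v \<phi> j \<theta>)) = (\<Sum>j=1..K. LBINT s:I i. \<phi> i s \<bullet> (LBINT \<theta>:I j. dR i j (s, \<theta>) *v \<phi> j \<theta>))"
      by (rule set_integral_sum, rule iF', assumption)+
    have "\<phi> i s \<bullet> u' s = (1 / ?t) * (\<phi> i s \<bullet> f i s - ?t * (?x \<bullet> (dQ i s *v \<phi> i s))
        - (\<Sum>j=1..K. \<phi> i s \<bullet> (LBINT \<theta>:I j. dR i j (s, \<theta>) *v \<phi> j \<theta>)))" for s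
      unfolding u'_def q_def F_def inner_scaleR_right inner_diff_right inner_sum_right
        inner_matrix_vector_transpose[of ?x "dQ i s"] inner_commute[of "\<phi> i s" "transpose (dQ i s) *v ?x"] ..
    then have "(LBINT s:I i. \<phi> i s \<bullet> u' s) = (1 / ?t) * ((LBINT s:I i. \<phi> i s \<bullet> f i s)
        - ?t * (?x \<bullet> (LBINT s:I i. dQ i s *v \<phi> i s))
        - (\<Sum>j=1..K. J i j \<phi>))"
      by (simp only: set_integral_mult_right set_integral_diff(2)[OF set_integral_diff(1)[OF if' set_integrable_mult_right[OF iq(1)]] iF(1)]
          set_integral_diff(2)[OF if' set_integrable_mult_right[OF iq(1)]] iq(2) iF(2) sF' cong: sum.cong)
    with quad \<tau>K_pos show ?thesis unfolding E_zero[OF \<phi> i] by (simp add: field_simps)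
  qed
  define q where "q i = (LBINT \<theta>:I i. Q i \<theta> *v \<phi> i \<theta>)" for i
  define dq where "dq i = (LBINT \<theta>:I i. dQ i \<theta> *v \<phi> i \<theta>)" for i
  define rr where "rr i j = (LBINT \<theta>:I j. R i j (-\<tau> i, \<theta>) *v \<phi> j \<theta>)" for i j
  have head: "?x \<bullet> (A 0 *v T \<phi> 1 0) = ?x \<bullet> ((A 0 ** P) *v ?x) + (\<Sum>i=1..K. ?x \<bullet> (A 0 *v q i))"
    unfolding T_zero[OF \<phi> one_mem] q_def[symmetric]
    by (simp only: matrix_vector_right_distrib inner_add_right matrix_vector_mul_assoc
        linear_sum[OF matrix_vector_mul_linear] inner_sum_right)
  have delays: "?x \<bullet> (A i *v T \<phi> i (-\<tau> i)) = ?t * (?x \<bullet> ((A i ** transpose (Q i (-\<tau> i))) *v ?x))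
      + ?x \<bullet> (C_mat K \<tau> A S i *v \<phi> i (-\<tau> i)) + (\<Sum>j=1..K. ?x \<bullet> (A i *v rr i j))" for i
    unfolding T_def rr_def[symmetric] C_mat_def
    by (simp only: matrix_vector_right_distrib inner_add_right matrix_vector_mul_assoc matrix_vector_mult_scaleR
        scaleR_matrix_vector_assoc[symmetric] inner_scaleR_right linear_sum[OF matrix_vector_mul_linear] inner_sum_right)
  have C0: "?x \<bullet> (C0_mat K \<tau> A P Q S *v ?x) = 2 * (?x \<bullet> ((A 0 ** P) *v ?x))
      + (\<Sum>i=1..K. 2 * ?t * (?x \<bullet> ((A i ** transpose (Q i (-\<tau> i))) *v ?x)) + ?x \<bullet> (S i 0 *v ?x))"
  proof -
    have a: "?x \<bullet> ((P ** transpose (A 0)) *v ?x) = ?x \<bullet> ((A 0 ** P) *v ?x)"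
      using quadratic_form_transpose[of ?x "A 0 ** P"] by (simp only: matrix_transpose_mul P_sym)
    have b: "?x \<bullet> ((Q i (-\<tau> i) ** transpose (A i)) *v ?x) = ?x \<bullet> ((A i ** transpose (Q i (-\<tau> i))) *v ?x)" for i
      using quadratic_form_transpose[of ?x "A i ** transpose (Q i (-\<tau> i))"]
      by (simp only: matrix_transpose_mul transpose_transpose)
    show ?thesis
      unfolding C0_mat_def matrix_vector_mult_add_rdistrib inner_add_right
        sum_matrix_vector_mult inner_sum_right scaleR_matrix_vector_assoc[symmetric] inner_scaleR_right a b
      by (simp add: algebra_simps)
  qed
  have Bt: "?x \<bullet> (LBINT \<theta>:I i. Bf i \<theta> *v \<phi> i \<theta>) = ?x \<bullet> (A 0 *v q i) + ?x \<bullet> dq i + (\<Sum>j=1..K. ?x \<bullet> (A j *v rr j i))"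
    if i: "i \<in> {1..K}" for i
    unfolding Bf_term(2)[OF \<phi> i] q_def dq_def rr_def by (simp only: inner_add_right inner_sum_right)
  \<comment> \<open>\<open>B_fun\<close> for the history \<open>i\<close> sums over the delays
    \<open>j\<close>, whereas \<open>T \<phi>\<close> at the delay \<open>i\<close> sums over the
    histories \<open>j\<close>; interchanging the sums matches the two.\<close>
  have Bs: "(\<Sum>i=1..K. ?x \<bullet> (LBINT \<theta>:I i. Bf i \<theta> *v \<phi> i \<theta>))
      = (\<Sum>i=1..K. ?x \<bullet> (A 0 *v q i)) + (\<Sum>i=1..K. ?x \<bullet> dq i) + (\<Sum>i=1..K. \<Sum>j=1..K. ?x \<bullet> (A i *v rr i j))"
    using sum.swap[of "\<lambda>i j. ?x \<bullet> (A j *v rr j i)" "{1..K}" "{1..K}"]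
    by (simp only: Bt sum.distrib cong: sum.cong)
  have parts: "2 * (\<Sum>i=1..K. LBINT s:I i. \<phi> i s \<bullet> f i s)
    = ?t * (\<Sum>i=1..K. ?x \<bullet> (S i 0 *v ?x)) - ?t * (\<Sum>i=1..K. \<phi> i (-\<tau> i) \<bullet> (S i (-\<tau> i) *v \<phi> i (-\<tau> i)))
        + ?t * (\<Sum>i=1..K. LBINT s:I i. \<phi> i s \<bullet> (dS i s *v \<phi> i s))
        + 2 * ?t * (\<Sum>i=1..K. ?x \<bullet> dq i) + 2 * (\<Sum>i=1..K. \<Sum>j=1..K. J i j \<phi>)"
    unfolding sum_distrib_left[of "2 :: real" "\<lambda>i. LBINT s:I i. \<phi> i s \<bullet> f i s"]
    by (simp only: part dq_def[symmetric] sum.distrib sum_subtractf sum_distrib_left cong: sum.cong)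
  have hd: "?x \<bullet> (A 0 *v T \<phi> 1 0 + (\<Sum>i=1..K. A i *v T \<phi> i (-\<tau> i)))
      = ?x \<bullet> ((A 0 ** P) *v ?x) + (\<Sum>i=1..K. ?x \<bullet> (A 0 *v q i))
      + ?t * (\<Sum>i=1..K. ?x \<bullet> ((A i ** transpose (Q i (-\<tau> i))) *v ?x))
      + (\<Sum>i=1..K. ?x \<bullet> (C_mat K \<tau> A S i *v \<phi> i (-\<tau> i))) + (\<Sum>i=1..K. \<Sum>j=1..K. ?x \<bullet> (A i *v rr i j))"
    unfolding inner_add_right inner_sum_right head delays by (simp only: sum.distrib sum_distrib_left add.assoc)
  have C0': "?x \<bullet> (C0_mat K \<tau> A P Q S *v ?x) = 2 * (?x \<bullet> ((A 0 ** P) *v ?x))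
      + 2 * ?t * (\<Sum>i=1..K. (?x \<bullet> ((A i ** transpose (Q i (-\<tau> i))) *v ?x))) + (\<Sum>i=1..K. ?x \<bullet> (S i 0 *v ?x))"
    unfolding C0 by (simp only: sum.distrib sum_distrib_left add.assoc)
  show ?thesis
    unfolding distrib_left[of "2 :: real"] parts D_form_def hd C0' Bs by (simp only: algebra_simps)
qed

lemma norm_inner_matrix_vector_le:
  assumes "\<And>v. norm (M *v v) \<le> norm M * norm v * C" "0 \<le> C" "norm a \<le> B" "norm b \<le> B"
  shows "norm (a \<bullet> ((M :: real ^ 'n ^ 'n) *v b)) \<le> (B * B * C) * norm M"
proof -
  have B: "0 \<le> B" using assms(3) norm_ge_zero order_trans by blast
  have "norm (a \<bullet> (M *v b)) \<le> norm a * norm (M *v b)" by (simp add: Cauchy_Schwarz_ineq2)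
  also have "\<dots> \<le> B * (norm M * B * C)"
    using assms B by (intro mult_mono order_trans[OF assms(1)] mult_right_mono mult_left_mono) auto
  finally show ?thesis by (simp add: mult_ac)
qed

section \<open>Dissipation on continuous histories\<close>

text \<open>The point evaluations at 0 and \<open>-\<tau> i\<close> converge by assumption; in the
  other terms bounded histories meet the integrable coefficients \<open>Bf\<close>,
  \<open>dS\<close> and \<open>dR\<close>.\<close>

lemma D_form_tendsto:
  assumes \<psi>: "bconv \<psi> \<phi>"
  shows "(\<lambda>n. D_form (\<psi> n)) \<longlonglongrightarrow> D_form \<phi>"
proof -
  note E1 = bconvD(1)[OF \<psi>] and E2 = bconvD(2)[OF \<psi>]
  obtain B where B: "0 \<le> B" "\<forall>n. \<forall>i\<in>{1..K}. \<forall>s\<in>(I i). norm (\<psi> n i s) \<le> B"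
    using bconv_bound[OF \<psi>] by blast
  obtain C where C: "\<And>M v. norm ((M :: real ^ 'n ^ 'n) *v v) \<le> norm M * norm v * C" "0 \<le> C"
    using bounded_bilinear.nonneg_bounded[OF bounded_bilinear_matrix_vector_mult] by metis
  have x: "(\<lambda>n. \<psi> n 1 0) \<longlonglongrightarrow> \<phi> 1 0" using bconvD(3)[OF \<psi> one_mem zero_mem[OF one_mem]] .
  have y: "(\<lambda>n. \<psi> n i (-\<tau> i)) \<longlonglongrightarrow> \<phi> i (-\<tau> i)" if "i \<in> {1..K}" for i
    using bconvD(3)[OF \<psi> that left_mem[OF that]] .
  have m: "(\<lambda>n. M *v u n) \<longlonglongrightarrow> M *v v" if "u \<longlonglongrightarrow> v" for M :: "real ^ 'n ^ 'n" and u v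
    by (rule bounded_linear.tendsto[OF matrix_vector_mul_bounded_linear that])
  have b: "(\<lambda>n. LBINT \<theta>:I i. Bf i \<theta> *v \<psi> n i \<theta>) \<longlonglongrightarrow> (LBINT \<theta>:I i. Bf i \<theta> *v \<phi> i \<theta>)"
    if i: "i \<in> {1..K}" for i
  proof (rule bconv_integral_tendsto[OF bounded_bilinear_matrix_vector_mult _ \<psi> i])
    have "continuous_on (I i) (\<lambda>\<theta>. (A 0 ** Q i \<theta>) + (\<Sum>j=1..K. A j ** R j i (-\<tau> j, \<theta>)))"
    proof (intro continuous_on_add continuous_on_sum)
      have mm: "bounded_linear (\<lambda>M :: real ^ 'n ^ 'n. L ** M)" for L :: "real ^ 'n ^ 'n"
        by (intro linear_conv_bounded_linear[THEN iffD1] linearI)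
          (simp_all add: vec_eq_iff matrix_matrix_mult_def sum_distrib_left sum.distrib algebra_simps)
      show "continuous_on (I i) (\<lambda>\<theta>. A 0 ** Q i \<theta>)"
        by (rule bounded_linear.continuous_on[OF mm Q_cont[OF i]])
      show "continuous_on (I i) (\<lambda>\<theta>. A j ** R j i (-\<tau> j, \<theta>))" if j: "j \<in> {1..K}" for j
        by (rule bounded_linear.continuous_on[OF mm R_section[OF j i left_mem[OF j]]])
    qed
    then have "set_integrable lborel (I i) (\<lambda>\<theta>. ((A 0 ** Q i \<theta>) + (\<Sum>j=1..K. A j ** R j i (-\<tau> j, \<theta>))) + dQ i \<theta>)"
      by (intro set_integral_add(1) set_integrable_continuous compact_Icc dQ_integrable[OF i])
    moreover have "((A 0 ** Q i \<theta>) + (\<Sum>j=1..K. A j ** R j i (-\<tau> j, \<theta>))) + dQ i \<theta> = Bf i \<theta>" for \<theta>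
      by (simp add: B_fun_def dQ_def)
    ultimately show "set_integrable lborel (I i) (Bf i)" by simp
  qed
  have s: "(\<lambda>n. LBINT s:I i. \<psi> n i s \<bullet> (dS i s *v \<psi> n i s))
      \<longlonglongrightarrow> (LBINT s:I i. \<phi> i s \<bullet> (dS i s *v \<phi> i s))" if i: "i \<in> {1..K}" for i
  proof (rule set_integral_dominated_convergence[OF dS_term_integrable[OF E1 i] dS_term_integrable[OF E2 i]
        set_integrable_mult_right[OF set_integrable_norm[OF dS_integrable[OF i]], of "B * B * C"]])
    show "AE s in lborel. s \<in> I i \<longrightarrow> (\<lambda>n. \<psi> n i s \<bullet> (dS i s *v \<psi> n i s)) \<longlonglongrightarrow> \<phi> i s \<bullet> (dS i s *v \<phi> i s)"
    proof (rule AE_I2, rule impI)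
      fix s assume "s \<in> I i"
      note l = bconvD(3)[OF \<psi> i this]
      show "(\<lambda>n. \<psi> n i s \<bullet> (dS i s *v \<psi> n i s)) \<longlonglongrightarrow> \<phi> i s \<bullet> (dS i s *v \<phi> i s)"
        by (rule tendsto_inner[OF l m[OF l]])
    qed
    show "norm (\<psi> n i s \<bullet> (dS i s *v \<psi> n i s)) \<le> B * B * C * norm (dS i s)" if "s \<in> I i" for n s
      by (rule norm_inner_matrix_vector_le[OF C]) (use B(2) i that in blast)+
  qed
  have j: "(\<lambda>n. J i j (\<psi> n)) \<longlonglongrightarrow> J i j \<phi>" if i: "i \<in> {1..K}" and j: "j \<in> {1..K}" for i j
    unfolding J_def
  proof (rule set_integral_dominated_convergence)
    show "set_integrable lborel (I i \<times> I j) (\<lambda>z. \<psi> n i (fst z) \<bullet> (dR i j z *v \<psi> n j (snd z)))" for n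
      by (rule set_integral_inner_Fubini(1)[OF dR_term_integrable[OF E1 i j] compact_Icc compact_Icc E_cont[OF E1 i]])
    show "set_integrable lborel (I i \<times> I j) (\<lambda>z. \<phi> i (fst z) \<bullet> (dR i j z *v \<phi> j (snd z)))"
      by (rule set_integral_inner_Fubini(1)[OF dR_term_integrable[OF E2 i j] compact_Icc compact_Icc E_cont[OF E2 i]])
    show "set_integrable lborel (I i \<times> I j) (\<lambda>z. B * B * C * norm (dR i j z))"
      by (intro set_integrable_mult_right set_integrable_norm dR_integrable i j)
    show "AE z in lborel. z \<in> I i \<times> I j \<longrightarrow>
        (\<lambda>n. \<psi> n i (fst z) \<bullet> (dR i j z *v \<psi> n j (snd z))) \<longlonglongrightarrow> \<phi> i (fst z) \<bullet> (dR i j z *v \<phi> j (snd z))"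
    proof (rule AE_I2, rule impI)
      fix z :: "real \<times> real" assume "z \<in> I i \<times> I j"
      then have "fst z \<in> I i" "snd z \<in> I j" by auto
      then show "(\<lambda>n. \<psi> n i (fst z) \<bullet> (dR i j z *v \<psi> n j (snd z))) \<longlonglongrightarrow> \<phi> i (fst z) \<bullet> (dR i j z *v \<phi> j (snd z))"
        by (intro tendsto_inner m bconvD(3)[OF \<psi> i] bconvD(3)[OF \<psi> j])
    qed
    show "norm (\<psi> n i (fst z) \<bullet> (dR i j z *v \<psi> n j (snd z))) \<le> B * B * C * norm (dR i j z)"
      if "z \<in> I i \<times> I j" for n z
    proof (rule norm_inner_matrix_vector_le[OF C])
      have "fst z \<in> I i" "snd z \<in> I j" using that by auto
      then show "norm (\<psi> n i (fst z)) \<le> B" "norm (\<psi> n j (snd z)) \<le> B" using B(2) i j by blast+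
    qed
  qed
  show ?thesis
    unfolding D_form_def
    by (intro tendsto_add tendsto_diff tendsto_mult tendsto_const tendsto_sum tendsto_inner m x y b s j)
qed

lemma dissipative_E:
  assumes \<phi>: "\<phi> \<in> E"
  shows "D_form \<phi> \<le> - ip \<phi> \<phi>"
proof -
  obtain \<psi> where \<psi>: "bconv \<psi> \<phi>" "\<And>n. (\<psi> n 1 0, \<psi> n) \<in> X_space K \<tau>"
    using X_dense[OF \<phi>] by blast
  have "D_form (\<psi> n) \<le> - ip (\<psi> n) (\<psi> n)" for n
    using dissipative[OF \<psi>(2)[of n]] unfolding D_op_eq_D_form[OF bconvD(1)[OF \<psi>(1)]] Z_norm_eq .
  then show ?thesis
    by (intro LIMSEQ_le[OF D_form_tendsto[OF \<psi>(1)] tendsto_minus[OF ip_tendsto[OF \<psi>(1) \<psi>(1)]]]) blast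
qed

section \<open>Estimates for the Lyapunov function\<close>

text \<open>Histories are total functions of which only the values on \<open>I i\<close> count; the
  image of the constructed preimage is known to agree with the true history only there.\<close>

lemma ip_cong:
  assumes "\<And>i s. i \<in> {1..K} \<Longrightarrow> s \<in> I i \<Longrightarrow> \<phi> i s = \<phi>' i s"
    "\<And>i s. i \<in> {1..K} \<Longrightarrow> s \<in> I i \<Longrightarrow> \<psi> i s = \<psi>' i s"
  shows "ip \<phi> \<psi> = ip \<phi>' \<psi>'"
proof -
  have "(\<Sum>i=1..K. LBINT s:I i. \<phi> i s \<bullet> \<psi> i s) = (\<Sum>i=1..K. LBINT s:I i. \<phi>' i s \<bullet> \<psi>' i s)"
  proof (intro sum.cong refl set_lebesgue_integral_cong allI impI)
    show "\<phi> i s \<bullet> \<psi> i s = \<phi>' i s \<bullet> \<psi>' i s" if "i \<in> {1..K}" "s \<in> I i" for i s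
      by (simp only: assms(1)[OF that] assms(2)[OF that])
  qed simp
  then show ?thesis
    unfolding ip_def assms(1)[OF one_mem zero_mem[OF one_mem]] assms(2)[OF one_mem zero_mem[OF one_mem]] by simp
qed

text \<open>Young's inequality, from expanding the square of
  \<open>c *\<^sub>R \<phi> i s - \<psi> i s\<close>.\<close>

lemma ip_le_mean:
  assumes "\<phi> \<in> E" "\<psi> \<in> E" "0 < c"
  shows "ip \<phi> \<psi> \<le> c / 2 * ip \<phi> \<phi> + ip \<psi> \<psi> / (2 * c)"
proof -
  let ?a = "\<lambda>i s. c *\<^sub>R \<phi> i s"
  have a: "?a \<in> E" by (rule E_scale[OF assms(1)])
  have "0 \<le> ip (\<lambda>i s. ?a i s - \<psi> i s) (\<lambda>i s. ?a i s - \<psi> i s)" by (rule ip_nonneg)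
  also have "\<dots> = c * (c * ip \<phi> \<phi>) - 2 * (c * ip \<phi> \<psi>) + ip \<psi> \<psi>"
    unfolding ip_diff_left[OF a assms(2) E_diff[OF a assms(2)]] ip_diff_right[OF a assms(2) a]
      ip_diff_right[OF a assms(2) assms(2)] ip_scale_left ip_scale_right ip_commute[of \<psi> \<phi>] by simp
  finally show ?thesis using assms(3) by (simp add: field_simps)
qed

text \<open>Young's inequality with weight \<open>\<epsilon>\<close> leaves half of
  \<open>\<epsilon> * ip \<phi> \<phi>\<close>, which coercivity absorbs. The Lyapunov function is
  thereby bounded by the history \<open>T \<phi>\<close> itself.\<close>

lemma ip_T_le:
  assumes "\<phi> \<in> E"
  shows "ip \<phi> (T \<phi>) \<le> ip (T \<phi>) (T \<phi>) / \<epsilon>" "0 \<le> ip \<phi> (T \<phi>)"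
proof -
  have a: "\<epsilon> * ip \<phi> \<phi> \<le> ip \<phi> (T \<phi>)" by (rule coercive_E[OF assms])
  have "ip \<phi> (T \<phi>) \<le> \<epsilon> / 2 * ip \<phi> \<phi> + ip (T \<phi>) (T \<phi>) / (2 * \<epsilon>)"
    by (rule ip_le_mean[OF assms T_in_E[OF assms] \<epsilon>])
  with a show "ip \<phi> (T \<phi>) \<le> ip (T \<phi>) (T \<phi>) / \<epsilon>" by simp
  have "0 \<le> \<epsilon> * ip \<phi> \<phi>" using \<epsilon> ip_nonneg by simp
  with a show "0 \<le> ip \<phi> (T \<phi>)" by linarith
qed

lemma ip_sup_le:
  assumes \<phi>: "\<phi> \<in> E" and b: "\<And>i s. i \<in> {1..K} \<Longrightarrow> s \<in> I i \<Longrightarrow> norm (\<phi> i s) \<le> b"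
  shows "ip \<phi> \<phi> \<le> (\<tau> K + (\<Sum>i=1..K. \<tau> i)) * b\<^sup>2"
proof -
  have sq: "\<phi> i s \<bullet> \<phi> i s \<le> b\<^sup>2" if "i \<in> {1..K}" "s \<in> I i" for i s
    unfolding dot_square_norm by (rule power_mono[OF b[OF that] norm_ge_zero])
  have "(LBINT s:I i. \<phi> i s \<bullet> \<phi> i s) \<le> \<tau> i * b\<^sup>2" if i: "i \<in> {1..K}" for i
  proof -
    have c: "set_integrable lborel (I i) (\<lambda>s. b\<^sup>2)" by (intro set_integrable_continuous) auto
    have "(LBINT s:I i. \<phi> i s \<bullet> \<phi> i s) \<le> (LBINT s:I i. b\<^sup>2)"
      by (rule set_integral_mono[OF inner_integrable[OF \<phi> \<phi> i] c sq[OF i]])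
    also have "\<dots> = \<tau> i * b\<^sup>2" using \<tau>_pos[OF i] by (simp add: set_lebesgue_integral_def)
    finally show ?thesis .
  qed
  then have "ip \<phi> \<phi> \<le> \<tau> K * b\<^sup>2 + (\<Sum>i=1..K. \<tau> i * b\<^sup>2)"
    unfolding ip_def by (intro add_mono sum_mono mult_left_mono sq one_mem zero_mem less_imp_le[OF \<tau>K_pos])
  then show ?thesis by (simp only: distrib_right sum_distrib_right)
qed

section \<open>The dynamics\<close>

definition rhs :: "(real \<Rightarrow> real ^ 'n) \<Rightarrow> real \<Rightarrow> real ^ 'n" where
  "rhs x t = A 0 *v x t + (\<Sum>i=1..K. A i *v x (t - \<tau> i))"

lemma solution_continuous:
  assumes "continuous_on {-\<tau> K..0} \<phi>\<^sub>0" and x: "delay_solution K \<tau> A \<phi>\<^sub>0 x"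
  shows "continuous_on {-\<tau> K..} x"
proof -
  have "continuous_on {-\<tau> K..0} x"
    using assms(1) by (rule continuous_on_eq) (use x in \<open>auto simp: delay_solution_def\<close>)
  moreover have "continuous_on {0..} x"
    unfolding continuous_on_eq_continuous_within
    using x has_vector_derivative_continuous unfolding delay_solution_def by fastforce
  moreover have "{-\<tau> K..} = {-\<tau> K..0} \<union> {0..}" using \<tau>K_pos by auto
  ultimately show ?thesis by (metis continuous_on_closed_Un closed_atLeastAtMost closed_atLeast)
qed

lemma solution_derivative:
  assumes x: "delay_solution K \<tau> A \<phi>\<^sub>0 x" and "0 < t"
  shows "(x has_vector_derivative rhs x t) (at t)"
proof -
  have "(x has_vector_derivative rhs x t) (at t within {0..})"
    using assms by (simp add: delay_solution_def rhs_def)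
  moreover have "at t within {0..} = at t" by (rule at_within_interior) (use \<open>0 < t\<close> in simp)
  ultimately show ?thesis by simp
qed

lemma rhs_continuous:
  assumes x: "continuous_on {-\<tau> K..} x"
  shows "continuous_on {0..} (rhs x)"
  unfolding rhs_def
proof (intro continuous_on_add continuous_on_sum)
  have m: "continuous_on {0..} (\<lambda>t. M *v x (t - c))" if "0 \<le> c" "c \<le> \<tau> K" for M :: "real ^ 'n ^ 'n" and c
    by (intro continuous_on_matrix_vector_mult continuous_on_const continuous_on_compose2[OF x] continuous_intros)
      (use that in auto)
  show "continuous_on {0..} (\<lambda>t. A 0 *v x t)" using m[of 0 "A 0"] \<tau>K_pos by simp
  show "continuous_on {0..} (\<lambda>t. A i *v x (t - \<tau> i))" if "i \<in> {1..K}" for i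
    using m[OF less_imp_le[OF \<tau>_pos[OF that]] \<tau>_le[OF that]] .
qed

text \<open>In the supremum of \<open>exp (- l * t) * norm (x t)\<close> the delayed terms are dominated by the current
  one, which replaces Gronwall's lemma.\<close>

lemma short_time_bound:
  assumes "0 \<le> T0"
  shows "\<exists>m>0. \<forall>\<phi>\<^sub>0 x. continuous_on {-\<tau> K..0} \<phi>\<^sub>0 \<longrightarrow> delay_solution K \<tau> A \<phi>\<^sub>0 x \<longrightarrow>
    (\<forall>t\<in>{-\<tau> K..T0}. norm (x t) \<le> m * (SUP s\<in>{-\<tau> K..0}. norm (\<phi>\<^sub>0 s)))"
proof -
  define a where "a = onorm ((*v) (A 0)) + (\<Sum>i=1..K. onorm ((*v) (A i)))"
  have on: "norm (A i *v v) \<le> onorm ((*v) (A i)) * norm v" for i v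
    by (rule onorm[OF matrix_vector_mul_bounded_linear])
  have on0: "0 \<le> onorm ((*v) (A i))" for i by (rule onorm_pos_le[OF matrix_vector_mul_bounded_linear])
  have a: "0 \<le> a" unfolding a_def by (intro add_nonneg_nonneg sum_nonneg on0)
  \<comment> \<open>With \<open>2 * a \<le> l\<close> the integrated right-hand side costs at most
    half of the weighted maximum; the summand 1 keeps \<open>l\<close> positive when
    \<open>a = 0\<close>.\<close>
  define l where "l = 2 * a + 1"
  have l: "0 < l" "2 * a \<le> l" using a by (auto simp: l_def)
  define m where "m = exp (l * T0) * (2 * exp (l * \<tau> K))"
  have m: "0 < m" by (simp add: m_def)
  have "norm (x t) \<le> m * (SUP s\<in>{-\<tau> K..0}. norm (\<phi>\<^sub>0 s))"
    if c0: "continuous_on {-\<tau> K..0} \<phi>\<^sub>0" and x: "delay_solution K \<tau> A \<phi>\<^sub>0 x" and t: "t \<in> {-\<tau> K..T0}" for \<phi>\<^sub>0 x t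
  proof -
    define \<Phi> where "\<Phi> = (SUP s\<in>{-\<tau> K..0}. norm (\<phi>\<^sub>0 s))"
    have cx: "continuous_on {-\<tau> K..} x" by (rule solution_continuous[OF c0 x])
    have "bounded ((\<lambda>s. norm (\<phi>\<^sub>0 s)) ` {-\<tau> K..0})"
      by (intro compact_imp_bounded compact_continuous_image continuous_on_norm c0 compact_Icc)
    then have bdd: "bdd_above ((\<lambda>s. norm (\<phi>\<^sub>0 s)) ` {-\<tau> K..0})" by (rule bounded_imp_bdd_above)
    have init: "norm (x s) \<le> \<Phi>" if "s \<in> {-\<tau> K..0}" for s
    proof -
      have "x s = \<phi>\<^sub>0 s" using x that unfolding delay_solution_def by (elim conjE bspec)
      then show ?thesis unfolding \<Phi>_def using cSUP_upper[OF that bdd] by simp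
    qed
    have x0: "norm (x 0) \<le> \<Phi>" using \<tau>K_pos by (intro init) simp
    then have \<Phi>0: "0 \<le> \<Phi>" using norm_ge_zero order_trans by blast
    \<comment> \<open>The weighted norm attains its maximum \<open>\<mu>\<close> at some
      \<open>p\<close>. It remains to bound \<open>\<mu>\<close> by the initial data, which is
      immediate if \<open>p \<le> 0\<close>.\<close>
    have "\<exists>p\<in>{-\<tau> K..T0}. \<forall>t\<in>{-\<tau> K..T0}. exp (- l * t) * norm (x t) \<le> exp (- l * p) * norm (x p)"
    proof (rule continuous_attains_sup[OF compact_Icc])
      show "{-\<tau> K..T0} \<noteq> {}" using assms \<tau>K_pos by simp
      have "continuous_on {-\<tau> K..T0} x" by (rule continuous_on_subset[OF cx]) auto
      then show "continuous_on {-\<tau> K..T0} (\<lambda>t. exp (- l * t) * norm (x t))" by (intro continuous_intros)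
    qed
    then obtain p where p: "p \<in> {-\<tau> K..T0}"
      "\<And>t. t \<in> {-\<tau> K..T0} \<Longrightarrow> exp (- l * t) * norm (x t) \<le> exp (- l * p) * norm (x p)" by blast
    define \<mu> where "\<mu> = exp (- l * p) * norm (x p)"
    have \<mu>0: "0 \<le> \<mu>" by (simp add: \<mu>_def)
    have xle: "norm (x t) \<le> \<mu> * exp (l * t)" if "t \<in> {-\<tau> K..T0}" for t
    proof -
      have "norm (x t) = (exp (- l * t) * norm (x t)) * exp (l * t)"
        by (simp add: exp_minus)
      also have "\<dots> \<le> \<mu> * exp (l * t)" unfolding \<mu>_def by (rule mult_right_mono[OF p(2)[OF that]]) simp
      finally show ?thesis .
    qed
    have "\<mu> \<le> 2 * exp (l * \<tau> K) * \<Phi>"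
    proof (cases "p \<le> 0")
      case True
      have "\<mu> \<le> exp (l * \<tau> K) * \<Phi>"
        unfolding \<mu>_def using p(1) True l(1) mult_left_mono[of "-p" "\<tau> K" l] by (intro mult_mono init) auto
      also have "\<dots> \<le> 2 * exp (l * \<tau> K) * \<Phi>" using \<Phi>0 by simp
      finally show ?thesis .
    next
      case False
      then have p0: "0 < p" by simp
      \<comment> \<open>The right-hand side at time \<open>r\<close> is at most
        \<open>a * \<mu> * exp (l * r)\<close>, since delayed values carry a smaller exponential.
        Integrating up to \<open>p\<close> gives \<open>\<mu>\<close> at most the initial supremum
        plus \<open>\<mu> / 2\<close>.\<close>
      have "norm (x p - x 0) \<le> a * \<mu> / l * exp (l * p) - a * \<mu> / l * exp (l * 0)"
      proof (rule differentiable_bound_general[OF p0])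
        show "continuous_on {0..p} x" by (rule continuous_on_subset[OF cx]) (use \<tau>K_pos in auto)
        show "continuous_on {0..p} (\<lambda>t. a * \<mu> / l * exp (l * t))" by (intro continuous_intros)
        show "(x has_vector_derivative rhs x r) (at r)" if "0 < r" for r by (rule solution_derivative[OF x that])
        show "((\<lambda>t. a * \<mu> / l * exp (l * t)) has_vector_derivative a * \<mu> * exp (l * r)) (at r)" for r
          unfolding has_real_derivative_iff_has_vector_derivative[symmetric]
          using l(1) by (auto intro!: derivative_eq_intros)
        show "norm (rhs x r) \<le> a * \<mu> * exp (l * r)" if r: "0 < r" "r < p" for r
        proof -
          have d: "norm (A i *v x (r - c)) \<le> onorm ((*v) (A i)) * (\<mu> * exp (l * r))" if "0 \<le> c" "c \<le> \<tau> K" for i c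
          proof -
            have "norm (x (r - c)) \<le> \<mu> * exp (l * (r - c))" using r p(1) that by (intro xle) auto
            also have "\<dots> \<le> \<mu> * exp (l * r)"
              using \<mu>0 l(1) that by (intro mult_left_mono) auto
            finally have "onorm ((*v) (A i)) * norm (x (r - c)) \<le> onorm ((*v) (A i)) * (\<mu> * exp (l * r))"
              by (rule mult_left_mono[OF _ on0])
            then show ?thesis using on[of i "x (r - c)"] by linarith
          qed
          have "norm (rhs x r) \<le> norm (A 0 *v x r) + (\<Sum>i=1..K. norm (A i *v x (r - \<tau> i)))"
            unfolding rhs_def by (rule order_trans[OF norm_triangle_ineq add_left_mono[OF norm_sum]])
          also have "\<dots> \<le> onorm ((*v) (A 0)) * (\<mu> * exp (l * r)) + (\<Sum>i=1..K. onorm ((*v) (A i)) * (\<mu> * exp (l * r)))"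
          proof (intro add_mono sum_mono)
            show "norm (A 0 *v x r) \<le> onorm ((*v) (A 0)) * (\<mu> * exp (l * r))" using d[of 0 0] \<tau>K_pos by simp
            show "norm (A i *v x (r - \<tau> i)) \<le> onorm ((*v) (A i)) * (\<mu> * exp (l * r))" if "i \<in> {1..K}" for i
              by (rule d[OF less_imp_le[OF \<tau>_pos[OF that]] \<tau>_le[OF that]])
          qed
          also have "\<dots> = a * \<mu> * exp (l * r)" unfolding a_def by (simp add: distrib_right sum_distrib_right mult.assoc)
          finally show ?thesis .
        qed
      qed
      moreover have "0 \<le> a * \<mu> / l" using a \<mu>0 l(1) by simp
      ultimately have "norm (x p) \<le> \<Phi> + a * \<mu> / l * exp (l * p)"
        using norm_triangle_sub[of "x p" "x 0"] x0 by simp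
      then have "\<mu> \<le> exp (- l * p) * (\<Phi> + a * \<mu> / l * exp (l * p))"
        unfolding \<mu>_def by (intro mult_left_mono) auto
      also have "\<dots> = exp (- l * p) * \<Phi> + a * \<mu> / l"
        by (simp add: distrib_left exp_minus)
      also have "\<dots> \<le> 1 * \<Phi> + \<mu> / 2"
      proof (intro add_mono mult_right_mono \<Phi>0)
        show "exp (- l * p) \<le> 1" using l(1) p0 by simp
        have "2 * a * \<mu> \<le> l * \<mu>" by (rule mult_right_mono[OF l(2) \<mu>0])
        then show "a * \<mu> / l \<le> \<mu> / 2" using l(1) by (simp add: field_simps)
      qed
      finally have "\<mu> \<le> 2 * \<Phi>" by simp
      also have "\<dots> \<le> 2 * exp (l * \<tau> K) * \<Phi>"
        using \<Phi>0 l(1) \<tau>K_pos by (intro mult_right_mono) auto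
      finally show ?thesis .
    qed
    then have "\<mu> * exp (l * t) \<le> 2 * exp (l * \<tau> K) * \<Phi> * exp (l * T0)"
      using t l(1) \<Phi>0 by (intro mult_mono) auto
    then show ?thesis using xle[OF t] unfolding m_def \<Phi>_def by (simp add: mult_ac)
  qed
  then show ?thesis using m by blast
qed

section \<open>Differentiating the Lyapunov function along a solution\<close>

lemma history_in_E:
  assumes x: "continuous_on {-\<tau> K..} x" and "0 \<le> t"
  shows "(\<lambda>i s. x (t + s)) \<in> E"
proof (rule E_I)
  fix i assume i: "i \<in> {1..K}"
  show "continuous_on (I i) (\<lambda>s. x (t + s))"
    by (rule continuous_on_compose2[OF x]) (use \<tau>_le[OF i] \<open>0 \<le> t\<close> in \<open>auto intro!: continuous_intros\<close>)
qed simp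

lemma shifted_derivative:
  assumes "(x has_vector_derivative d) (at (r + s :: real))"
  shows "((\<lambda>r. x (r + s)) has_vector_derivative d) (at r)" "((\<lambda>s. x (r + s)) has_vector_derivative d) (at s)"
proof -
  have "((\<lambda>r. r + s) has_vector_derivative 1) (at r)" "((\<lambda>s. r + s) has_vector_derivative 1) (at s)"
    by (auto intro!: derivative_eq_intros)
  from vector_diff_chain_at[OF this(1)] vector_diff_chain_at[OF this(2)] assms
  show "((\<lambda>r. x (r + s)) has_vector_derivative d) (at r)" "((\<lambda>s. x (r + s)) has_vector_derivative d) (at s)"
    by (fastforce simp: o_def)+
qed

text \<open>For \<open>t > \<tau> K\<close> all times \<open>t + s\<close> are positive, where the
  solution has a continuous two-sided derivative, so the Leibniz rule applies; \<open>\<phi>\<close>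
  stays fixed.\<close>

lemma ip_history_derivative:
  assumes \<phi>: "\<phi> \<in> E" and x: "continuous_on {-\<tau> K..} x"
    and d: "\<And>t. 0 < t \<Longrightarrow> (x has_vector_derivative rhs x t) (at t)" and t: "\<tau> K < t"
  shows "((\<lambda>r. ip \<phi> (\<lambda>i s. x (r + s))) has_real_derivative
    \<tau> K * (\<phi> 1 0 \<bullet> rhs x t) + (\<Sum>i=1..K. LBINT s:I i. \<phi> i s \<bullet> rhs x (t + s))) (at t)"
proof -
  have inner: "((\<lambda>r. v \<bullet> x (r + s)) has_real_derivative v \<bullet> rhs x (r + s)) (at r)" if "0 < r + s" for r s v
    unfolding has_real_derivative_iff_has_vector_derivative
    by (rule bounded_linear.has_vector_derivative[OF bounded_linear_inner_right shifted_derivative(1)[OF d[OF that]]])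
  have part: "((\<lambda>r. LBINT s:I i. \<phi> i s \<bullet> x (r + s)) has_real_derivative
      (LBINT s:I i. \<phi> i s \<bullet> rhs x (t + s))) (at t)" if i: "i \<in> {1..K}" for i
  proof -
    have pos: "0 < r + s" if "r \<in> {\<tau> K<..}" "s \<in> I i" for r s
      using that \<tau>_le[OF i] by auto
    have int: "set_integrable lborel (I i) (\<lambda>s. \<phi> i s \<bullet> x (r + s))" if "r \<in> {\<tau> K<..}" for r
      using inner_integrable[OF \<phi> history_in_E[OF x] i, of r] that \<tau>K_pos by auto
    have crhs: "continuous_on {0..} (rhs x)" by (rule rhs_continuous[OF x])
    have int': "set_integrable lborel (I i) (\<lambda>s. \<phi> i s \<bullet> rhs x (t + s))"
      by (intro set_integrable_continuous compact_Icc continuous_on_inner E_cont[OF \<phi> i]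
          continuous_on_compose2[OF crhs]) (use t \<tau>_le[OF i] in \<open>auto intro!: continuous_intros\<close>)
    have "((\<lambda>r. integral (cbox (-\<tau> i) 0) (\<lambda>s. \<phi> i s \<bullet> x (r + s))) has_field_derivative
        integral (cbox (-\<tau> i) 0) (\<lambda>s. \<phi> i s \<bullet> rhs x (t + s))) (at t within {\<tau> K<..})"
    proof (rule leibniz_rule_field_derivative)
      show "((\<lambda>r. \<phi> i s \<bullet> x (r + s)) has_real_derivative \<phi> i s \<bullet> rhs x (r + s)) (at r within {\<tau> K<..})"
        if "r \<in> {\<tau> K<..}" "s \<in> cbox (-\<tau> i) 0" for r s
        by (rule has_field_derivative_at_within[OF inner[OF pos]]) (use that in auto)
      show "(\<lambda>s. \<phi> i s \<bullet> x (r + s)) integrable_on cbox (-\<tau> i) 0" if "r \<in> {\<tau> K<..}" for r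
        using set_borel_integral_eq_integral(1)[OF int[OF that]] by simp
      have "continuous_on ({\<tau> K<..} \<times> I i) (\<lambda>z. rhs x (fst z + snd z))"
      proof (rule continuous_on_compose2[OF crhs])
        show "continuous_on ({\<tau> K<..} \<times> I i) (\<lambda>z. fst z + snd z)"
          by (intro continuous_intros)
        show "(\<lambda>z. fst z + snd z) ` ({\<tau> K<..} \<times> I i) \<subseteq> {0..}"
        proof
          fix y assume "y \<in> (\<lambda>z. fst z + snd z) ` ({\<tau> K<..} \<times> I i)"
          then obtain z where "z \<in> {\<tau> K<..} \<times> I i" and y: "y = fst z + snd z" by (rule imageE)
          then have "0 < fst z + snd z" by (intro pos) (simp_all only: mem_Times_iff)
          then show "y \<in> {0..}" unfolding y by simp
        qed
      qed
      moreover have "continuous_on ({\<tau> K<..} \<times> I i) (\<lambda>z. \<phi> i (snd z))"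
        by (rule continuous_on_compose2[OF E_cont[OF \<phi> i]]) (auto intro!: continuous_intros)
      ultimately show "continuous_on ({\<tau> K<..} \<times> cbox (-\<tau> i) 0) (\<lambda>(r, s). \<phi> i s \<bullet> rhs x (r + s))"
        unfolding split_beta by (simp add: continuous_on_inner)
    qed (use t in auto)
    then have D: "((\<lambda>r. integral (I i) (\<lambda>s. \<phi> i s \<bullet> x (r + s))) has_real_derivative
        (LBINT s:I i. \<phi> i s \<bullet> rhs x (t + s))) (at t)"
      unfolding set_borel_integral_eq_integral(2)[OF int'] interval_cbox[symmetric]
        at_within_open[of t "{\<tau> K<..}", OF _ open_greaterThan, unfolded greaterThan_iff, OF t] .
    show ?thesis
    proof (rule has_field_derivative_transform_within_open[OF D open_greaterThan])
      show "t \<in> {\<tau> K<..}" using t by simp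
      show "integral (I i) (\<lambda>s. \<phi> i s \<bullet> x (r + s)) = (LBINT s:I i. \<phi> i s \<bullet> x (r + s))"
        if "r \<in> {\<tau> K<..}" for r
        by (rule set_borel_integral_eq_integral(2)[OF int[OF that], symmetric])
    qed
  qed
  have head: "((\<lambda>r. \<tau> K * (\<phi> 1 0 \<bullet> x (r + 0))) has_real_derivative \<tau> K * (\<phi> 1 0 \<bullet> rhs x (t + 0))) (at t)"
    by (rule DERIV_cmult[OF inner]) (use t \<tau>K_pos in simp)
  show ?thesis
    unfolding ip_def using DERIV_add[OF head DERIV_sum[of "{1..K}", OF part]] by simp
qed

text \<open>By self-adjointness, \<open>V r - V t\<close> is \<open>2 \<langle>z t, w r - w t\<rangle>\<close> plus a term quadratic in \<open>w r - w t\<close>, so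
  that differentiability of \<open>z\<close> is not required.\<close>

lemma Lyapunov_derivative:
  assumes x: "continuous_on {-\<tau> K..} x"
    and d: "\<And>t. 0 < t \<Longrightarrow> (x has_vector_derivative rhs x t) (at t)" and t: "\<tau> K < t"
    and zE: "\<And>t. 0 \<le> t \<Longrightarrow> z t \<in> E"
    and Tz: "\<And>t i s. 0 \<le> t \<Longrightarrow> i \<in> {1..K} \<Longrightarrow> s \<in> I i \<Longrightarrow> T (z t) i s = x (t + s)"
  shows "((\<lambda>t. ip (z t) (T (z t))) has_real_derivative D_form (z t)) (at t)"
proof -
  define U where "U r = ip (z t) (\<lambda>i s. x (r + s))" for r
  define U' where "U' = \<tau> K * (z t 1 0 \<bullet> rhs x t) + (\<Sum>i=1..K. LBINT s:I i. z t i s \<bullet> rhs x (t + s))"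
  have t0: "0 \<le> t" using t \<tau>K_pos by simp
  have DU: "(U has_real_derivative U') (at t)"
    unfolding U_def[abs_def] U'_def by (rule ip_history_derivative[OF zE[OF t0] x d t])
  \<comment> \<open>Keeps every time \<open>r + s\<close> with
    \<open>\<bar>r - t\<bar> < \<delta>\<close> in a compact interval of positive times, on which
    the solution is Lipschitz with constant \<open>\<Lambda>\<close>.\<close>
  define \<delta> where "\<delta> = (t - \<tau> K) / 2"
  have \<delta>: "0 < \<delta>" "0 < t - \<tau> K - \<delta>" using t by (auto simp: \<delta>_def)
  have "continuous_on {t - \<tau> K - \<delta>..t + \<delta>} (rhs x)"
    by (rule continuous_on_subset[OF rhs_continuous[OF x]]) (use \<delta> in auto)
  then have "bounded (rhs x ` {t - \<tau> K - \<delta>..t + \<delta>})"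
    by (intro compact_imp_bounded compact_continuous_image) auto
  then obtain \<Lambda> where \<Lambda>: "\<And>r. r \<in> {t - \<tau> K - \<delta>..t + \<delta>} \<Longrightarrow> norm (rhs x r) \<le> \<Lambda>"
    unfolding bounded_iff by (metis image_eqI)
  define c where "c = \<tau> K + (\<Sum>i=1..K. \<tau> i)"
  \<comment> \<open>The remainder equals \<open>ip e (T e)\<close> with \<open>e\<close> the
    difference of \<open>z r\<close> and \<open>z t\<close>. By \<open>ip_T_le\<close> it is
    controlled by \<open>T e\<close>, the increment of the history, which is of order
    \<open>\<bar>r - t\<bar>\<close>.\<close>
  define W where "W r = ip (z r) (T (z r)) - ip (z t) (T (z t)) - 2 * (U r - U t)" for r
  have W: "\<bar>W r\<bar> \<le> (c * \<Lambda>\<^sup>2 / \<epsilon>) * (r - t)\<^sup>2" if r: "\<bar>r - t\<bar> < \<delta>" for r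
  proof -
    have r0: "0 \<le> r" using r \<delta> \<tau>K_pos by linarith
    let ?e = "\<lambda>i s. z r i s - z t i s"
    have e: "?e \<in> E" by (rule E_diff[OF zE[OF r0] zE[OF t0]])
    note Er = zE[OF r0] T_in_E[OF zE[OF r0]] and Et = zE[OF t0] T_in_E[OF zE[OF t0]]
    have Te: "T ?e i s = x (r + s) - x (t + s)" if "i \<in> {1..K}" "s \<in> I i" for i s
      unfolding T_diff[OF zE[OF r0] zE[OF t0] that] Tz[OF r0 that] Tz[OF t0 that] ..
    have "ip ?e (T ?e) = ip ?e (\<lambda>i s. T (z r) i s - T (z t) i s)"
      by (rule ip_cong[OF refl T_diff[OF zE[OF r0] zE[OF t0]]])
    also have "\<dots> = ip (z r) (T (z r)) - 2 * ip (z t) (T (z r)) + ip (z t) (T (z t))"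
      unfolding ip_diff_right[OF Er(2) Et(2) e] ip_diff_left[OF Er(1) Et(1) Er(2)] ip_diff_left[OF Er(1) Et(1) Et(2)]
        T_self_adjoint[OF Er(1) Et(1)] ip_commute[of "T (z r)"] by simp
    also have "ip (z t) (T (z r)) = U r" unfolding U_def by (rule ip_cong[OF refl Tz[OF r0]])
    finally have "ip ?e (T ?e) = ip (z r) (T (z r)) - 2 * U r + ip (z t) (T (z t))" .
    moreover have "ip (z t) (T (z t)) = U t" unfolding U_def by (rule ip_cong[OF refl Tz[OF t0]])
    ultimately have eq: "W r = ip ?e (T ?e)" by (simp add: W_def)
    have "norm (x (r + s) - x (t + s)) \<le> \<Lambda> * \<bar>r - t\<bar>" if "i \<in> {1..K}" "s \<in> I i" for i s
    proof -
      have "r + s \<in> {t - \<tau> K - \<delta>..t + \<delta>}" "t + s \<in> {t - \<tau> K - \<delta>..t + \<delta>}"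
        using that r \<tau>_le[OF that(1)] \<delta> by (auto simp: abs_less_iff)
      moreover have "(x has_vector_derivative rhs x q) (at q)" if "q \<in> {t - \<tau> K - \<delta>..t + \<delta>}" for q
        using that \<delta> by (intro d) auto
      ultimately have "norm (x (r + s) - x (t + s)) \<le> \<Lambda> * \<bar>(r + s) - (t + s)\<bar>"
        by (intro norm_diff_le_derivative_bound[OF _ \<Lambda>])
      then show ?thesis by simp
    qed
    then have "ip (T ?e) (T ?e) \<le> c * (\<Lambda> * \<bar>r - t\<bar>)\<^sup>2"
      unfolding c_def by (intro ip_sup_le T_in_E e) (simp only: Te)
    then have "ip (T ?e) (T ?e) / \<epsilon> \<le> c * (\<Lambda> * \<bar>r - t\<bar>)\<^sup>2 / \<epsilon>" using \<epsilon> by (simp add: divide_right_mono)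
    then show ?thesis using ip_T_le[OF e] unfolding eq by (simp add: power_mult_distrib)
  qed
  have "(W has_real_derivative 0) (at t)" by (rule DERIV_zero_of_quadratic_bound[OF \<delta>(1) W])
  then have "((\<lambda>r. (W r + ip (z t) (T (z t))) + 2 * (U r - U t)) has_real_derivative (0 + 0) + 2 * (U' - 0)) (at t)"
    by (intro DERIV_add DERIV_cmult DERIV_diff DU DERIV_const)
  moreover have "(W r + ip (z t) (T (z t))) + 2 * (U r - U t) = ip (z r) (T (z r))" for r by (simp add: W_def)
  ultimately have D: "((\<lambda>r. ip (z r) (T (z r))) has_real_derivative 2 * U') (at t)" by simp
  have "2 * U' = D_form (z t)"
  proof -
    have h: "A 0 *v T (z t) 1 0 + (\<Sum>i=1..K. A i *v T (z t) i (-\<tau> i)) = rhs x t"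
    proof -
      have "(\<Sum>i=1..K. A i *v T (z t) i (-\<tau> i)) = (\<Sum>i=1..K. A i *v x (t - \<tau> i))"
      proof (rule sum.cong[OF refl])
        fix i assume "i \<in> {1..K}"
        from Tz[OF t0 this left_mem[OF this]]
        show "A i *v T (z t) i (-\<tau> i) = A i *v x (t - \<tau> i)" by (simp only: add_uminus_conv_diff)
      qed
      moreover have "T (z t) 1 0 = x t" using Tz[OF t0 one_mem zero_mem[OF one_mem]] by simp
      ultimately show ?thesis by (simp only: rhs_def)
    qed
    have "2 * (\<tau> K * (z t 1 0 \<bullet> (A 0 *v T (z t) 1 0 + (\<Sum>i=1..K. A i *v T (z t) i (-\<tau> i))))
      + (\<Sum>i=1..K. LBINT s:I i. z t i s \<bullet> rhs x (t + s))) = D_form (z t)"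
    proof (rule D_identity[OF zE[OF t0], where f = "\<lambda>i s. rhs x (t + s)"])
      fix i assume i: "i \<in> {1..K}"
      show "continuous_on (I i) (\<lambda>s. rhs x (t + s))"
        by (rule continuous_on_compose2[OF rhs_continuous[OF x]])
          (use t \<tau>_le[OF i] in \<open>auto intro!: continuous_intros\<close>)
      fix s assume s: "s \<in> I i"
      have "0 < t + s" using s t \<tau>_le[OF i] by auto
      then have "((\<lambda>s. x (t + s)) has_vector_derivative rhs x (t + s)) (at s within (I i))"
        by (rule has_vector_derivative_at_within[OF shifted_derivative(2)[OF d]])
      then show "(T (z t) i has_vector_derivative rhs x (t + s)) (at s within (I i))"
        by (rule has_vector_derivative_transform[OF s, rotated]) (rule Tz[OF t0 i])
    qed
    then show ?thesis unfolding h U'_def .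
  qed
  with D show ?thesis by simp
qed

lemma exponentially_stable_system: "exponentially_stable K \<tau> A"
proof -
  \<comment> \<open>\<open>Lyapunov_derivative\<close> requires times strictly beyond
    \<open>\<tau> K\<close>; up to \<open>T0\<close> the crude bound \<open>m\<close> is
    used.\<close>
  define T0 where "T0 = \<tau> K + 1"
  have T0: "\<tau> K < T0" "0 \<le> T0" using \<tau>K_pos by (auto simp: T0_def)
  obtain m where m: "0 < m" "\<forall>\<phi>\<^sub>0 x. continuous_on {-\<tau> K..0} \<phi>\<^sub>0 \<longrightarrow> delay_solution K \<tau> A \<phi>\<^sub>0 x \<longrightarrow>
    (\<forall>t\<in>{-\<tau> K..T0}. norm (x t) \<le> m * (SUP s\<in>{-\<tau> K..0}. norm (\<phi>\<^sub>0 s)))"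
    using short_time_bound[OF T0(2)] by blast
  obtain L where L: "0 < L" "\<forall>\<phi>\<in>E. nrm (T \<phi>) \<le> L * nrm \<phi>" using nrm_T_le by blast
  have L2: "ip (T \<phi>) (T \<phi>) \<le> L\<^sup>2 * ip \<phi> \<phi>" if "\<phi> \<in> E" for \<phi>
    using power_mono[OF L(2)[rule_format, OF that] nrm_nonneg, of 2] by (simp only: nrm_square power_mult_distrib)
  \<comment> \<open>Young's inequality bounds the Lyapunov function by
    \<open>(1 + L\<^sup>2) / 2\<close> times the squared norm of \<open>z t\<close>, so dissipation
    gives it the decay rate \<open>2 * b\<close>. As it is quadratic in the solution, the solution
    decays with rate \<open>b\<close>.\<close>
  define b where "b = 1 / (1 + L\<^sup>2)"
  have L21: "0 < 1 + L\<^sup>2" by (simp add: add_pos_nonneg)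
  have b: "0 < b" using L21 by (simp add: b_def)
  define c where "c = (\<tau> K + (\<Sum>i=1..K. \<tau> i))"
  have c: "0 < c" unfolding c_def using \<tau>K_pos \<tau>_pos by (intro add_pos_nonneg sum_nonneg) (auto intro: less_imp_le)
  \<comment> \<open>The root collects the chain from \<open>(norm (x t))\<^sup>2\<close> to the
    history at \<open>T0\<close>: one factor \<open>1 / \<tau> K\<close> from the head,
    \<open>L\<^sup>2 / \<epsilon>\<close> from passing to the Lyapunov function at \<open>t\<close>,
    and \<open>c / \<epsilon>\<close> from bounding it at \<open>T0\<close>. The added
    \<open>m\<close> covers times before \<open>T0\<close>.\<close>
  define N where "N = sqrt (L\<^sup>2 * c / (\<epsilon> * \<epsilon> * \<tau> K)) * m + m"
  have N: "0 < N" unfolding N_def using m(1) c \<epsilon> \<tau>K_pos by (intro add_nonneg_pos mult_nonneg_nonneg) auto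
  have "norm (x t) \<le> (N * exp (b * T0)) * exp (- b * t) * (SUP s\<in>{-\<tau> K..0}. norm (\<phi>\<^sub>0 s))"
    if c0: "continuous_on {-\<tau> K..0} \<phi>\<^sub>0" and sol: "delay_solution K \<tau> A \<phi>\<^sub>0 x" and t: "0 \<le> t" for \<phi>\<^sub>0 x t
  proof -
    define \<Phi> where "\<Phi> = (SUP s\<in>{-\<tau> K..0}. norm (\<phi>\<^sub>0 s))"
    have short: "norm (x t) \<le> m * \<Phi>" if "t \<in> {-\<tau> K..T0}" for t
      unfolding \<Phi>_def using m(2) c0 sol that by blast
    have "0 \<le> m * \<Phi>" using order_trans[OF norm_ge_zero short[of 0]] T0(2) \<tau>K_pos by simp
    then have \<Phi>0: "0 \<le> \<Phi>" using m(1) by (simp add: zero_le_mult_iff)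
    have cx: "continuous_on {-\<tau> K..} x" by (rule solution_continuous[OF c0 sol])
    \<comment> \<open>A preimage is chosen separately at each time;
      \<open>Lyapunov_derivative\<close> asks nothing about how it depends on
      \<open>t\<close>.\<close>
    define z where "z t = (SOME \<phi>. \<phi> \<in> E \<and> (\<forall>i\<in>{1..K}. \<forall>s\<in>(I i). T \<phi> i s = x (t + s)))" for t
    have z: "z t \<in> E \<and> (\<forall>i\<in>{1..K}. \<forall>s\<in>(I i). T (z t) i s = x (t + s))" if "0 \<le> t" for t
    proof -
      have "\<exists>\<phi>. \<phi> \<in> E \<and> (\<forall>i\<in>{1..K}. \<forall>s\<in>(I i). T \<phi> i s = x (t + s))"
        using T_surjective[OF history_in_E[OF cx that]] by blast
      from someI_ex[OF this] show ?thesis unfolding z_def .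
    qed
    have zE: "z t \<in> E" if "0 \<le> t" for t using z[OF that] by blast
    have Tz: "T (z t) i s = x (t + s)" if "0 \<le> t" "i \<in> {1..K}" "s \<in> I i" for t i s
      using z[OF that(1)] that(2,3) by blast
    define V where "V t = ip (z t) (T (z t))" for t
    have DV: "(V has_real_derivative D_form (z t)) (at t)" if "T0 \<le> t" for t
      unfolding V_def[abs_def]
      by (rule Lyapunov_derivative[OF cx solution_derivative[OF sol] _ zE Tz]) (use that T0 in auto)
    have V_le: "V t \<le> ip (z t) (z t) / (2 * b)" if "0 \<le> t" for t
    proof -
      have "V t \<le> 1 / 2 * ip (z t) (z t) + ip (T (z t)) (T (z t)) / (2 * 1)"
        unfolding V_def by (rule ip_le_mean[OF zE[OF that] T_in_E[OF zE[OF that]]]) simp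
      also have "\<dots> \<le> (1 + L\<^sup>2) / 2 * ip (z t) (z t)"
        using L2[OF zE[OF that]] by (simp add: field_simps)
      also have "\<dots> = ip (z t) (z t) / (2 * b)" unfolding b_def by simp
      finally show ?thesis .
    qed
    have dec: "D_form (z t) \<le> - (2 * b) * V t" if "0 \<le> t" for t
    proof -
      have "2 * b * V t \<le> ip (z t) (z t)" using V_le[OF that] b by (simp add: field_simps)
      then show ?thesis using dissipative_E[OF zE[OF that]] by simp
    qed
    have decay: "V t \<le> V T0 * exp (- (2 * b) * (t - T0))" if t: "T0 \<le> t" for t
    proof -
      have "V t * exp (2 * b * t) \<le> V T0 * exp (2 * b * T0)"
      proof (rule DERIV_nonpos_imp_nonincreasing[OF t])
        fix r assume r: "T0 \<le> r" "r \<le> t"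
        have "((\<lambda>t. V t * exp (2 * b * t)) has_real_derivative
            D_form (z r) * exp (2 * b * r) + exp (2 * b * r) * (2 * b) * V r) (at r)"
          by (rule DERIV_mult[OF DV[OF r(1)]]) (auto intro!: derivative_eq_intros)
        moreover have "D_form (z r) * exp (2 * b * r) + exp (2 * b * r) * (2 * b) * V r
            = (D_form (z r) + 2 * b * V r) * exp (2 * b * r)" by (simp add: algebra_simps)
        moreover have "\<dots> \<le> 0" using dec[of r] r T0(2) by (intro mult_nonpos_nonneg) auto
        ultimately show "\<exists>y. ((\<lambda>t. V t * exp (2 * b * t)) has_real_derivative y) (at r) \<and> y \<le> 0" by metis
      qed
      then have "V t * exp (2 * b * t) * exp (- (2 * b * t)) \<le> V T0 * exp (2 * b * T0) * exp (- (2 * b * t))"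
        by (rule mult_right_mono) simp
      then show ?thesis by (simp add: mult.assoc exp_add[symmetric] algebra_simps)
    qed
    have ipT: "ip (T (z T0)) (T (z T0)) \<le> c * (m * \<Phi>)\<^sup>2"
      unfolding c_def
    proof (rule ip_sup_le[OF T_in_E[OF zE[OF T0(2)]]])
      show "norm (T (z T0) i s) \<le> m * \<Phi>" if "i \<in> {1..K}" "s \<in> I i" for i s
        unfolding Tz[OF T0(2) that] by (rule short) (use that \<tau>_le[OF that(1)] T0 in auto)
    qed
    have "V T0 \<le> ip (T (z T0)) (T (z T0)) / \<epsilon>" unfolding V_def by (rule ip_T_le[OF zE[OF T0(2)]])
    also have "\<dots> \<le> c * (m * \<Phi>)\<^sup>2 / \<epsilon>" using ipT \<epsilon> by (simp add: divide_right_mono)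
    finally have VT0: "V T0 \<le> c * (m * \<Phi>)\<^sup>2 / \<epsilon>" .
    have late: "norm (x t) \<le> sqrt (L\<^sup>2 * c / (\<epsilon> * \<epsilon> * \<tau> K)) * m * \<Phi> * exp (- b * (t - T0))" if t: "T0 \<le> t" for t
    proof -
      have t0: "0 \<le> t" using t T0 by simp
      have "x t = T (z t) 1 0" using Tz[OF t0 one_mem zero_mem[OF one_mem]] by simp
      then have "norm (x t) \<le> nrm (T (z t)) / sqrt (\<tau> K)" using norm_head_le by metis
      then have "(norm (x t))\<^sup>2 \<le> (nrm (T (z t)) / sqrt (\<tau> K))\<^sup>2" by (rule power_mono) simp
      also have "\<dots> = ip (T (z t)) (T (z t)) / \<tau> K"
        unfolding power_divide nrm_square using \<tau>K_pos by simp
      also have "\<dots> \<le> (L\<^sup>2 * (V t / \<epsilon>)) / \<tau> K"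
      proof (rule divide_right_mono[OF order_trans[OF L2[OF zE[OF t0]]] less_imp_le[OF \<tau>K_pos]])
        have "ip (z t) (z t) \<le> V t / \<epsilon>" using coercive_E[OF zE[OF t0]] \<epsilon> unfolding V_def by (simp add: field_simps)
        then show "L\<^sup>2 * ip (z t) (z t) \<le> L\<^sup>2 * (V t / \<epsilon>)" by (rule mult_left_mono) simp
      qed
      also have "\<dots> \<le> (L\<^sup>2 * ((c * (m * \<Phi>)\<^sup>2 / \<epsilon> * exp (- (2 * b) * (t - T0))) / \<epsilon>)) / \<tau> K"
      proof (intro divide_right_mono mult_left_mono)
        have "V T0 * exp (- (2 * b) * (t - T0)) \<le> c * (m * \<Phi>)\<^sup>2 / \<epsilon> * exp (- (2 * b) * (t - T0))"
          by (rule mult_right_mono[OF VT0]) simp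
        then show "V t \<le> c * (m * \<Phi>)\<^sup>2 / \<epsilon> * exp (- (2 * b) * (t - T0))" using decay[OF t] by linarith
      qed (use \<epsilon> \<tau>K_pos in auto)
      also have "\<dots> = (L\<^sup>2 * c / (\<epsilon> * \<epsilon> * \<tau> K)) * (m * \<Phi>)\<^sup>2 * (exp (- b * (t - T0)))\<^sup>2"
      proof -
        have "exp (- (2 * b) * (t - T0)) = (exp (- b * (t - T0)))\<^sup>2"
          by (simp add: power2_eq_square exp_add[symmetric] algebra_simps)
        then show ?thesis by (simp add: field_simps)
      qed
      also have "\<dots> = (sqrt (L\<^sup>2 * c / (\<epsilon> * \<epsilon> * \<tau> K)) * m * \<Phi> * exp (- b * (t - T0)))\<^sup>2"
        using c \<epsilon> \<tau>K_pos by (simp add: power_mult_distrib)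
      finally show ?thesis
        by (rule power2_le_imp_le) (use m(1) \<Phi>0 c \<epsilon> \<tau>K_pos in auto)
    qed
    have "norm (x t) \<le> N * \<Phi> * exp (- b * (t - T0))"
    proof (cases "T0 \<le> t")
      case True
      have "norm (x t) \<le> sqrt (L\<^sup>2 * c / (\<epsilon> * \<epsilon> * \<tau> K)) * m * \<Phi> * exp (- b * (t - T0))" by (rule late[OF True])
      also have "\<dots> \<le> N * \<Phi> * exp (- b * (t - T0))"
        unfolding N_def using m(1) \<Phi>0 by (intro mult_right_mono) auto
      finally show ?thesis .
    next
      case False
      have "norm (x t) \<le> m * \<Phi>" by (rule short) (use False t \<tau>K_pos in auto)
      also have "\<dots> \<le> N * \<Phi> * 1"
        unfolding N_def using m(1) \<Phi>0 c \<epsilon> \<tau>K_pos by (simp add: distrib_right)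
      also have "\<dots> \<le> N * \<Phi> * exp (- b * (t - T0))"
        using N \<Phi>0 b False by (intro mult_left_mono) (auto intro: mult_nonneg_nonpos)
      finally show ?thesis .
    qed
    also have "\<dots> = (N * exp (b * T0)) * exp (- b * t) * \<Phi>"
      by (simp add: exp_add[symmetric] algebra_simps exp_diff)
    finally show ?thesis unfolding \<Phi>_def .
  qed
  then show ?thesis
    unfolding exponentially_stable_def using N b by (intro exI[of _ "N * exp (b * T0)"] exI[of _ b] conjI) auto
qed

end

theorem theorem5:
  fixes K :: nat and \<tau> :: "nat \<Rightarrow> real"
    and A :: "nat \<Rightarrow> real ^ 'n::finite ^ 'n"
    and P :: "real ^ 'n ^ 'n"
    and Q S :: "nat \<Rightarrow> real \<Rightarrow> real ^ 'n ^ 'n"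
    and R :: "nat \<Rightarrow> nat \<Rightarrow> real \<times> real \<Rightarrow> real ^ 'n ^ 'n"
    and \<epsilon> :: real
  assumes "1 \<le> K" and "0 < \<tau> 1" and "strict_mono_on {1..K} \<tau>"
    and "\<And>i. i \<in> {1..K} \<Longrightarrow> S i \<in> W2 {-\<tau> i..0}"
    and "\<And>i j. i \<in> {1..K} \<Longrightarrow> j \<in> {1..K} \<Longrightarrow> R i j \<in> W2 ({-\<tau> i..0} \<times> {-\<tau> j..0})"
    and "\<And>j. j \<in> {1..K} \<Longrightarrow> Q j \<in> W2 {-\<tau> j..0}"
    and "\<And>i j. i \<in> {1..K} \<Longrightarrow> j \<in> {1..K} \<Longrightarrow> (\<lambda>s. R i j (-\<tau> i, s)) \<in> W2 {-\<tau> j..0}"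
    and "\<And>i s. i \<in> {1..K} \<Longrightarrow> s \<in> {-\<tau> i..0} \<Longrightarrow> S i s = transpose (S i s)"
    and "\<And>i j s \<theta>. i \<in> {1..K} \<Longrightarrow> j \<in> {1..K} \<Longrightarrow> s \<in> {-\<tau> i..0} \<Longrightarrow> \<theta> \<in> {-\<tau> j..0} \<Longrightarrow>
           R i j (s, \<theta>) = transpose (R j i (\<theta>, s))"
    and "\<And>i. i \<in> {1..K} \<Longrightarrow> P = \<tau> K *\<^sub>R transpose (Q i 0) + \<tau> K *\<^sub>R S i 0"
    and "\<And>i j s. i \<in> {1..K} \<Longrightarrow> j \<in> {1..K} \<Longrightarrow> s \<in> {-\<tau> j..0} \<Longrightarrow> Q j s = R i j (0, s)"
    and "0 < \<epsilon>"
    and "\<And>z. z \<in> X_space K \<tau> \<Longrightarrow>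
           Z_inner inner K \<tau> z (P_op K \<tau> P Q S R z) \<ge> \<epsilon> * (Z_norm K \<tau> z)\<^sup>2"
    and "\<And>x \<phi>. (x, \<phi>) \<in> X_space K \<tau> \<Longrightarrow>
           Z_inner (block_inner K) K \<tau> (boundary_vec \<tau> x \<phi>, \<phi>)
             (D_op K \<tau> A P Q S R (boundary_vec \<tau> x \<phi>, \<phi>)) \<le> - (Z_norm K \<tau> (x, \<phi>))\<^sup>2"
  shows "exponentially_stable K \<tau> A"
proof -
  interpret delay_stability K \<tau> P Q S R \<epsilon> A
    by unfold_locales (fact assms)+
  show ?thesis by (rule exponentially_stable_system)
qed

end
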